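(* Let $M_0$ be a Riemannian manifold with a Lie structure $(M,\mathcal V,g)$ at infinity, $A=A_{\mathcal V}$, and let $\nabla$ be the Levi-Civita connection of $(M_0,g)$ (extended to an $A^*$-valued connection on $A$). Then the Riemannian curvature tensor $R(X,Y)$ extends to an endomorphism of $A$, for all $X,Y\in\Gamma(A)$. Moreover, each covariant derivative $\nabla^kR$ extends to a section of $A^{*\otimes k}\otimes\Lambda^2A^*\otimes\mathrm{End}(A)$ over $M$, and hence all the $\nabla^kR$ are bounded on $M_0$ (with respect to $g$).
   Context: Manifolds may have corners: they are locally modelled on $[0,\infty)^k\times\mathbb R^{n-k}$, and each hyperface (codimension one boundary face) $H$ is assumed embedded with a smooth defining function $x_H\ge 0$, $H=\{x_H=0\}$, $dx_H\ne 0$ on $H$. $\partial M$ is the union of all hyperfaces and $M\smallsetminus\partial M$ is the interior. A smooth manifold has no corners. A structural Lie algebra of vector fields on $M$ is a real subspace $\mathcal V\subset\Gamma(TM)$ that (i) is closed under Lie brackets, (ii) is closed under multiplication by $C^\infty(M)$ and is a finitely generated projective $C^\infty(M)$-module, (iii) consists of vector fields tangent to all faces of $M$. By the Serre–Swan theorem there is a vector bundle $A=A_{\mathcal V}\to M$ with $\mathcal V\cong\Gamma(A)$ as $C^\infty(M)$-modules, and a bundle map $\varrho:A\to TM$ (the anchor) inducing on sections the inclusion $\mathcal V\subset\Gamma(TM)$. A Lie structure at infinity on a smooth manifold $M_0$ is a pair $(M,\mathcal V)$ where $M$ is a compact manifold, possibly with corners, with interior $M_0$, $\mathcal V$ is a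 structural Lie algebra of vector fields on $M$, and $\varrho|_{M_0}:A|_{M_0}\to TM_0$ is a fiberwise isomorphism (used to identify $A|_{M_0}$ with $TM_0$). With a Riemannian metric $g$ on $A$ (a smooth positive definite symmetric 2-tensor on $A$ over all of $M$), which induces a Riemannian metric $g$ on $M_0$, one calls $M_0$ a Riemannian manifold with a Lie structure $(M,\mathcal V,g)$ at infinity. The curvature is $R(X,Y)=\nabla_X\nabla_Y-\nabla_Y\nabla_X-\nabla_{[X,Y]}$, regarded as a section of $\Lambda^2T^*M_0\otimes\mathrm{End}(TM_0)$, so that $\nabla^kR\in\Gamma(T^*M_0^{\otimes k}\otimes\Lambda^2T^*M_0\otimes\mathrm{End}(TM_0))$. An $A^*$-valued connection on a vector bundle $E\to M$ is a differential operator $D:\Gamma(E)\to\Gamma(E\otimes A^* )$ with $D_X(f\xi)=fD_X\xi+X(f)\xi$ and $D_{fX}\xi=fD_X\xi$ for $X\in\Gamma(A)$, $f\in C^\infty(M)$, $\xi\in\Gamma(E)$, where $X(f)$ is the action of the vector field $\varrho(X)$. The Levi-Civita connection of $(M_0,g)$ extends from $TM_0=A|_{M_0}$ to an $A^*$-valued connection on $A$, and hence functorially to tensor bundles built from $A$ and $A^*$. *)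

theory Defs
  imports "HOL-Analysis.Analysis" "HOL-Library.Function_Algebras"
begin

text \<open>Functions into a real vector space, with the pointwise operations. This covers real functions,
  tangent vectors (functionals on functions), vector fields and sections.\<close>

instantiation "fun" :: (type, real_vector) real_vector
begin

definition scaleR_fun :: "real \<Rightarrow> ('a \<Rightarrow> 'b) \<Rightarrow> 'a \<Rightarrow> 'b"
  where "scaleR_fun c f = (\<lambda>x. c *\<^sub>R f x)"

instance
  by standard (simp_all add: scaleR_fun_def fun_eq_iff scaleR_add_right scaleR_add_left)

end

definition linear_map_on :: "'a::real_vector set \<Rightarrow> ('a \<Rightarrow> 'b::real_vector) \<Rightarrow> bool" where
  "linear_map_on S h \<longleftrightarrow>
     (\<forall>x\<in>S. \<forall>y\<in>S. h (x + y) = h x + h y) \<and> (\<forall>c. \<forall>x\<in>S. h (c *\<^sub>R x) = c *\<^sub>R h x)"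


section \<open>Manifolds with corners\<close>

fun C_k_on :: "nat \<Rightarrow> ('e::euclidean_space \<Rightarrow> 'b::real_normed_vector) \<Rightarrow> 'e set \<Rightarrow> bool" where
  "C_k_on 0 f U \<longleftrightarrow> continuous_on U f"
| "C_k_on (Suc k) f U \<longleftrightarrow>
     (\<forall>x\<in>U. f differentiable (at x)) \<and> (\<forall>v. C_k_on k (\<lambda>x. frechet_derivative f (at x) v) U)"

text \<open>Smoothness on a set that need not be open, e.g. a piece of a corner: local existence of
  smooth extensions.\<close>

definition smooth_on :: "'e::euclidean_space set \<Rightarrow> ('e \<Rightarrow> 'b::real_normed_vector) \<Rightarrow> bool" where
  "smooth_on S f \<longleftrightarrow>
     (\<forall>x\<in>S. \<exists>W F. open W \<and> x \<in> W \<and> (\<forall>k. C_k_on k F W) \<and> (\<forall>y\<in>W \<inter> S. F y = f y))"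

text \<open>The model corner \<open>[0,\<infinity>)\<^sup>k \<times> \<real>\<^sup>n\<^sup>-\<^sup>k\<close> for \<open>n = card N\<close>, \<open>k = card B\<close>, where
  \<open>B \<subseteq> N \<subseteq> Basis\<close>. The coordinate set \<open>N\<close> may be smaller than \<open>Basis\<close> because no type of class
  euclidean space has dimension 0.\<close>

definition corner :: "'e::euclidean_space set \<Rightarrow> 'e set \<Rightarrow> 'e set" where
  "corner N B = {x \<in> span N. \<forall>b\<in>B. 0 \<le> x \<bullet> b}"

text \<open>A chart \<open>(U, \<phi>, B)\<close> consists of its domain, the coordinate map, and the set of coordinates
  that are constrained to be nonnegative in its model corner.\<close>

type_synonym ('m, 'e) chart = "'m set \<times> ('m \<Rightarrow> 'e) \<times> 'e set"

definition is_chart :: "'e::euclidean_space set \<Rightarrow> ('m::t2_space, 'e) chart \<Rightarrow> bool" where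
  "is_chart N = (\<lambda>(U, \<phi>, B). open U \<and> B \<subseteq> N \<and> openin (top_of_set (corner N B)) (\<phi> ` U) \<and>
     inj_on \<phi> U \<and> homeomorphism U (\<phi> ` U) \<phi> (inv_into U \<phi>))"

definition corner_atlas :: "('m::t2_space, 'e::euclidean_space) chart set \<Rightarrow> bool" where
  "corner_atlas \<A> \<longleftrightarrow>
     (\<exists>N\<subseteq>Basis. \<forall>c\<in>\<A>. is_chart N c) \<and>
     (\<forall>p. \<exists>(U, \<phi>, B)\<in>\<A>. p \<in> U) \<and>
     (\<forall>(U, \<phi>, B)\<in>\<A>. \<forall>(U', \<phi>', B')\<in>\<A>. smooth_on (\<phi> ` (U \<inter> U')) (\<phi>' \<circ> inv_into U \<phi>))"

definition smooth_fn :: "('m::t2_space, 'e::euclidean_space) chart set \<Rightarrow> 'm set \<Rightarrow> ('m \<Rightarrow> real) \<Rightarrow> bool"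
  where "smooth_fn \<A> W f \<longleftrightarrow> (\<forall>(U, \<phi>, B)\<in>\<A>. smooth_on (\<phi> ` (U \<inter> W)) (f \<circ> inv_into U \<phi>))"

definition smooth_near :: "('m::t2_space, 'e::euclidean_space) chart set \<Rightarrow> 'm \<Rightarrow> ('m \<Rightarrow> real) \<Rightarrow> bool"
  where "smooth_near \<A> p f \<longleftrightarrow> (\<exists>W. open W \<and> p \<in> W \<and> smooth_fn \<A> W f)"

text \<open>Tangent vectors are derivations on germs of smooth functions; their value on functions that are
  not smooth near the point is normalised to 0.\<close>

type_synonym 'm tvec = "('m \<Rightarrow> real) \<Rightarrow> real"
type_synonym 'm vfield = "'m \<Rightarrow> 'm tvec"

definition tangent_space :: "('m::t2_space, 'e::euclidean_space) chart set \<Rightarrow> 'm \<Rightarrow> 'm tvec set" where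
  "tangent_space \<A> p = {v.
     (\<forall>f. \<not> smooth_near \<A> p f \<longrightarrow> v f = 0) \<and>
     (\<forall>f g. smooth_near \<A> p f \<and> eventually (\<lambda>q. f q = g q) (nhds p) \<longrightarrow> v f = v g) \<and>
     (\<forall>f g. smooth_near \<A> p f \<and> smooth_near \<A> p g \<longrightarrow> v (\<lambda>q. f q + g q) = v f + v g) \<and>
     (\<forall>f c. smooth_near \<A> p f \<longrightarrow> v (\<lambda>q. c * f q) = c * v f) \<and>
     (\<forall>f g. smooth_near \<A> p f \<and> smooth_near \<A> p g \<longrightarrow>
        v (\<lambda>q. f q * g q) = v f * g p + f p * v g)}"

text \<open>Points of codimension \<open>k\<close>, and boundary faces: closures of connected components of the set
  of points of codimension \<open>k\<close>.\<close>

definition codim_set :: "('m::t2_space, 'e::euclidean_space) chart set \<Rightarrow> nat \<Rightarrow> 'm set" where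
  "codim_set \<A> k = {p. \<exists>(U, \<phi>, B)\<in>\<A>. p \<in> U \<and> card {b\<in>B. \<phi> p \<bullet> b = 0} = k}"

definition faces :: "('m::t2_space, 'e::euclidean_space) chart set \<Rightarrow> nat \<Rightarrow> 'm set set" where
  "faces \<A> k = closure ` components (codim_set \<A> k)"

abbreviation hyperfaces :: "('m::t2_space, 'e::euclidean_space) chart set \<Rightarrow> 'm set set" where
  "hyperfaces \<A> \<equiv> faces \<A> 1"

definition mfd_boundary :: "('m::t2_space, 'e::euclidean_space) chart set \<Rightarrow> 'm set" where
  "mfd_boundary \<A> = \<Union> (hyperfaces \<A>)"

definition mfd_interior :: "('m::t2_space, 'e::euclidean_space) chart set \<Rightarrow> 'm set" where
  "mfd_interior \<A> = UNIV - mfd_boundary \<A>"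

definition defining_function ::
    "('m::t2_space, 'e::euclidean_space) chart set \<Rightarrow> 'm set \<Rightarrow> ('m \<Rightarrow> real) \<Rightarrow> bool" where
  "defining_function \<A> H x \<longleftrightarrow>
     smooth_fn \<A> UNIV x \<and> (\<forall>p. 0 \<le> x p) \<and> H = {p. x p = 0} \<and>
     (\<forall>p\<in>H. \<exists>v\<in>tangent_space \<A> p. v x \<noteq> 0)"

text \<open>A hyperface with a defining function is in particular embedded. The manifold is the whole type;
  countability is not required since only compact manifolds are considered.\<close>

definition manifold_with_corners :: "('m::t2_space, 'e::euclidean_space) chart set \<Rightarrow> bool" where
  "manifold_with_corners \<A> \<longleftrightarrow>
     corner_atlas \<A> \<and> (\<forall>H\<in>hyperfaces \<A>. \<exists>x. defining_function \<A> H x)"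


section \<open>Vector fields\<close>

text \<open>Smooth vector fields on an open set \<open>W\<close>; here and below, fields and sections over \<open>W\<close> are set to 0
  outside \<open>W\<close>, so that they are determined by their values on \<open>W\<close>.\<close>

definition vector_fields ::
    "('m::t2_space, 'e::euclidean_space) chart set \<Rightarrow> 'm set \<Rightarrow> 'm vfield set" where
  "vector_fields \<A> W = {X. (\<forall>p\<in>W. X p \<in> tangent_space \<A> p) \<and> (\<forall>p. p \<notin> W \<longrightarrow> X p = 0) \<and>
     (\<forall>W' f. open W' \<and> W' \<subseteq> W \<and> smooth_fn \<A> W' f \<longrightarrow> smooth_fn \<A> W' (\<lambda>p. X p f))}"

definition lie_bracket ::
    "('m::t2_space, 'e::euclidean_space) chart set \<Rightarrow> 'm vfield \<Rightarrow> 'm vfield \<Rightarrow> 'm vfield" where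
  "lie_bracket \<A> X Y = (\<lambda>p f.
     if smooth_near \<A> p f then X p (\<lambda>q. Y q f) - Y p (\<lambda>q. X q f) else 0)"

text \<open>\<open>v \<in> T\<^sub>pF\<close> for a face \<open>F\<close>: \<open>v\<close> annihilates the germs of smooth functions vanishing on \<open>F\<close>.\<close>

definition tangent_to ::
    "('m::t2_space, 'e::euclidean_space) chart set \<Rightarrow> 'm set \<Rightarrow> 'm \<Rightarrow> 'm tvec \<Rightarrow> bool" where
  "tangent_to \<A> F p v \<longleftrightarrow>
     (\<forall>f. smooth_near \<A> p f \<and> eventually (\<lambda>q. q \<in> F \<longrightarrow> f q = 0) (nhds p) \<longrightarrow> v f = 0)"


section \<open>Modules over the smooth functions\<close>

definition smooth_module_hom ::
    "('m::t2_space, 'e::euclidean_space) chart set \<Rightarrow> ('m \<Rightarrow> 'b::real_vector) set \<Rightarrow>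
     ('m \<Rightarrow> 'c::real_vector) set \<Rightarrow> (('m \<Rightarrow> 'b) \<Rightarrow> ('m \<Rightarrow> 'c)) \<Rightarrow> bool" where
  "smooth_module_hom \<A> P Q h \<longleftrightarrow>
     (\<forall>s\<in>P. h s \<in> Q) \<and> (\<forall>s\<in>P. \<forall>t\<in>P. h (s + t) = h s + h t) \<and>
     (\<forall>f. \<forall>s\<in>P. smooth_fn \<A> UNIV f \<longrightarrow> h (\<lambda>p. f p *\<^sub>R s p) = (\<lambda>p. f p *\<^sub>R h s p))"

text \<open>The free module of rank \<open>n\<close>: smooth maps to \<open>\<real>\<^sup>n\<close>, as sequences that vanish from index \<open>n\<close> on.\<close>

definition free_module ::
    "('m::t2_space, 'e::euclidean_space) chart set \<Rightarrow> nat \<Rightarrow> ('m \<Rightarrow> nat \<Rightarrow> real) set" where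
  "free_module \<A> n =
     {a. (\<forall>i<n. smooth_fn \<A> UNIV (\<lambda>p. a p i)) \<and> (\<forall>p. \<forall>i\<ge>n. a p i = 0)}"

text \<open>Finitely generated projective: a direct summand (retract) of a free module of finite rank.\<close>

definition fg_projective ::
    "('m::t2_space, 'e::euclidean_space) chart set \<Rightarrow> ('m \<Rightarrow> 'b::real_vector) set \<Rightarrow> bool" where
  "fg_projective \<A> P \<longleftrightarrow>
     (\<exists>n \<iota> \<pi>. smooth_module_hom \<A> P (free_module \<A> n) \<iota> \<and>
        smooth_module_hom \<A> (free_module \<A> n) P \<pi> \<and> (\<forall>s\<in>P. \<pi> (\<iota> s) = s))"

definition structural_lie_algebra ::
    "('m::t2_space, 'e::euclidean_space) chart set \<Rightarrow> 'm vfield set \<Rightarrow> bool" where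
  "structural_lie_algebra \<A> \<V> \<longleftrightarrow>
     \<V> \<subseteq> vector_fields \<A> UNIV \<and> subspace \<V> \<and>
     (\<forall>X\<in>\<V>. \<forall>Y\<in>\<V>. lie_bracket \<A> X Y \<in> \<V>) \<and>
     (\<forall>f. \<forall>X\<in>\<V>. smooth_fn \<A> UNIV f \<longrightarrow> (\<lambda>p. f p *\<^sub>R X p) \<in> \<V>) \<and>
     fg_projective \<A> \<V> \<and>
     (\<forall>X\<in>\<V>. \<forall>k. \<forall>F\<in>faces \<A> k. \<forall>p\<in>F. tangent_to \<A> F p (X p))"


section \<open>Vector bundles and tensors\<close>

text \<open>The fibres are linear subspaces of an ambient real vector space; the ambient space carries no
  topology, and the smooth structure is given by local trivialisations, i.e. by local frames
  \<open>(U, e)\<close>, where \<open>e 0 p, \<dots>, e (r - 1) p\<close> is a basis of the fibre at \<open>p \<in> U\<close>.\<close>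

record ('m, 'v) vbundle =
  vb_fibre :: "'m \<Rightarrow> 'v set"
  vb_rank :: nat
  vb_frames :: "('m set \<times> (nat \<Rightarrow> 'm \<Rightarrow> 'v)) set"

definition smooth_in_frame ::
    "('m::t2_space, 'e::euclidean_space) chart set \<Rightarrow> nat \<Rightarrow> (nat \<Rightarrow> 'm \<Rightarrow> 'v::real_vector) \<Rightarrow>
     'm set \<Rightarrow> ('m \<Rightarrow> 'v) \<Rightarrow> bool" where
  "smooth_in_frame \<A> r e W s \<longleftrightarrow>
     (\<exists>c. (\<forall>i<r. smooth_fn \<A> W (c i)) \<and> (\<forall>p\<in>W. s p = (\<Sum>i<r. c i p *\<^sub>R e i p)))"

definition vector_bundle ::
    "('m::t2_space, 'e::euclidean_space) chart set \<Rightarrow> ('m, 'v::real_vector) vbundle \<Rightarrow> bool" where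
  "vector_bundle \<A> E \<longleftrightarrow>
     (\<forall>p. subspace (vb_fibre E p)) \<and>
     (\<forall>p. \<exists>(U, e)\<in>vb_frames E. p \<in> U) \<and>
     (\<forall>(U, e)\<in>vb_frames E. open U \<and>
        (\<forall>p\<in>U. inj_on (\<lambda>i. e i p) {..<vb_rank E} \<and> independent ((\<lambda>i. e i p) ` {..<vb_rank E}) \<and>
                span ((\<lambda>i. e i p) ` {..<vb_rank E}) = vb_fibre E p)) \<and>
     (\<forall>(U, e)\<in>vb_frames E. \<forall>(U', e')\<in>vb_frames E. \<forall>j<vb_rank E.
        smooth_in_frame \<A> (vb_rank E) e (U \<inter> U') (e' j))"

definition smooth_sections ::
    "('m::t2_space, 'e::euclidean_space) chart set \<Rightarrow> ('m, 'v::real_vector) vbundle \<Rightarrow> ('m \<Rightarrow> 'v) set" where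
  "smooth_sections \<A> E = {s. (\<forall>p. s p \<in> vb_fibre E p) \<and>
     (\<forall>(U, e)\<in>vb_frames E. smooth_in_frame \<A> (vb_rank E) e U s)}"

text \<open>Smooth sections of \<open>E\<^sup>*\<^sup>\<otimes>\<^sup>m \<otimes> E\<close>, viewed as fields of \<open>m\<close>-linear maps \<open>E\<^sub>p \<times> \<dots> \<times> E\<^sub>p \<rightarrow> E\<^sub>p\<close>,
  with the arguments given as a list of length \<open>m\<close>.\<close>

definition tensor_section ::
    "('m::t2_space, 'e::euclidean_space) chart set \<Rightarrow> ('m, 'v::real_vector) vbundle \<Rightarrow> nat \<Rightarrow>
     ('m \<Rightarrow> 'v list \<Rightarrow> 'v) \<Rightarrow> bool" where
  "tensor_section \<A> E m T \<longleftrightarrow>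
     (\<forall>p as. length as = m \<and> set as \<subseteq> vb_fibre E p \<longrightarrow>
        T p as \<in> vb_fibre E p \<and>
        (\<forall>i<m. linear_map_on (vb_fibre E p) (\<lambda>a. T p (as[i := a])))) \<and>
     (\<forall>(U, e)\<in>vb_frames E. \<forall>js. length js = m \<and> set js \<subseteq> {..<vb_rank E} \<longrightarrow>
        smooth_in_frame \<A> (vb_rank E) e U (\<lambda>p. T p (map (\<lambda>i. e i p) js)))"

definition endomorphism_section ::
    "('m::t2_space, 'e::euclidean_space) chart set \<Rightarrow> ('m, 'v::real_vector) vbundle \<Rightarrow>
     ('m \<Rightarrow> 'v list \<Rightarrow> 'v) \<Rightarrow> bool" where
  "endomorphism_section \<A> E T \<longleftrightarrow> tensor_section \<A> E 1 T"

text \<open>Sections of \<open>E\<^sup>*\<^sup>\<otimes>\<^sup>k \<otimes> \<Lambda>\<^sup>2E\<^sup>* \<otimes> End(E)\<close>: the arguments are listed in this order.\<close>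

definition curvature_type_section ::
    "('m::t2_space, 'e::euclidean_space) chart set \<Rightarrow> ('m, 'v::real_vector) vbundle \<Rightarrow> nat \<Rightarrow>
     ('m \<Rightarrow> 'v list \<Rightarrow> 'v) \<Rightarrow> bool" where
  "curvature_type_section \<A> E k T \<longleftrightarrow>
     tensor_section \<A> E (k + 3) T \<and>
     (\<forall>p as. \<forall>a\<in>vb_fibre E p. \<forall>b\<in>vb_fibre E p. \<forall>c\<in>vb_fibre E p.
        length as = k \<and> set as \<subseteq> vb_fibre E p \<longrightarrow>
        T p (as @ [a, b, c]) = - T p (as @ [b, a, c]))"

definition bundle_metric ::
    "('m::t2_space, 'e::euclidean_space) chart set \<Rightarrow> ('m, 'v::real_vector) vbundle \<Rightarrow>
     ('m \<Rightarrow> 'v \<Rightarrow> 'v \<Rightarrow> real) \<Rightarrow> bool" where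
  "bundle_metric \<A> E g \<longleftrightarrow>
     (\<forall>p. \<forall>a\<in>vb_fibre E p. linear_map_on (vb_fibre E p) (g p a) \<and>
        (\<forall>b\<in>vb_fibre E p. g p a b = g p b a) \<and> (a \<noteq> 0 \<longrightarrow> 0 < g p a a)) \<and>
     (\<forall>(U, e)\<in>vb_frames E. \<forall>i<vb_rank E. \<forall>j<vb_rank E.
        smooth_fn \<A> U (\<lambda>p. g p (e i p) (e j p)))"


section \<open>Lie structures at infinity\<close>

text \<open>\<open>A\<close> with anchor \<open>\<rho>\<close> is the vector bundle with \<open>\<V> \<cong> \<Gamma>(A)\<close> provided by the Serre--Swan theorem, the
  isomorphism being induced by \<open>\<rho>\<close>.\<close>

definition is_lie_algebroid_of ::
    "('m::t2_space, 'e::euclidean_space) chart set \<Rightarrow> 'm vfield set \<Rightarrow>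
     ('m, 'v::real_vector) vbundle \<Rightarrow> ('m \<Rightarrow> 'v \<Rightarrow> 'm tvec) \<Rightarrow> bool" where
  "is_lie_algebroid_of \<A> \<V> A \<rho> \<longleftrightarrow>
     vector_bundle \<A> A \<and>
     (\<forall>p. linear_map_on (vb_fibre A p) (\<rho> p) \<and> \<rho> p ` vb_fibre A p \<subseteq> tangent_space \<A> p) \<and>
     bij_betw (\<lambda>s p. \<rho> p (s p)) (smooth_sections \<A> A) \<V>"

definition lie_structure_at_infinity ::
    "('m::t2_space, 'e::euclidean_space) chart set \<Rightarrow> 'm vfield set \<Rightarrow>
     ('m, 'v::real_vector) vbundle \<Rightarrow> ('m \<Rightarrow> 'v \<Rightarrow> 'm tvec) \<Rightarrow> bool" where
  "lie_structure_at_infinity \<A> \<V> A \<rho> \<longleftrightarrow>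
     manifold_with_corners \<A> \<and> compact (UNIV :: 'm set) \<and>
     structural_lie_algebra \<A> \<V> \<and> is_lie_algebroid_of \<A> \<V> A \<rho> \<and>
     (\<forall>p\<in>mfd_interior \<A>. bij_betw (\<rho> p) (vb_fibre A p) (tangent_space \<A> p))"

text \<open>The inverse of the identification \<open>A\<^sub>p = T\<^sub>pM\<^sub>0\<close>, for \<open>p\<close> in the interior.\<close>

definition anchor_inv ::
    "('m, 'v::real_vector) vbundle \<Rightarrow> ('m \<Rightarrow> 'v \<Rightarrow> 'm tvec) \<Rightarrow> 'm \<Rightarrow> 'm tvec \<Rightarrow> 'v" where
  "anchor_inv A \<rho> p = inv_into (vb_fibre A p) (\<rho> p)"

definition induced_metric ::
    "('m, 'v::real_vector) vbundle \<Rightarrow> ('m \<Rightarrow> 'v \<Rightarrow> 'm tvec) \<Rightarrow> ('m \<Rightarrow> 'v \<Rightarrow> 'v \<Rightarrow> real) \<Rightarrow>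
     'm \<Rightarrow> 'm tvec \<Rightarrow> 'm tvec \<Rightarrow> real" where
  "induced_metric A \<rho> g p v w = g p (anchor_inv A \<rho> p v) (anchor_inv A \<rho> p w)"

text \<open>The restriction to \<open>M\<^sub>0\<close> of a section of \<open>A\<close>, as a vector field on \<open>M\<^sub>0\<close>.\<close>

definition interior_field ::
    "('m::t2_space, 'e::euclidean_space) chart set \<Rightarrow> ('m \<Rightarrow> 'v \<Rightarrow> 'm tvec) \<Rightarrow>
     ('m \<Rightarrow> 'v) \<Rightarrow> 'm vfield" where
  "interior_field \<A> \<rho> s = (\<lambda>p. if p \<in> mfd_interior \<A> then \<rho> p (s p) else 0)"


section \<open>Connections and curvature\<close>

text \<open>A connection over \<open>W\<close>, differentiating sections in \<open>\<E>\<close> along sections in \<open>\<X>\<close>; the latter act on functions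
  by \<open>act\<close>. That \<open>D \<xi>\<close> is a section of \<open>E \<otimes> A\<^sup>*\<close> is expressed by linearity over smooth functions in the
  first argument.\<close>

definition connection_on ::
    "('m::t2_space, 'e::euclidean_space) chart set \<Rightarrow> 'm set \<Rightarrow> ('m \<Rightarrow> 'a::real_vector) set \<Rightarrow>
     (('m \<Rightarrow> 'a) \<Rightarrow> ('m \<Rightarrow> real) \<Rightarrow> 'm \<Rightarrow> real) \<Rightarrow> ('m \<Rightarrow> 'b::real_vector) set \<Rightarrow>
     (('m \<Rightarrow> 'a) \<Rightarrow> ('m \<Rightarrow> 'b) \<Rightarrow> ('m \<Rightarrow> 'b)) \<Rightarrow> bool" where
  "connection_on \<A> W \<X> act \<E> D \<longleftrightarrow>
     (\<forall>X\<in>\<X>. \<forall>\<xi>\<in>\<E>. D X \<xi> \<in> \<E>) \<and>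
     (\<forall>X\<in>\<X>. \<forall>Y\<in>\<X>. \<forall>\<xi>\<in>\<E>. D (X + Y) \<xi> = D X \<xi> + D Y \<xi>) \<and>
     (\<forall>X\<in>\<X>. \<forall>\<xi>\<in>\<E>. \<forall>\<eta>\<in>\<E>. D X (\<xi> + \<eta>) = D X \<xi> + D X \<eta>) \<and>
     (\<forall>f. \<forall>X\<in>\<X>. \<forall>\<xi>\<in>\<E>. smooth_fn \<A> W f \<longrightarrow>
        D (\<lambda>p. f p *\<^sub>R X p) \<xi> = (\<lambda>p. f p *\<^sub>R D X \<xi> p) \<and>
        D X (\<lambda>p. f p *\<^sub>R \<xi> p) = (\<lambda>p. f p *\<^sub>R D X \<xi> p + act X f p *\<^sub>R \<xi> p))"

text \<open>An \<open>A\<^sup>*\<close>-valued connection on \<open>A\<close>.\<close>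

definition A_connection ::
    "('m::t2_space, 'e::euclidean_space) chart set \<Rightarrow> ('m, 'v::real_vector) vbundle \<Rightarrow>
     ('m \<Rightarrow> 'v \<Rightarrow> 'm tvec) \<Rightarrow> (('m \<Rightarrow> 'v) \<Rightarrow> ('m \<Rightarrow> 'v) \<Rightarrow> ('m \<Rightarrow> 'v)) \<Rightarrow> bool" where
  "A_connection \<A> A \<rho> D \<longleftrightarrow>
     connection_on \<A> UNIV (smooth_sections \<A> A) (\<lambda>X f p. \<rho> p (X p) f) (smooth_sections \<A> A) D"

definition levi_civita ::
    "('m::t2_space, 'e::euclidean_space) chart set \<Rightarrow> 'm set \<Rightarrow> ('m \<Rightarrow> 'm tvec \<Rightarrow> 'm tvec \<Rightarrow> real) \<Rightarrow>
     ('m vfield \<Rightarrow> 'm vfield \<Rightarrow> 'm vfield) \<Rightarrow> bool" where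
  "levi_civita \<A> W h conn \<longleftrightarrow>
     connection_on \<A> W (vector_fields \<A> W) (\<lambda>X f p. X p f) (vector_fields \<A> W) conn \<and>
     (\<forall>X\<in>vector_fields \<A> W. \<forall>Y\<in>vector_fields \<A> W. conn X Y - conn Y X = lie_bracket \<A> X Y) \<and>
     (\<forall>X\<in>vector_fields \<A> W. \<forall>Y\<in>vector_fields \<A> W. \<forall>Z\<in>vector_fields \<A> W. \<forall>p\<in>W.
        X p (\<lambda>q. h q (Y q) (Z q)) = h p (conn X Y p) (Z p) + h p (Y p) (conn X Z p))"

definition curvature ::
    "('m::t2_space, 'e::euclidean_space) chart set \<Rightarrow> ('m vfield \<Rightarrow> 'm vfield \<Rightarrow> 'm vfield) \<Rightarrow>
     'm vfield \<Rightarrow> 'm vfield \<Rightarrow> 'm vfield \<Rightarrow> 'm vfield" where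
  "curvature \<A> conn X Y Z = conn X (conn Y Z) - conn Y (conn X Z) - conn (lie_bracket \<A> X Y) Z"

text \<open>\<open>\<nabla>\<^sup>kR\<close> as an operator on lists \<open>[X\<^sub>1, \<dots>, X\<^sub>k, X, Y, Z]\<close> of vector fields, by
  \<open>(\<nabla>T)(X\<^sub>0, X\<^sub>1, \<dots>) = \<nabla>\<^bsub>X\<^sub>0\<^esub>(T(X\<^sub>1, \<dots>)) - \<Sum>\<^sub>i T(X\<^sub>1, \<dots>, \<nabla>\<^bsub>X\<^sub>0\<^esub>X\<^sub>i, \<dots>)\<close>.\<close>

fun nabla_curvature ::
    "('m::t2_space, 'e::euclidean_space) chart set \<Rightarrow> ('m vfield \<Rightarrow> 'm vfield \<Rightarrow> 'm vfield) \<Rightarrow>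
     nat \<Rightarrow> 'm vfield list \<Rightarrow> 'm vfield" where
  "nabla_curvature \<A> conn 0 Xs = curvature \<A> conn (Xs ! 0) (Xs ! 1) (Xs ! 2)"
| "nabla_curvature \<A> conn (Suc k) Xs =
     conn (hd Xs) (nabla_curvature \<A> conn k (tl Xs)) -
     (\<Sum>i<length (tl Xs). nabla_curvature \<A> conn k ((tl Xs)[i := conn (hd Xs) (tl Xs ! i)]))"

text \<open>Under \<open>A|\<^bsub>M\<^sub>0\<^esub> = TM\<^sub>0\<close>, the tensor field \<open>T\<close> on \<open>A\<close> extends the tensor field on \<open>M\<^sub>0\<close> that is given by the
  operator \<open>F\<close> on lists of \<open>m\<close> vector fields.\<close>

definition extends_tensor ::
    "('m::t2_space, 'e::euclidean_space) chart set \<Rightarrow> ('m, 'v::real_vector) vbundle \<Rightarrow>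
     ('m \<Rightarrow> 'v \<Rightarrow> 'm tvec) \<Rightarrow> nat \<Rightarrow> ('m \<Rightarrow> 'v list \<Rightarrow> 'v) \<Rightarrow> ('m vfield list \<Rightarrow> 'm vfield) \<Rightarrow> bool" where
  "extends_tensor \<A> A \<rho> m T F \<longleftrightarrow>
     (\<forall>Xs. length Xs = m \<and> set Xs \<subseteq> vector_fields \<A> (mfd_interior \<A>) \<longrightarrow>
        (\<forall>p\<in>mfd_interior \<A>. F Xs p = \<rho> p (T p (map (\<lambda>X. anchor_inv A \<rho> p (X p)) Xs))))"

definition extends_connection ::
    "('m::t2_space, 'e::euclidean_space) chart set \<Rightarrow> ('m, 'v::real_vector) vbundle \<Rightarrow>
     ('m \<Rightarrow> 'v \<Rightarrow> 'm tvec) \<Rightarrow> (('m \<Rightarrow> 'v) \<Rightarrow> ('m \<Rightarrow> 'v) \<Rightarrow> ('m \<Rightarrow> 'v)) \<Rightarrow>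
     ('m vfield \<Rightarrow> 'm vfield \<Rightarrow> 'm vfield) \<Rightarrow> bool" where
  "extends_connection \<A> A \<rho> D conn \<longleftrightarrow>
     (\<forall>X\<in>smooth_sections \<A> A. \<forall>Y\<in>smooth_sections \<A> A.
        interior_field \<A> \<rho> (D X Y) = conn (interior_field \<A> \<rho> X) (interior_field \<A> \<rho> Y))"

text \<open>Boundedness on \<open>W\<close> of the pointwise norm of a tensor field, given by an operator on lists of \<open>m\<close>
  vector fields, with respect to the metric \<open>h\<close>. The pointwise norm is the norm of a multilinear map.\<close>

definition bounded_tensor ::
    "('m::t2_space, 'e::euclidean_space) chart set \<Rightarrow> 'm set \<Rightarrow> ('m \<Rightarrow> 'm tvec \<Rightarrow> 'm tvec \<Rightarrow> real) \<Rightarrow>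
     nat \<Rightarrow> ('m vfield list \<Rightarrow> 'm vfield) \<Rightarrow> bool" where
  "bounded_tensor \<A> W h m F \<longleftrightarrow>
     (\<exists>C. \<forall>p\<in>W. \<forall>Xs. length Xs = m \<and> set Xs \<subseteq> vector_fields \<A> W \<longrightarrow>
        sqrt (h p (F Xs p) (F Xs p)) \<le> C * (\<Prod>X\<leftarrow>Xs. sqrt (h p (X p) (X p))))"

end

theory Submission
  imports Defs
begin

text \<open>The anchor identifies sections of \<open>A\<close> with vector fields that are closed under brackets, so the Koszul
  formula makes sense for sections of \<open>A\<close> over all of \<open>M\<close>; since the metric is non-degenerate up to the boundary,
  it defines a connection \<open>D\<close> on \<open>A\<close>, and on \<open>M\<^sub>0\<close> the Koszul formula forces \<open>D\<close> to agree with the Levi-Civita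
  connection. The iterated covariant derivatives of the curvature of \<open>D\<close> are \<open>C\<^sup>\<infinity>(M)\<close>-multilinear on sections,
  hence are tensors over \<open>M\<close>. Over \<open>M\<^sub>0\<close> the same multilinearity, now over \<open>C\<^sup>\<infinity>(M\<^sub>0)\<close>, shows that \<open>\<nabla>\<^sup>kR\<close> depends only
  on the values of its arguments at a point, where they may be replaced by sections of \<open>A\<close>. Boundedness is
  compactness of \<open>M\<close>.\<close>

section \<open>Smooth maps between Euclidean spaces\<close>

text \<open>Both connections are known only as operators on global objects: sections over M on one
  side, vector fields over all of M_0 on the other. Making such an operator pointwise requires that
  an element vanishing at p be a finite sum of terms f t with f(p) = 0. Frames give this only near
  p. One bump function, applied once to the frame and once to the coefficients, makes it global, and
  no partition of unity is built.

  A smooth field on M_0 is given by its action on functions and may be unbounded near the boundary.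
  Its coefficients in a frame of A are found by elimination on values at test functions; the same
  elimination inverts Gram matrices.

  Restriction to M_0 respects differentiation because M_0 is open. With the boundary defined through
  closures of components, openness rests on invariance of domain: a point inner to one chart must
  not be a boundary point of another.

  The calculus of curvature is carried out once, for an abstract module with bracket and connection,
  and instantiated over M and over M_0.\<close>

lemma C_k_on_SucD: "C_k_on (Suc k) f U \<Longrightarrow> C_k_on k f U"
proof (induction k arbitrary: f)
  case 0
  then show ?case
    by (auto intro!: continuous_at_imp_continuous_on differentiable_imp_continuous_within)
next
  case (Suc k)
  then show ?case by (metis C_k_on.simps(2))
qed

lemma C_k_on_SucE:
  assumes "C_k_on (Suc k) f U" "x \<in> U"
  shows "(f has_derivative frechet_derivative f (at x)) (at x)"
  using assms frechet_derivative_works by auto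

lemma C_k_on_cong:
  assumes "open U" "\<And>x. x \<in> U \<Longrightarrow> f x = g x" "C_k_on k f U"
  shows "C_k_on k g U"
  using assms(2,3)
proof (induction k arbitrary: f g)
  case 0
  then show ?case by (auto cong: continuous_on_cong)
next
  case (Suc k)
  have *: "(g has_derivative frechet_derivative f (at x)) (at x)" if "x \<in> U" for x
    by (rule has_derivative_transform_within_open[OF C_k_on_SucE[OF Suc.prems(2) that] assms(1) that])
      (rule Suc.prems(1))
  then have "frechet_derivative g (at x) = frechet_derivative f (at x)" if "x \<in> U" for x
    using that frechet_derivative_at by metis
  then have "C_k_on k (\<lambda>x. frechet_derivative g (at x) v) U" for v
    using Suc.IH[of "\<lambda>x. frechet_derivative f (at x) v" "\<lambda>x. frechet_derivative g (at x) v"]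
      Suc.prems by auto
  then show ?case using * by (auto simp: differentiable_def)
qed

lemma C_k_on_mono: "C_k_on k f U \<Longrightarrow> V \<subseteq> U \<Longrightarrow> C_k_on k f V"
  by (induction k arbitrary: f) (auto intro: continuous_on_subset)

text \<open>Uniqueness of derivatives lets an explicit formula \<open>f'\<close> stand in for the
  choice term \<open>frechet_derivative\<close>. The rules below for sums, products and compositions
  only have to exhibit such a formula and bound its order.\<close>

lemma C_k_on_SucI:
  assumes "open U" "\<And>x. x \<in> U \<Longrightarrow> (f has_derivative f' x) (at x)"
    and "\<And>v. C_k_on k (\<lambda>x. f' x v) U"
  shows "C_k_on (Suc k) f U"
proof -
  have "frechet_derivative f (at x) = f' x" if "x \<in> U" for x
    using assms(2)[OF that] frechet_derivative_at by metis
  then have "C_k_on k (\<lambda>x. frechet_derivative f (at x) v) U" for v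
    using C_k_on_cong[OF \<open>open U\<close> _ assms(3)[of v]] by simp
  then show ?thesis using assms(2) by (auto simp: differentiable_def)
qed

lemma C_k_on_const: "open U \<Longrightarrow> C_k_on k (\<lambda>x. c) U"
proof (induction k arbitrary: c)
  case (Suc k)
  show ?case
    by (rule C_k_on_SucI[OF Suc.prems has_derivative_const]) (use Suc in auto)
qed simp

lemma C_k_on_linear:
  assumes "open U" "bounded_linear f"
  shows "C_k_on k f U"
proof (cases k)
  case 0
  then show ?thesis using assms(2) by (simp add: linear_continuous_on)
next
  case (Suc m)
  show ?thesis unfolding Suc
    by (rule C_k_on_SucI[where f' = "\<lambda>x. f"])
      (use assms in \<open>auto intro: C_k_on_const bounded_linear_imp_has_derivative\<close>)
qed

lemma C_k_on_add:
  assumes "open U" "C_k_on k f U" "C_k_on k g U"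
  shows "C_k_on k (\<lambda>x. f x + g x) U"
  using assms(2,3)
proof (induction k arbitrary: f g)
  case 0
  then show ?case by (auto intro: continuous_on_add)
next
  case (Suc k)
  show ?case
    by (rule C_k_on_SucI[OF assms(1) has_derivative_add[OF C_k_on_SucE[OF Suc.prems(1)] C_k_on_SucE[OF Suc.prems(2)]]])
      (use Suc in auto)
qed

lemma C_k_on_sum:
  assumes "open U" "\<And>i. i \<in> I \<Longrightarrow> C_k_on k (f i) U"
  shows "C_k_on k (\<lambda>x. \<Sum>i\<in>I. f i x) U"
  using assms(2)
proof (induction I rule: infinite_finite_induct)
  case (insert a F)
  have "C_k_on k (\<lambda>x. f a x + (\<Sum>i\<in>F. f i x)) U"
    using insert by (intro C_k_on_add[OF assms(1)]) auto
  then show ?case using insert by simp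
qed (auto intro: C_k_on_const[OF assms(1)])

lemma C_k_on_scaleR:
  fixes f :: "'e::euclidean_space \<Rightarrow> real"
  assumes "open U" "C_k_on k f U" "C_k_on k g U"
  shows "C_k_on k (\<lambda>x. f x *\<^sub>R g x) U"
  using assms(2,3)
proof (induction k arbitrary: f g)
  case 0
  then show ?case by (auto intro: continuous_on_scaleR)
next
  case (Suc k)
  note f = Suc.prems(1) and g = Suc.prems(2)
  show ?case
  proof (rule C_k_on_SucI[OF assms(1) has_derivative_scaleR[OF C_k_on_SucE[OF f] C_k_on_SucE[OF g]]])
    fix v
    have "C_k_on k (\<lambda>x. frechet_derivative g (at x) v) U" "C_k_on k (\<lambda>x. frechet_derivative f (at x) v) U"
      using f g by simp_all
    then show "C_k_on k (\<lambda>x. f x *\<^sub>R frechet_derivative g (at x) v + frechet_derivative f (at x) v *\<^sub>R g x) U"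
      by (intro C_k_on_add[OF assms(1)] Suc.IH C_k_on_SucD[OF f] C_k_on_SucD[OF g])
  qed
qed

lemma C_k_on_bounded_linear:
  assumes "open U" "bounded_linear L" "C_k_on k f U"
  shows "C_k_on k (\<lambda>x. L (f x)) U"
  using assms(3)
proof (induction k arbitrary: f)
  case 0
  then show ?case
    using assms(2) continuous_on_compose2[OF linear_continuous_on[OF assms(2)]] by auto
next
  case (Suc k)
  show ?case
    by (rule C_k_on_SucI[OF assms(1) bounded_linear.has_derivative[OF assms(2) C_k_on_SucE[OF Suc.prems]]])
      (use Suc in auto)
qed

text \<open>The chain rule produces a linear map depending on \<open>x\<close>, applied to a vector
  depending on \<open>x\<close>. Expanding that vector in \<open>Basis\<close> turns this into a
  finite sum of products: a component of the derivative of \<open>g\<close> times a partial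
  derivative of \<open>f\<close> composed with \<open>g\<close>. The induction hypothesis applies to
  the latter, which is why \<open>f\<close> is arbitrary in the induction.\<close>

lemma C_k_on_compose:
  fixes f :: "'e::euclidean_space \<Rightarrow> 'b::real_normed_vector" and g :: "'d::euclidean_space \<Rightarrow> 'e"
  assumes U: "open U" and gV: "g ` U \<subseteq> V"
    and f: "C_k_on k f V" and g: "C_k_on k g U"
  shows "C_k_on k (\<lambda>x. f (g x)) U"
  using f g
proof (induction k arbitrary: f)
  case 0
  then show ?case using gV continuous_on_compose2 by auto
next
  case (Suc k)
  have gd: "(g has_derivative frechet_derivative g (at x)) (at x)" if "x \<in> U" for x
    using C_k_on_SucE[OF Suc.prems(2) that] .
  have fd: "(f has_derivative frechet_derivative f (at (g x))) (at (g x))" if "x \<in> U" for x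
    using C_k_on_SucE[OF Suc.prems(1)] that gV by blast
  let ?f' = "\<lambda>x v. \<Sum>b\<in>Basis. (frechet_derivative g (at x) v \<bullet> b) *\<^sub>R frechet_derivative f (at (g x)) b"
  have "((\<lambda>x. f (g x)) has_derivative ?f' x) (at x)" if "x \<in> U" for x
  proof -
    have lin: "linear (frechet_derivative f (at (g x)))"
      using has_derivative_bounded_linear[OF fd[OF that]] bounded_linear.linear by blast
    have "frechet_derivative f (at (g x)) w = (\<Sum>b\<in>Basis. (w \<bullet> b) *\<^sub>R frechet_derivative f (at (g x)) b)" for w
      by (subst euclidean_representation[of w, symmetric])
        (simp only: linear_sum[OF lin] linear_scale[OF lin])
    then have "(\<lambda>v. frechet_derivative f (at (g x)) (frechet_derivative g (at x) v)) = ?f' x"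
      by (intro ext)
    then show ?thesis
      using has_derivative_compose[OF gd[OF that] fd[OF that]] by simp
  qed
  moreover have "C_k_on k (\<lambda>x. ?f' x v) U" for v
  proof (intro C_k_on_sum[OF U] C_k_on_scaleR[OF U])
    fix b :: 'e assume "b \<in> Basis"
    show "C_k_on k (\<lambda>x. frechet_derivative g (at x) v \<bullet> b) U"
      using Suc.prems(2) by (intro C_k_on_bounded_linear[OF U bounded_linear_inner_left]) simp
    show "C_k_on k (\<lambda>x. frechet_derivative f (at (g x)) b) U"
      by (rule Suc.IH[of "\<lambda>y. frechet_derivative f (at y) b", OF _ C_k_on_SucD[OF Suc.prems(2)]])
        (use Suc.prems(1) in simp)
  qed
  ultimately show ?case by (rule C_k_on_SucI[OF U])
qed

lemma C_k_on_inverse: "C_k_on k inverse (UNIV - {0::real})"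
proof (induction k)
  case 0
  then show ?case by (auto intro!: continuous_intros)
next
  case (Suc k)
  have op: "open (UNIV - {0::real})" by auto
  show ?case
  proof (rule C_k_on_SucI[OF op])
    show "(inverse has_derivative (\<lambda>v. inverse x *\<^sub>R inverse x *\<^sub>R (- v))) (at x)" if "x \<in> UNIV - {0}" for x :: real
      using that by (auto intro!: derivative_eq_intros simp: fun_eq_iff)
    show "C_k_on k (\<lambda>x. inverse x *\<^sub>R inverse x *\<^sub>R - v) (UNIV - {0})" for v :: real
      by (intro C_k_on_scaleR C_k_on_const Suc op)
  qed
qed

section \<open>Cutoff functions on Euclidean space\<close>

definition flat_exp :: "nat \<Rightarrow> real \<Rightarrow> real" where
  "flat_exp n x = (if x > 0 then inverse x ^ n * exp (- inverse x) else 0)"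

lemma flat_exp_tendsto_0: "(flat_exp n \<longlongrightarrow> 0) (at 0)"
proof (rule filterlim_split_at)
  show "(flat_exp n \<longlongrightarrow> 0) (at_left 0)"
    by (rule tendsto_eventually) (auto simp: flat_exp_def eventually_at_filter)
  have "((\<lambda>x. x ^ n / exp x) \<longlongrightarrow> (0::real)) at_top" by (rule tendsto_power_div_exp_0)
  then have "((\<lambda>x. inverse x ^ n / exp (inverse x)) \<longlongrightarrow> (0::real)) (at_right 0)"
    using filterlim_compose filterlim_inverse_at_top_right by blast
  then show "(flat_exp n \<longlongrightarrow> 0) (at_right 0)"
    by (rule Lim_transform_eventually)
      (auto simp: flat_exp_def eventually_at_filter exp_minus field_simps)
qed

text \<open>The power of \<open>inverse x\<close> is a parameter so that the family is closed under
  differentiation up to linear combinations. Smoothness of the usual flat function, the case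
  \<open>n = 0\<close>, then follows by induction on the order with \<open>n\<close>
  arbitrary.\<close>

lemma flat_exp_has_derivative:
  "(flat_exp n has_real_derivative (flat_exp (n + 2) x - real n * flat_exp (n + 1) x)) (at x)"
proof (cases x "0::real" rule: linorder_cases)
  case less
  then have "((\<lambda>_. 0) has_real_derivative 0) (at x)" by simp
  then have "(flat_exp n has_real_derivative 0) (at x)"
    by (rule has_field_derivative_transform_within_open[where S = "{..<0}"])
      (use less in \<open>auto simp: flat_exp_def\<close>)
  then show ?thesis using less by (simp add: flat_exp_def)
next
  case equal
  \<comment> \<open>The difference quotient at 0 is \<open>flat_exp (n + 1)\<close> itself.\<close>
  have "((\<lambda>h. (flat_exp n (0 + h) - flat_exp n 0) / h) \<longlongrightarrow> 0) (at 0)"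
    by (rule Lim_transform_eventually[OF flat_exp_tendsto_0[of "n + 1"]])
      (auto simp: flat_exp_def eventually_at_filter field_simps)
  then show ?thesis using equal by (simp add: DERIV_def flat_exp_def)
next
  case greater
  have eq: "flat_exp (n + 2) x - real n * flat_exp (n + 1) x =
     inverse x ^ n * (exp (- inverse x) * (inverse x * inverse x)) - real n * inverse x ^ (n + 1) * exp (- inverse x)"
    using greater by (simp add: flat_exp_def power_add algebra_simps)
  have p: "((\<lambda>x. inverse x ^ n) has_real_derivative - real n * inverse x ^ (n + 1)) (at x)"
    using DERIV_power[OF DERIV_inverse, of x n] greater by (cases n) (simp_all add: algebra_simps)
  have e: "((\<lambda>x. exp (- inverse x)) has_real_derivative exp (- inverse x) * (inverse x * inverse x)) (at x)"
    using greater by (auto intro!: derivative_eq_intros simp: power2_eq_square)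
  have "((\<lambda>x. inverse x ^ n * exp (- inverse x)) has_real_derivative
     (flat_exp (n + 2) x - real n * flat_exp (n + 1) x)) (at x)"
    unfolding eq using DERIV_mult[OF p e] by (simp add: algebra_simps)
  then show ?thesis
    by (rule has_field_derivative_transform_within_open[where S = "{0<..}"])
      (use greater in \<open>auto simp: flat_exp_def\<close>)
qed

lemma C_k_on_flat_exp: "C_k_on k (flat_exp n) UNIV"
proof (induction k arbitrary: n)
  case 0
  then show ?case
    using DERIV_isCont[OF flat_exp_has_derivative] by (auto intro: continuous_at_imp_continuous_on)
next
  case (Suc k)
  show ?case
  proof (rule C_k_on_SucI)
    show "(flat_exp n has_derivative (\<lambda>v. v *\<^sub>R (flat_exp (n + 2) x + - real n *\<^sub>R flat_exp (n + 1) x))) (at x)" for x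
      using flat_exp_has_derivative[of n x] by (simp add: has_field_derivative_def mult.commute[of _ "_ - _"] mult_commute_abs)
    show "C_k_on k (\<lambda>x. v *\<^sub>R (flat_exp (n + 2) x + - real n *\<^sub>R flat_exp (n + 1) x)) UNIV" for v :: real
      by (intro C_k_on_scaleR C_k_on_add C_k_on_const Suc open_UNIV)
  qed simp
qed

section \<open>Smooth functions on subsets of Euclidean space\<close>

lemma smooth_onI:
  assumes "open W" "\<And>k. C_k_on k F W" "\<And>x. x \<in> S \<Longrightarrow> x \<in> W" "\<And>x. x \<in> S \<Longrightarrow> F x = f x"
  shows "smooth_on S f"
  using assms unfolding smooth_on_def by blast

lemma smooth_onE:
  assumes "smooth_on S f" "x \<in> S"
  obtains W F where "open W" "x \<in> W" "\<And>k. C_k_on k F W" "\<And>y. y \<in> W \<inter> S \<Longrightarrow> F y = f y"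
proof -
  from assms obtain W F where
    "open W \<and> x \<in> W \<and> (\<forall>k. C_k_on k F W) \<and> (\<forall>y\<in>W \<inter> S. F y = f y)"
    unfolding smooth_on_def by blast
  then show thesis by (intro that[of W F]) auto
qed

lemma smooth_on_const: "smooth_on S (\<lambda>x. c)"
  by (rule smooth_onI[OF open_UNIV C_k_on_const[OF open_UNIV]]) simp_all

lemma smooth_on_subset:
  assumes "smooth_on S f" "T \<subseteq> S"
  shows "smooth_on T f"
  unfolding smooth_on_def
proof
  fix x assume "x \<in> T"
  then have "x \<in> S" using assms(2) by blast
  then obtain W F where "open W" "x \<in> W" "\<And>k. C_k_on k F W" "\<And>y. y \<in> W \<inter> S \<Longrightarrow> F y = f y"
    using smooth_onE[OF assms(1)] by blast
  then show "\<exists>W F. open W \<and> x \<in> W \<and> (\<forall>k. C_k_on k F W) \<and> (\<forall>y\<in>W \<inter> T. F y = f y)"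
    using assms(2) by (intro exI[of _ W] exI[of _ F]) auto
qed

lemma smooth_on_cong: "(\<And>x. x \<in> S \<Longrightarrow> f x = g x) \<Longrightarrow> smooth_on S f \<longleftrightarrow> smooth_on S g"
  unfolding smooth_on_def by (intro ball_cong refl iff_exI conj_cong) auto

lemma smooth_on_imp_continuous_on:
  assumes "smooth_on S f" shows "continuous_on S f"
proof (clarsimp simp: continuous_on_eq_continuous_within)
  fix x assume "x \<in> S"
  then obtain W F where W: "open W" "x \<in> W" "\<And>k. C_k_on k F W" "\<And>y. y \<in> W \<inter> S \<Longrightarrow> F y = f y"
    using smooth_onE[OF assms] by blast
  have "continuous (at x within S) F"
    using W(1,2) W(3)[of 0] by (simp add: continuous_on_eq_continuous_at continuous_at_imp_continuous_at_within)
  moreover have "eventually (\<lambda>y. F y = f y) (at x within S)"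
    using W by (auto simp: eventually_at_topological)
  ultimately show "continuous (at x within S) f"
    using W(4)[of x] W(2) \<open>x \<in> S\<close> unfolding continuous_within
    by (auto intro: Lim_transform_eventually)
qed

lemma smooth_on_scaleR:
  fixes f :: "'e::euclidean_space \<Rightarrow> real"
  assumes "smooth_on S f" "smooth_on S g"
  shows "smooth_on S (\<lambda>x. f x *\<^sub>R g x)"
  unfolding smooth_on_def
proof
  fix x assume x: "x \<in> S"
  obtain V F where V: "open V" "x \<in> V" "\<And>k. C_k_on k F V" "\<And>y. y \<in> V \<inter> S \<Longrightarrow> F y = f y"
    using smooth_onE[OF assms(1) x] by blast
  obtain W G where W: "open W" "x \<in> W" "\<And>k. C_k_on k G W" "\<And>y. y \<in> W \<inter> S \<Longrightarrow> G y = g y"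
    using smooth_onE[OF assms(2) x] by blast
  have "C_k_on k (\<lambda>x. F x *\<^sub>R G x) (V \<inter> W)" for k
    using V W by (intro C_k_on_scaleR) (auto intro: C_k_on_mono)
  then show "\<exists>W F. open W \<and> x \<in> W \<and> (\<forall>k. C_k_on k F W) \<and> (\<forall>y\<in>W \<inter> S. F y = f y *\<^sub>R g y)"
    using V W by (intro exI[of _ "V \<inter> W"] exI[of _ "\<lambda>x. F x *\<^sub>R G x"]) auto
qed

lemma smooth_on_add:
  assumes "smooth_on S f" "smooth_on S g"
  shows "smooth_on S (\<lambda>x. f x + g x)"
  unfolding smooth_on_def
proof
  fix x assume x: "x \<in> S"
  obtain V F where V: "open V" "x \<in> V" "\<And>k. C_k_on k F V" "\<And>y. y \<in> V \<inter> S \<Longrightarrow> F y = f y"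
    using smooth_onE[OF assms(1) x] by blast
  obtain W G where W: "open W" "x \<in> W" "\<And>k. C_k_on k G W" "\<And>y. y \<in> W \<inter> S \<Longrightarrow> G y = g y"
    using smooth_onE[OF assms(2) x] by blast
  have "C_k_on k (\<lambda>x. F x + G x) (V \<inter> W)" for k
    using V W by (intro C_k_on_add) (auto intro: C_k_on_mono)
  then show "\<exists>W F. open W \<and> x \<in> W \<and> (\<forall>k. C_k_on k F W) \<and> (\<forall>y\<in>W \<inter> S. F y = f y + g y)"
    using V W by (intro exI[of _ "V \<inter> W"] exI[of _ "\<lambda>x. F x + G x"]) auto
qed

lemma smooth_on_compose:
  fixes f :: "'e::euclidean_space \<Rightarrow> 'b::real_normed_vector" and g :: "'d::euclidean_space \<Rightarrow> 'e"
  assumes "open V" "\<And>k. C_k_on k f V" "smooth_on S g" "g ` S \<subseteq> V"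
  shows "smooth_on S (\<lambda>x. f (g x))"
  unfolding smooth_on_def
proof
  fix x assume x: "x \<in> S"
  obtain W G where W: "open W" "x \<in> W" "\<And>k. C_k_on k G W" "\<And>y. y \<in> W \<inter> S \<Longrightarrow> G y = g y"
    using smooth_onE[OF assms(3) x] by blast
  have "open (W \<inter> G -` V)"
    using W(1) W(3)[of 0] \<open>open V\<close> by (simp add: continuous_open_preimage)
  moreover have "C_k_on k (\<lambda>x. f (G x)) (W \<inter> G -` V)" for k
    by (rule C_k_on_compose[OF calculation _ assms(2) C_k_on_mono[OF W(3)]]) auto
  ultimately show "\<exists>W F. open W \<and> x \<in> W \<and> (\<forall>k. C_k_on k F W) \<and> (\<forall>y\<in>W \<inter> S. F y = f (g y))"
    using W assms(4) x by (intro exI[of _ "W \<inter> G -` V"] exI[of _ "\<lambda>x. f (G x)"]) auto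
qed

lemma smooth_on_inverse:
  assumes "smooth_on S f" "\<And>x. x \<in> S \<Longrightarrow> f x \<noteq> (0::real)"
  shows "smooth_on S (\<lambda>x. inverse (f x))"
  by (rule smooth_on_compose[where V = "UNIV - {0}", OF _ C_k_on_inverse assms(1)]) (use assms(2) in auto)

text \<open>The bump is a quotient of flat functions in the squared distance \<open>q\<close>; the
  distance itself is not differentiable at \<open>a\<close>. The numerator vanishes once
  \<open>q\<close> reaches \<open>4 * e^2\<close>, the other summand of the denominator vanishes up
  to \<open>e^2\<close>, and the two never vanish together.\<close>

lemma ex_euclidean_bump:
  fixes a :: "'e::euclidean_space"
  assumes "0 < e"
  obtains \<beta> :: "'e \<Rightarrow> real" where "\<And>k. C_k_on k \<beta> UNIV"
    "\<And>x. dist a x < e \<Longrightarrow> \<beta> x = 1" "\<And>x. 2 * e \<le> dist a x \<Longrightarrow> \<beta> x = 0"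
proof -
  define q where "q x = (x - a) \<bullet> (x - a)" for x :: 'e
  define \<psi> where "\<psi> t = inverse (flat_exp 0 (4 * e^2 - t) + flat_exp 0 (t - e^2)) *\<^sub>R flat_exp 0 (4 * e^2 - t)" for t
  have q: "C_k_on k q UNIV" for k
  proof -
    have "C_k_on k (\<lambda>x. x + - a) UNIV" for k
      by (intro C_k_on_add C_k_on_const C_k_on_linear bounded_linear_ident open_UNIV)
    then have "C_k_on k (\<lambda>x. x - a) UNIV" for k by simp
    then have "C_k_on k (\<lambda>x. \<Sum>b\<in>Basis. ((x - a) \<bullet> b) *\<^sub>R ((x - a) \<bullet> b)) UNIV"
      by (intro C_k_on_sum C_k_on_scaleR C_k_on_bounded_linear[OF _ bounded_linear_inner_left] open_UNIV)
    moreover have "q = (\<lambda>x. \<Sum>b\<in>Basis. ((x - a) \<bullet> b) *\<^sub>R ((x - a) \<bullet> b))"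
      unfolding q_def real_scaleR_def by (rule ext) (rule euclidean_inner)
    ultimately show ?thesis by metis
  qed
  have lin: "C_k_on k (\<lambda>t::real. 4 * e^2 + (- t)) UNIV" "C_k_on k (\<lambda>t::real. t + - (e^2)) UNIV" for k
    by (intro C_k_on_add C_k_on_const C_k_on_linear bounded_linear_minus bounded_linear_ident open_UNIV)+
  have fe: "C_k_on k (\<lambda>t. flat_exp 0 (4 * e^2 - t)) UNIV" "C_k_on k (\<lambda>t. flat_exp 0 (t - e^2)) UNIV" for k
    using C_k_on_compose[OF _ _ C_k_on_flat_exp[of k 0] lin(1)[of k]]
      C_k_on_compose[OF _ _ C_k_on_flat_exp[of k 0] lin(2)[of k]] by simp_all
  have pos: "flat_exp 0 (4 * e^2 - t) + flat_exp 0 (t - e^2) > 0" for t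
  proof -
    have "4 * e^2 - t > 0 \<or> t - e^2 > 0"
    proof (rule ccontr)
      assume "\<not> ?thesis"
      then have "4 * e^2 \<le> e^2" by linarith
      then show False using assms by simp
    qed
    then show ?thesis by (auto simp: flat_exp_def add_pos_pos)
  qed
  have "C_k_on k (\<lambda>t. inverse (flat_exp 0 (4 * e^2 - t) + flat_exp 0 (t - e^2))) UNIV" for k
    by (rule C_k_on_compose[OF open_UNIV _ C_k_on_inverse])
      (use pos in \<open>auto intro!: C_k_on_add fe simp: less_le\<close>)
  then have \<psi>: "C_k_on k \<psi> UNIV" for k
    unfolding \<psi>_def by (intro C_k_on_scaleR fe open_UNIV)
  have sm: "\<And>k. C_k_on k (\<lambda>x. \<psi> (q x)) UNIV"
    by (rule C_k_on_compose[OF open_UNIV _ \<psi> q]) simp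
  have qd: "q x = (dist a x)^2" for x
    by (simp add: q_def dist_norm power2_norm_eq_inner inner_diff_left inner_diff_right inner_commute)
  have "\<psi> (q x) = 1" if "dist a x < e" for x
  proof -
    have "(dist a x)^2 \<le> e^2" using that by (intro power_mono) auto
    moreover have "e^2 > 0" using assms by simp
    ultimately have "(dist a x)^2 < 4 * e^2" "\<not> 0 < (dist a x)^2 - e^2" by linarith+
    then show ?thesis by (simp add: \<psi>_def qd flat_exp_def)
  qed
  moreover have "\<psi> (q x) = 0" if "2 * e \<le> dist a x" for x
  proof -
    have "(2 * e)^2 \<le> (dist a x)^2" using that assms by (intro power_mono) auto
    then show ?thesis by (simp add: \<psi>_def qd flat_exp_def)
  qed
  ultimately show ?thesis using that[OF sm] by blast
qed

section \<open>Smooth functions on manifolds with corners\<close>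

lemma smooth_fn_mono: "smooth_fn \<A> W f \<Longrightarrow> V \<subseteq> W \<Longrightarrow> smooth_fn \<A> V f"
  unfolding smooth_fn_def by (fast elim!: smooth_on_subset)

lemma inv_into_chart_image: "x \<in> \<phi> ` (U \<inter> W) \<Longrightarrow> inj_on \<phi> U \<Longrightarrow> inv_into U \<phi> x \<in> U \<inter> W"
  by auto

locale atlas =
  fixes \<A> :: "('m::t2_space, 'e::euclidean_space) chart set"
  assumes atlas: "corner_atlas \<A>"
begin

lemma chart_coordinates: obtains N where "N \<subseteq> Basis" "\<And>c. c \<in> \<A> \<Longrightarrow> is_chart N c"
  using atlas unfolding corner_atlas_def by blast

lemma chart_at: obtains U \<phi> B where "(U, \<phi>, B) \<in> \<A>" "p \<in> U"
  using atlas unfolding corner_atlas_def by blast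

lemma transition_smooth:
  "(U, \<phi>, B) \<in> \<A> \<Longrightarrow> (U', \<phi>', B') \<in> \<A> \<Longrightarrow> smooth_on (\<phi> ` (U \<inter> U')) (\<phi>' \<circ> inv_into U \<phi>)"
  using atlas unfolding corner_atlas_def by fast

lemma
  assumes "(U, \<phi>, B) \<in> \<A>"
  shows chart_open: "open U" and chart_inj: "inj_on \<phi> U"
    and chart_homeomorphism: "homeomorphism U (\<phi> ` U) \<phi> (inv_into U \<phi>)"
  using chart_coordinates assms unfolding is_chart_def by (metis (no_types, lifting) case_prod_conv)+

lemma chart_continuous: "(U, \<phi>, B) \<in> \<A> \<Longrightarrow> continuous_on U \<phi>"
  using chart_homeomorphism homeomorphism_cont1 by blast

lemma chart_image_open:
  assumes "(U, \<phi>, B) \<in> \<A>" "open V"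
  obtains O' where "open O'" "\<phi> ` (U \<inter> V) = O' \<inter> \<phi> ` U"
proof -
  have "openin (top_of_set (\<phi> ` U)) (\<phi> ` (U \<inter> V))"
    using homeomorphism_imp_open_map[OF chart_homeomorphism[OF assms(1)]] assms(2)
    by (simp add: openin_open_Int)
  then show thesis using that unfolding openin_open by blast
qed

lemma smooth_fn_chart:
  "smooth_fn \<A> W f \<Longrightarrow> (U, \<phi>, B) \<in> \<A> \<Longrightarrow> smooth_on (\<phi> ` (U \<inter> W)) (f \<circ> inv_into U \<phi>)"
  unfolding smooth_fn_def by fast

lemma smooth_fnI:
  assumes "\<And>U \<phi> B. (U, \<phi>, B) \<in> \<A> \<Longrightarrow> smooth_on (\<phi> ` (U \<inter> W)) (f \<circ> inv_into U \<phi>)"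
  shows "smooth_fn \<A> W f"
  using assms unfolding smooth_fn_def by fast

lemma smooth_fn_cong:
  assumes "smooth_fn \<A> W f" "\<And>p. p \<in> W \<Longrightarrow> f p = g p"
  shows "smooth_fn \<A> W g"
proof (rule smooth_fnI)
  fix U \<phi> B assume c: "(U, \<phi>, B) \<in> \<A>"
  have "(f \<circ> inv_into U \<phi>) x = (g \<circ> inv_into U \<phi>) x" if "x \<in> \<phi> ` (U \<inter> W)" for x
    using inv_into_chart_image[OF that chart_inj[OF c]] assms(2) by simp
  then show "smooth_on (\<phi> ` (U \<inter> W)) (g \<circ> inv_into U \<phi>)"
    using smooth_on_cong smooth_fn_chart[OF assms(1) c] by blast
qed

text \<open>Smoothness in a chart is tested on open sets of the ambient Euclidean space, whereas
  \<open>V\<close> is open in the manifold. The chart being a homeomorphism, the image of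
  \<open>V\<close> is the trace of some ambient open set \<open>O'\<close>, and the local extension
  is restricted to it.\<close>

lemma smooth_fn_local:
  assumes "\<And>p. p \<in> W \<Longrightarrow> \<exists>V. open V \<and> p \<in> V \<and> smooth_fn \<A> (V \<inter> W) f"
  shows "smooth_fn \<A> W f"
proof (rule smooth_fnI)
  fix U \<phi> B assume c: "(U, \<phi>, B) \<in> \<A>"
  show "smooth_on (\<phi> ` (U \<inter> W)) (f \<circ> inv_into U \<phi>)"
    unfolding smooth_on_def
  proof
    fix x assume "x \<in> \<phi> ` (U \<inter> W)"
    then obtain p where p: "p \<in> U" "p \<in> W" "x = \<phi> p" by blast
    obtain V where V: "open V" "p \<in> V" "smooth_fn \<A> (V \<inter> W) f" using assms p(2) by blast
    obtain O' where O': "open O'" "\<phi> ` (U \<inter> V) = O' \<inter> \<phi> ` U" using chart_image_open[OF c V(1)] .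
    have "x \<in> \<phi> ` (U \<inter> (V \<inter> W))" using p V by blast
    then obtain X F where X: "open X" "x \<in> X" "\<And>k. C_k_on k F X"
      "\<And>y. y \<in> X \<inter> \<phi> ` (U \<inter> (V \<inter> W)) \<Longrightarrow> F y = (f \<circ> inv_into U \<phi>) y"
      using smooth_onE[OF smooth_fn_chart[OF V(3) c]] by blast
    have "F y = (f \<circ> inv_into U \<phi>) y" if y: "y \<in> (X \<inter> O') \<inter> \<phi> ` (U \<inter> W)" for y
    proof -
      obtain q where q: "q \<in> U" "q \<in> W" "y = \<phi> q" using y by blast
      then have "y \<in> \<phi> ` (U \<inter> V)" using O'(2) y by blast
      then have "q \<in> V" using q chart_inj[OF c] by (auto simp: inj_on_def)
      then show ?thesis using X(4) q y by blast
    qed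
    moreover have "x \<in> X \<inter> O'" using X(2) O'(2) p V(2) by blast
    moreover have "C_k_on k F (X \<inter> O')" for k using C_k_on_mono X(3) by blast
    ultimately show "\<exists>W' F. open W' \<and> x \<in> W' \<and> (\<forall>k. C_k_on k F W') \<and>
        (\<forall>y\<in>W' \<inter> \<phi> ` (U \<inter> W). F y = (f \<circ> inv_into U \<phi>) y)"
      using X(1) O'(1) by (intro exI[of _ "X \<inter> O'"] exI[of _ F]) auto
  qed
qed

lemma smooth_fn_const: "smooth_fn \<A> W (\<lambda>p. c)"
  by (rule smooth_fnI) (simp add: comp_def smooth_on_const)

lemma smooth_fn_add: "smooth_fn \<A> W f \<Longrightarrow> smooth_fn \<A> W g \<Longrightarrow> smooth_fn \<A> W (\<lambda>p. f p + g p)"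
  using smooth_on_add by (intro smooth_fnI) (force simp: comp_def dest: smooth_fn_chart)

lemma smooth_fn_mult:
  assumes "smooth_fn \<A> W f" "smooth_fn \<A> W g"
  shows "smooth_fn \<A> W (\<lambda>p. f p * g p)"
proof (rule smooth_fnI)
  fix U \<phi> B assume c: "(U, \<phi>, B) \<in> \<A>"
  show "smooth_on (\<phi> ` (U \<inter> W)) ((\<lambda>p. f p * g p) \<circ> inv_into U \<phi>)"
    using smooth_on_scaleR[OF smooth_fn_chart[OF assms(1) c] smooth_fn_chart[OF assms(2) c]]
    by (simp add: comp_def)
qed

lemma smooth_fn_cmult: "smooth_fn \<A> W f \<Longrightarrow> smooth_fn \<A> W (\<lambda>p. c * f p)"
  using smooth_fn_mult[OF smooth_fn_const] .

lemma smooth_fn_diff: "smooth_fn \<A> W f \<Longrightarrow> smooth_fn \<A> W g \<Longrightarrow> smooth_fn \<A> W (\<lambda>p. f p - g p)"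
  using smooth_fn_add[of W f "\<lambda>p. - 1 * g p"] smooth_fn_cmult[of W g "- 1"] by simp

lemma smooth_fn_sum:
  "(\<And>i. i \<in> I \<Longrightarrow> smooth_fn \<A> W (f i)) \<Longrightarrow> smooth_fn \<A> W (\<lambda>p. \<Sum>i\<in>I. f i p)"
proof (induction I rule: infinite_finite_induct)
  case (insert a F)
  then have "smooth_fn \<A> W (\<lambda>p. f a p + (\<Sum>i\<in>F. f i p))" by (intro smooth_fn_add) auto
  then show ?case using insert by simp
qed (auto intro: smooth_fn_const)

lemma smooth_fn_inverse:
  assumes "smooth_fn \<A> W f" "\<And>p. p \<in> W \<Longrightarrow> f p \<noteq> 0"
  shows "smooth_fn \<A> W (\<lambda>p. inverse (f p))"
proof (rule smooth_fnI)
  fix U \<phi> B assume c: "(U, \<phi>, B) \<in> \<A>"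
  have "(f \<circ> inv_into U \<phi>) x \<noteq> 0" if "x \<in> \<phi> ` (U \<inter> W)" for x
    using inv_into_chart_image[OF that chart_inj[OF c]] assms(2) by simp
  then show "smooth_on (\<phi> ` (U \<inter> W)) ((\<lambda>p. inverse (f p)) \<circ> inv_into U \<phi>)"
    using smooth_on_inverse[OF smooth_fn_chart[OF assms(1) c]] by (simp add: comp_def)
qed

lemma smooth_fn_chart_compose:
  assumes "(U, \<phi>, B) \<in> \<A>" "\<And>k. C_k_on k \<beta> UNIV"
  shows "smooth_fn \<A> U (\<lambda>p. \<beta> (\<phi> p))"
proof (rule smooth_fnI)
  fix U' \<phi>' B' assume c: "(U', \<phi>', B') \<in> \<A>"
  show "smooth_on (\<phi>' ` (U' \<inter> U)) ((\<lambda>p. \<beta> (\<phi> p)) \<circ> inv_into U' \<phi>')"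
    using smooth_on_compose[OF open_UNIV assms(2) transition_smooth[OF c assms(1)]] by (simp add: comp_def)
qed

lemma smooth_fn_isCont:
  assumes "smooth_fn \<A> W f" "open W" "p \<in> W"
  shows "isCont f p"
proof -
  obtain U \<phi> B where c: "(U, \<phi>, B) \<in> \<A>" and p: "p \<in> U" using chart_at .
  have "continuous_on (U \<inter> W) \<phi>" using chart_continuous[OF c] continuous_on_subset by blast
  then have "continuous_on (U \<inter> W) (\<lambda>q. (f \<circ> inv_into U \<phi>) (\<phi> q))"
    by (rule continuous_on_compose2[OF smooth_on_imp_continuous_on[OF smooth_fn_chart[OF assms(1) c]]]) simp
  moreover have "(f \<circ> inv_into U \<phi>) (\<phi> q) = f q" if "q \<in> U \<inter> W" for q
    using that chart_inj[OF c] by simp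
  ultimately have "continuous_on (U \<inter> W) f"
    using continuous_on_cong[OF refl] by (metis (no_types, lifting))
  then show ?thesis
    using assms(2,3) p chart_open[OF c] by (simp add: continuous_on_eq_continuous_at open_Int)
qed

lemma smooth_nearI: "smooth_fn \<A> W f \<Longrightarrow> open W \<Longrightarrow> p \<in> W \<Longrightarrow> smooth_near \<A> p f"
  unfolding smooth_near_def by blast

lemma smooth_near_isCont: "smooth_near \<A> p f \<Longrightarrow> isCont f p"
  unfolding smooth_near_def using smooth_fn_isCont by blast

lemma smooth_fn_iff_near:
  assumes "open W"
  shows "smooth_fn \<A> W f \<longleftrightarrow> (\<forall>p\<in>W. smooth_near \<A> p f)"
proof
  assume "\<forall>p\<in>W. smooth_near \<A> p f"
  then show "smooth_fn \<A> W f"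
    by (intro smooth_fn_local) (metis smooth_near_def smooth_fn_mono inf_le1)
qed (use assms smooth_nearI in blast)

lemma smooth_near_cong:
  assumes "smooth_near \<A> p f" "eventually (\<lambda>q. f q = g q) (nhds p)"
  shows "smooth_near \<A> p g"
proof -
  obtain W where W: "open W" "p \<in> W" "smooth_fn \<A> W f" using assms(1) unfolding smooth_near_def by blast
  obtain V where V: "open V" "p \<in> V" "\<And>q. q \<in> V \<Longrightarrow> f q = g q"
    using assms(2) unfolding eventually_nhds by blast
  have "smooth_fn \<A> (W \<inter> V) g"
    using smooth_fn_cong[OF smooth_fn_mono[OF W(3)]] V(3) by blast
  then show ?thesis using W V by (intro smooth_nearI[of "W \<inter> V"]) auto
qed

lemma eventually_smooth_near:
  assumes "smooth_near \<A> p f"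
  shows "eventually (\<lambda>q. smooth_near \<A> q f) (nhds p)"
proof -
  obtain V where "open V" "p \<in> V" "smooth_fn \<A> V f" using assms unfolding smooth_near_def by blast
  then show ?thesis unfolding eventually_nhds using smooth_nearI by blast
qed

lemma smooth_near_const: "smooth_near \<A> p (\<lambda>q. c)"
  using smooth_fn_const smooth_nearI by blast

lemma smooth_near_add:
  assumes "smooth_near \<A> p f" "smooth_near \<A> p g"
  shows "smooth_near \<A> p (\<lambda>q. f q + g q)"
proof -
  obtain V W where "open V" "p \<in> V" "smooth_fn \<A> V f" "open W" "p \<in> W" "smooth_fn \<A> W g"
    using assms unfolding smooth_near_def by blast
  then show ?thesis
    using smooth_fn_mono[OF _ inf_le1] smooth_fn_mono[OF _ inf_le2]
    by (intro smooth_nearI[of "V \<inter> W"] smooth_fn_add) auto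
qed

lemma smooth_near_mult:
  assumes "smooth_near \<A> p f" "smooth_near \<A> p g"
  shows "smooth_near \<A> p (\<lambda>q. f q * g q)"
proof -
  obtain V W where "open V" "p \<in> V" "smooth_fn \<A> V f" "open W" "p \<in> W" "smooth_fn \<A> W g"
    using assms unfolding smooth_near_def by blast
  then show ?thesis
    using smooth_fn_mono[OF _ inf_le1] smooth_fn_mono[OF _ inf_le2]
    by (intro smooth_nearI[of "V \<inter> W"] smooth_fn_mult) auto
qed

lemma smooth_near_diff:
  "smooth_near \<A> p f \<Longrightarrow> smooth_near \<A> p g \<Longrightarrow> smooth_near \<A> p (\<lambda>q. f q - g q)"
  using smooth_near_add[of p f "\<lambda>q. - 1 * g q"] smooth_near_mult[OF smooth_near_const, of p g "- 1"] by simp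

lemma smooth_near_sum:
  "(\<And>i. i \<in> I \<Longrightarrow> smooth_near \<A> p (f i)) \<Longrightarrow> smooth_near \<A> p (\<lambda>q. \<Sum>i\<in>I. f i q)"
proof (induction I rule: infinite_finite_induct)
  case (insert a F)
  then have "smooth_near \<A> p (\<lambda>q. f a q + (\<Sum>i\<in>F. f i q))" by (intro smooth_near_add) auto
  then show ?case using insert by simp
qed (auto intro: smooth_near_const)

lemma smooth_near_eventually_nonzero:
  assumes "smooth_near \<A> p f" "f p \<noteq> 0"
  shows "eventually (\<lambda>q. f q \<noteq> 0) (nhds p)"
  using smooth_near_isCont[OF assms(1)] assms(2)
  by (intro tendsto_imp_eventually_ne[of f "f p"]) (auto simp: isCont_def tendsto_at_iff_tendsto_nhds)

lemma smooth_near_inverse: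
  assumes "smooth_near \<A> p f" "f p \<noteq> 0"
  shows "smooth_near \<A> p (\<lambda>q. inverse (f q))"
proof -
  obtain W where W: "open W" "p \<in> W" "smooth_fn \<A> W f" using assms(1) unfolding smooth_near_def by blast
  obtain V where V: "open V" "p \<in> V" "\<And>q. q \<in> V \<Longrightarrow> f q \<noteq> 0"
    using smooth_near_eventually_nonzero[OF assms] unfolding eventually_nhds by blast
  have "smooth_fn \<A> (W \<inter> V) (\<lambda>q. inverse (f q))"
    using smooth_fn_mono[OF W(3)] V(3) by (intro smooth_fn_inverse) auto
  then show ?thesis using W V by (intro smooth_nearI[of "W \<inter> V"]) auto
qed

section \<open>Bump functions and extension by zero on a manifold with corners\<close>

lemma ex_bump:
  assumes "open O'" "p \<in> O'"
  obtains \<eta> K where "smooth_fn \<A> UNIV \<eta>" "eventually (\<lambda>q. \<eta> q = 1) (nhds p)"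
    "closed K" "K \<subseteq> O'" "\<And>q. q \<notin> K \<Longrightarrow> \<eta> q = 0"
proof -
  obtain U \<phi> B where c: "(U, \<phi>, B) \<in> \<A>" and p: "p \<in> U" using chart_at .
  obtain N where "N \<subseteq> Basis" and "is_chart N (U, \<phi>, B)" using chart_coordinates c by metis
  then have opn: "openin (top_of_set (corner N B)) (\<phi> ` U)" by (simp add: is_chart_def)
  have clos: "closed (corner N B)"
  proof -
    have "corner N B = span N \<inter> (\<Inter>b\<in>B. {x. b \<bullet> x \<ge> 0})" by (auto simp: corner_def inner_commute)
    then show ?thesis by (auto intro!: closed_Int closed_INT closed_halfspace_ge closed_subspace[OF subspace_span])
  qed
  have "openin (top_of_set (corner N B)) (\<phi> ` (U \<inter> O'))"
    using homeomorphism_imp_open_map[OF chart_homeomorphism[OF c]] assms(1) opn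
    by (meson openin_open_Int openin_trans)
  then obtain e where e: "e > 0" "ball (\<phi> p) e \<inter> corner N B \<subseteq> \<phi> ` (U \<inter> O')"
    using p assms(2) unfolding openin_contains_ball by blast
  \<comment> \<open>The bump is 1 up to radius \<open>e / 4\<close> and 0 from radius
    \<open>e / 2\<close> on, which leaves room for a closed ball inside the ball of radius
    \<open>e\<close>.\<close>
  obtain \<beta> where \<beta>: "\<And>k. C_k_on k \<beta> UNIV" "\<And>x. dist (\<phi> p) x < e / 4 \<Longrightarrow> \<beta> x = (1::real)"
    "\<And>x. 2 * (e / 4) \<le> dist (\<phi> p) x \<Longrightarrow> \<beta> x = 0"
    using ex_euclidean_bump[of "e / 4" "\<phi> p"] e(1) by auto
  \<comment> \<open>The support must be closed in the whole manifold and not only in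
    \<open>U\<close>. The model corner is closed, so \<open>K\<close> is the continuous image of a
    compact set, and compact sets in a Hausdorff space are closed.\<close>
  define K where "K = inv_into U \<phi> ` (cball (\<phi> p) (e / 2) \<inter> corner N B)"
  have "cball (\<phi> p) (e / 2) \<subseteq> ball (\<phi> p) e" using e(1) by (simp add: cball_subset_ball_iff)
  then have sub: "cball (\<phi> p) (e / 2) \<inter> corner N B \<subseteq> \<phi> ` (U \<inter> O')"
    using e(2) by (meson Int_mono order_refl order_trans)
  have "compact (cball (\<phi> p) (e / 2) \<inter> corner N B)" by (rule compact_Int_closed[OF compact_cball clos])
  then have "compact K"
    unfolding K_def using chart_homeomorphism[OF c] sub
    by (intro compact_continuous_image) (auto intro!: continuous_on_subset[OF homeomorphism_cont2])
  then have K: "closed K" by (rule compact_imp_closed)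
  have KO: "K \<subseteq> U \<inter> O'" unfolding K_def
    by (rule image_subsetI, rule inv_into_chart_image[OF subsetD[OF sub] chart_inj[OF c]])
  \<comment> \<open>Zero on the open set \<open>- K\<close> by construction, and equal to
    \<open>\<beta>\<close> in coordinates on all of \<open>U\<close>: a point of \<open>U\<close>
    outside \<open>K\<close> has coordinates in the corner but off the closed ball, where
    \<open>\<beta>\<close> vanishes.\<close>
  define \<eta> where "\<eta> q = (if q \<in> K then \<beta> (\<phi> q) else 0)" for q
  have \<eta>U: "\<eta> q = \<beta> (\<phi> q)" if "q \<in> U" for q
  proof (cases "q \<in> K")
    case False
    have "\<phi> q \<in> corner N B" using opn that openin_subset by fastforce
    moreover have "inv_into U \<phi> (\<phi> q) = q" using that chart_inj[OF c] by simp
    ultimately have "\<phi> q \<notin> cball (\<phi> p) (e / 2)" using False unfolding K_def by (metis IntI imageI)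
    then show ?thesis using False \<beta>(3)[of "\<phi> q"] by (simp add: \<eta>_def)
  qed (simp add: \<eta>_def)
  have "smooth_fn \<A> UNIV \<eta>"
  proof (rule smooth_fn_local)
    fix q :: 'm
    show "\<exists>V. open V \<and> q \<in> V \<and> smooth_fn \<A> (V \<inter> UNIV) \<eta>"
    proof (cases "q \<in> U")
      case True
      have "smooth_fn \<A> U \<eta>" using smooth_fn_cong[OF smooth_fn_chart_compose[OF c \<beta>(1)]] \<eta>U by simp
      then show ?thesis using True chart_open[OF c] by auto
    next
      case False
      have "smooth_fn \<A> (- K) \<eta>" by (rule smooth_fn_cong[OF smooth_fn_const[of _ 0]]) (simp add: \<eta>_def)
      then show ?thesis using False K KO by (intro exI[of _ "- K"]) auto
    qed
  qed
  moreover have "eventually (\<lambda>q. \<eta> q = 1) (nhds p)"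
  proof -
    have "open (U \<inter> \<phi> -` ball (\<phi> p) (e / 4))"
      using chart_continuous[OF c] chart_open[OF c] by (simp add: continuous_open_preimage)
    moreover have "p \<in> U \<inter> \<phi> -` ball (\<phi> p) (e / 4)" using p e(1) by simp
    ultimately show ?thesis
      unfolding eventually_nhds using \<eta>U \<beta>(2) by (metis IntE mem_ball vimageE)
  qed
  ultimately show thesis using that K KO by (auto simp: \<eta>_def)
qed

text \<open>The open sets \<open>U\<close> and \<open>- K\<close> cover the manifold, and the
  product is smooth on the trace of each. The set \<open>W\<close> is kept general so that
  coefficients smooth over the interior alone are covered too.\<close>

lemma smooth_fn_extend_by_zero:
  assumes "open U" "smooth_fn \<A> (U \<inter> W) f" "closed K" "K \<subseteq> U" "\<And>q. q \<notin> K \<Longrightarrow> \<eta> q = 0" "smooth_fn \<A> UNIV \<eta>"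
  shows "smooth_fn \<A> W (\<lambda>q. if q \<in> U then \<eta> q * f q else 0)"
proof (rule smooth_fn_local)
  fix q assume "q \<in> W"
  let ?f = "\<lambda>q. if q \<in> U then \<eta> q * f q else 0"
  show "\<exists>V. open V \<and> q \<in> V \<and> smooth_fn \<A> (V \<inter> W) ?f"
  proof (cases "q \<in> U")
    case True
    have "smooth_fn \<A> (U \<inter> W) (\<lambda>q. \<eta> q * f q)"
      using smooth_fn_mono[OF assms(6)] by (intro smooth_fn_mult assms(2)) auto
    then have "smooth_fn \<A> (U \<inter> W) ?f" by (rule smooth_fn_cong) auto
    then show ?thesis using True assms(1) by blast
  next
    case False
    have "smooth_fn \<A> (- K \<inter> W) ?f" by (rule smooth_fn_cong[OF smooth_fn_const[of _ 0]]) (use assms(5) in auto)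
    then show ?thesis using False assms(3,4) by (intro exI[of _ "- K"]) auto
  qed
qed

section \<open>Openness of the interior\<close>

lemma corner_at_chart: "(U, \<phi>, B) \<in> \<A> \<Longrightarrow> is_chart N (U, \<phi>, B) \<Longrightarrow> q \<in> U \<Longrightarrow> \<phi> q \<in> corner N B"
  unfolding is_chart_def using openin_subset by fastforce

text \<open>If the coordinate along \<open>b0\<close> vanished at \<open>p\<close>, possibly
  together with others, then moving along the sum \<open>u\<close> of the other constrained
  directions would make all of those positive while keeping \<open>b0\<close> at zero. The path
  obtained consists of points of codimension 1 for positive times and is connected, hence lies in
  one component; \<open>p\<close> is in its closure and so on a hyperface.\<close>

lemma interior_point_off_chart_boundary:
  assumes p: "p \<in> mfd_interior \<A>" and c: "(U, \<phi>, B) \<in> \<A>" and pU: "p \<in> U" and b0: "b0 \<in> B"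
  shows "\<phi> p \<bullet> b0 \<noteq> 0"
proof
  assume z: "\<phi> p \<bullet> b0 = 0"
  obtain N where N: "N \<subseteq> Basis" and ch: "is_chart N (U, \<phi>, B)" using chart_coordinates c by metis
  have BN: "B \<subseteq> N" and opn: "openin (top_of_set (corner N B)) (\<phi> ` U)" using ch by (auto simp: is_chart_def)
  have finB: "finite B" using finite_subset[OF subset_trans[OF BN(1) N] finite_Basis] .
  define u where "u = (\<Sum>b\<in>B - {b0}. b)"
  have ub: "u \<bullet> b = (if b = b0 then 0 else 1)" if "b \<in> B" for b
  proof -
    have "u \<bullet> b = (\<Sum>b'\<in>B - {b0}. if b' = b then 1 else 0)"
      unfolding u_def inner_sum_left
      using that subset_trans[OF BN N] by (intro sum.cong refl) (auto simp: inner_Basis subset_iff)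
    then show ?thesis using that finB by (simp add: sum.delta')
  qed
  have uN: "u \<in> span N" unfolding u_def using BN by (intro span_sum span_base) auto
  have pc: "\<phi> p \<in> corner N B" using corner_at_chart[OF c ch pU] .
  define y where "y t = \<phi> p + t *\<^sub>R u" for t
  have yc: "y t \<in> corner N B" if "t \<ge> 0" for t
    using pc uN that ub unfolding corner_def y_def
    by (auto simp: inner_add_left intro!: span_add span_scale add_nonneg_nonneg)
  obtain e where e: "e > 0" "ball (\<phi> p) e \<inter> corner N B \<subseteq> \<phi> ` U"
    using opn pU unfolding openin_contains_ball by blast
  \<comment> \<open>The summand 1 keeps the denominator positive when \<open>b0\<close> is the only
    constrained direction and \<open>u = 0\<close>.\<close>
  define \<delta> where "\<delta> = e / (norm u + 1)"
  have \<delta>: "\<delta> > 0" using e(1) by (simp add: \<delta>_def add_nonneg_pos)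
  have yU: "y t \<in> \<phi> ` U" if "0 \<le> t" "t < \<delta>" for t
  proof -
    have "t * (norm u + 1) < e"
      using that(2) unfolding \<delta>_def by (simp add: pos_less_divide_eq add_nonneg_pos)
    then have "t * norm u < e" using that(1) by (simp add: algebra_simps)
    then show ?thesis using e(2) yc[OF that(1)] that(1) by (auto simp: y_def dist_norm)
  qed
  define \<gamma> where "\<gamma> t = inv_into U \<phi> (y t)" for t
  have "continuous_on {0..<\<delta>} y" unfolding y_def by (intro continuous_intros)
  then have cont: "continuous_on {0..<\<delta>} \<gamma>"
    unfolding \<gamma>_def
    by (rule continuous_on_compose2[OF homeomorphism_cont2[OF chart_homeomorphism[OF c]]]) (use yU in auto)
  define S where "S = \<gamma> ` {0<..<\<delta>}"
  have "S \<subseteq> codim_set \<A> 1"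
  proof
    fix q assume "q \<in> S"
    then obtain t where t: "0 < t" "t < \<delta>" "q = \<gamma> t" by (auto simp: S_def)
    have q: "q \<in> U" "\<phi> q = y t" using yU[of t] t by (auto simp: \<gamma>_def inv_into_into f_inv_into_f)
    have "y t \<bullet> b = 0 \<longleftrightarrow> b = b0" if "b \<in> B" for b
    proof -
      have "0 \<le> \<phi> p \<bullet> b" using pc that by (simp add: corner_def)
      then show ?thesis using z ub[OF that] t(1) by (auto simp: y_def inner_add_left)
    qed
    then have "{b \<in> B. \<phi> q \<bullet> b = 0} = {b0}" using b0 q(2) by auto
    then show "q \<in> codim_set \<A> 1" unfolding codim_set_def using c q(1) by (auto intro!: bexI[OF _ c])
  qed
  moreover have "connected S"
    unfolding S_def by (intro connected_continuous_image continuous_on_subset[OF cont]) auto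
  moreover have "codim_set \<A> 1 \<noteq> {}"
  proof -
    have "\<gamma> (\<delta> / 2) \<in> S" using \<delta> by (simp add: S_def)
    then show ?thesis using calculation(1) by blast
  qed
  ultimately obtain C where C: "C \<in> components (codim_set \<A> 1)" "S \<subseteq> C"
    using exists_component_superset[of S "codim_set \<A> 1"] by blast
  have "p = \<gamma> 0" using pU chart_inj[OF c] by (simp add: \<gamma>_def y_def)
  moreover have "\<gamma> 0 \<in> closure S"
  proof (rule Lim_in_closed_set[OF closed_closure])
    have "(\<gamma> \<longlongrightarrow> \<gamma> 0) (at 0 within {0..<\<delta>})" using cont \<delta> by (auto simp: continuous_on_def)
    then show "(\<gamma> \<longlongrightarrow> \<gamma> 0) (at 0 within {0<..<\<delta>})" by (rule tendsto_within_subset) auto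
    show "eventually (\<lambda>t. \<gamma> t \<in> closure S) (at 0 within {0<..<\<delta>})"
      unfolding eventually_at_filter using closure_subset[of S]
      by (intro always_eventually) (auto simp: S_def)
    show "at 0 within {0<..<\<delta>} \<noteq> bot" using \<delta> by (simp add: at_within_eq_bot_iff)
  qed
  ultimately have "p \<in> closure C" using closure_mono[OF C(2)] by blast
  then show False using p C(1) unfolding mfd_interior_def mfd_boundary_def faces_def by blast
qed

text \<open>By invariance of domain, a point all of whose constrained coordinates are positive in one chart
  cannot lie on the boundary of the model corner of another chart.\<close>

lemma chart_interior_not_codim_1:
  assumes c: "(U, \<phi>, B) \<in> \<A>" and qU: "q \<in> U" and pos: "\<And>b. b \<in> B \<Longrightarrow> 0 < \<phi> q \<bullet> b"
  shows "q \<notin> codim_set \<A> 1"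
proof
  assume "q \<in> codim_set \<A> 1"
  then obtain U' \<phi>' B' where c': "(U', \<phi>', B') \<in> \<A>" and qU': "q \<in> U'"
    and card: "card {b\<in>B'. \<phi>' q \<bullet> b = 0} = 1"
    unfolding codim_set_def by blast
  obtain N where N: "N \<subseteq> Basis" and chs: "\<And>c. c \<in> \<A> \<Longrightarrow> is_chart N c" using chart_coordinates by blast
  note ch = chs[OF c] and ch' = chs[OF c']
  have BN: "B \<subseteq> N" "B' \<subseteq> N" and opn: "openin (top_of_set (corner N B)) (\<phi> ` U)"
    using ch ch' by (auto simp: is_chart_def)
  have finB: "finite B" using finite_subset[OF subset_trans[OF BN(1) N] finite_Basis] .
  obtain b where b: "b \<in> B'" "\<phi>' q \<bullet> b = 0" using card by (auto simp: card_1_singleton_iff)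
  have "openin (top_of_set (corner N B)) (\<phi> ` (U \<inter> U'))"
    using homeomorphism_imp_open_map[OF chart_homeomorphism[OF c]] chart_open[OF c'] opn
    by (meson openin_open_Int openin_trans)
  then obtain O' where O': "open O'" "\<phi> ` (U \<inter> U') = corner N B \<inter> O'" unfolding openin_open by blast
  define P where "P = (\<Inter>b\<in>B. {x. 0 < b \<bullet> x})"
  have "open P" unfolding P_def using finB by (intro open_INT) (auto intro: open_halfspace_gt)
  \<comment> \<open>All constrained coordinates are positive on \<open>S\<close>, so
    \<open>S\<close> is open in the linear span of \<open>N\<close> and not merely relative to the
    corner. Both charts use the same \<open>N\<close>, so source and target subspace have equal
    dimension.\<close>
  define S where "S = span N \<inter> (O' \<inter> P)"
  have SU: "S \<subseteq> \<phi> ` (U \<inter> U')" unfolding S_def O'(2) by (auto simp: P_def corner_def inner_commute less_imp_le)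
  have "openin (top_of_set (span N)) S" unfolding S_def using O'(1) \<open>open P\<close> by auto
  moreover have "continuous_on S (\<phi>' \<circ> inv_into U \<phi>)"
    using smooth_on_imp_continuous_on[OF transition_smooth[OF c c']] SU continuous_on_subset by blast
  moreover have inU: "inv_into U \<phi> x \<in> U \<inter> U'" if "x \<in> S" for x
    using inv_into_chart_image[OF subsetD[OF SU that] chart_inj[OF c]] .
  then have img: "(\<phi>' \<circ> inv_into U \<phi>) ` S \<subseteq> corner N B'" using corner_at_chart[OF c' ch'] by auto
  then have "(\<phi>' \<circ> inv_into U \<phi>) \<in> S \<rightarrow> span N" by (auto simp: corner_def)
  moreover have "inj_on (\<phi>' \<circ> inv_into U \<phi>) S"
    using chart_inj[OF c'] inU SU
    by (intro comp_inj_on inj_on_inv_into) (auto intro: inj_on_subset)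
  ultimately have "openin (top_of_set (span N)) ((\<phi>' \<circ> inv_into U \<phi>) ` S)"
    by (intro invariance_of_domain_subspaces) auto
  moreover have "\<phi>' q \<in> (\<phi>' \<circ> inv_into U \<phi>) ` S"
  proof -
    have "\<phi> q \<in> S"
      using pos qU qU' O'(2) corner_at_chart[OF c ch qU]
      by (auto simp: S_def P_def corner_def inner_commute)
    then have "(\<phi>' \<circ> inv_into U \<phi>) (\<phi> q) \<in> (\<phi>' \<circ> inv_into U \<phi>) ` S" by (rule imageI)
    then show ?thesis using chart_inj[OF c] qU by simp
  qed
  ultimately obtain e where e0: "e > 0" "ball (\<phi>' q) e \<inter> span N \<subseteq> (\<phi>' \<circ> inv_into U \<phi>) ` S"
    unfolding openin_contains_ball by (elim conjE) (drule (1) bspec, blast)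
  note e = e0(1) subset_trans[OF e0(2) img]
  have bB: "b \<in> Basis" using b(1) BN N by blast
  \<comment> \<open>A small step against \<open>b\<close> stays in the ball and in the span, yet
    leaves the corner, since the coordinate of \<open>\<phi>' q\<close> along \<open>b\<close> is
    zero.\<close>
  let ?y = "\<phi>' q - (e / 2) *\<^sub>R b"
  have "\<phi>' q \<in> span N" using corner_at_chart[OF c' ch' qU'] by (simp add: corner_def)
  moreover have "b \<in> span N" using b(1) BN by (auto intro: span_base)
  ultimately have "?y \<in> span N" by (intro span_diff span_scale)
  moreover have "?y \<in> ball (\<phi>' q) e" using e(1) bB by (simp add: dist_norm)
  ultimately have "?y \<in> corner N B'" using e(2) by blast
  then have "0 \<le> ?y \<bullet> b" using b(1) by (simp add: corner_def)
  then show False using b(2) e(1) bB by (simp add: inner_diff_left)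
qed

text \<open>A union of closed hyperfaces need not be closed for formal reasons, so the argument is
  local. Near \<open>p\<close> all constrained coordinates of one chart are positive; this open set
  contains no point of codimension 1, hence misses every component of
  \<open>codim_set \<A> 1\<close> and, being open, also its closure.\<close>

lemma open_mfd_interior: "open (mfd_interior \<A>)"
proof (subst open_subopen, intro ballI)
  fix p assume p: "p \<in> mfd_interior \<A>"
  obtain U \<phi> B where c: "(U, \<phi>, B) \<in> \<A>" and pU: "p \<in> U" using chart_at .
  obtain N where N: "N \<subseteq> Basis" and ch: "is_chart N (U, \<phi>, B)" using chart_coordinates c by metis
  have "B \<subseteq> N" using ch by (simp add: is_chart_def)
  then have finB: "finite B" using finite_subset[OF subset_trans[OF _ N] finite_Basis] by blast
  define V where "V = U \<inter> \<phi> -` (\<Inter>b\<in>B. {x. 0 < b \<bullet> x})"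
  have "open (\<Inter>b\<in>B. {x. 0 < b \<bullet> x})" using finB by (intro open_INT) (auto intro: open_halfspace_gt)
  then have "open V"
    unfolding V_def using chart_continuous[OF c] chart_open[OF c] by (simp add: continuous_open_preimage)
  moreover have "p \<in> V"
  proof -
    have "0 < \<phi> p \<bullet> b" if "b \<in> B" for b
      using interior_point_off_chart_boundary[OF p c pU that] corner_at_chart[OF c ch pU] that
      by (force simp: corner_def)
    then show ?thesis using pU by (simp add: V_def inner_commute)
  qed
  moreover have "V \<subseteq> mfd_interior \<A>"
  proof -
    have "V \<inter> codim_set \<A> 1 = {}"
      using chart_interior_not_codim_1[OF c] by (auto simp: V_def inner_commute)
    then have "V \<inter> C = {}" if "C \<in> components (codim_set \<A> 1)" for C
      using in_components_subset[OF that] by blast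
    then have "V \<inter> closure C = {}" if "C \<in> components (codim_set \<A> 1)" for C
      using open_Int_closure_eq_empty[OF \<open>open V\<close>] that by blast
    then show ?thesis unfolding mfd_interior_def mfd_boundary_def faces_def by blast
  qed
  ultimately show "\<exists>T. open T \<and> p \<in> T \<and> T \<subseteq> mfd_interior \<A>" by blast
qed

end

section \<open>Modules of sections and tensorial operators\<close>

lemma sum_fun_apply: "(\<Sum>i\<in>I. f i) x = (\<Sum>i\<in>I. (f i :: 'a \<Rightarrow> 'b::comm_monoid_add) x)"
  by (induction I rule: infinite_finite_induct) simp_all

lemma scaleR_fun_apply: "(c *\<^sub>R f) x = c *\<^sub>R f x"
  by (simp add: scaleR_fun_def)

context atlas
begin

text \<open>The coefficients of \<open>s\<close> with respect to \<open>v 0, \<dots>, v (r - 1)\<close> are found by elimination. With \<open>x\<close>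
  ranging over indices of a Gram matrix this yields the smoothness of the inverse matrix, with \<open>x\<close> ranging over
  smooth functions it yields the smoothness of the coefficients of a vector field in a frame.\<close>

lemma coefficients_smooth_near:
  fixes v :: "nat \<Rightarrow> 'm \<Rightarrow> 'x \<Rightarrow> real"
  assumes "\<And>i x. i < r \<Longrightarrow> x \<in> K \<Longrightarrow> smooth_near \<A> p (\<lambda>q. v i q x)"
    and "\<And>x. x \<in> K \<Longrightarrow> smooth_near \<A> p (\<lambda>q. s q x)"
    and "\<And>x. x \<in> K \<Longrightarrow> eventually (\<lambda>q. s q x = (\<Sum>i<r. c i q * v i q x)) (nhds p)"
    and "\<And>d. (\<And>x. x \<in> K \<Longrightarrow> (\<Sum>i<r. d i * v i p x) = 0) \<Longrightarrow> \<forall>i<r. d i = (0::real)"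
  shows "\<forall>i<r. smooth_near \<A> p (c i)"
  using assms
proof (induction r arbitrary: v s)
  case (Suc r)
  note v = Suc.prems(1) and s = Suc.prems(2) and eq = Suc.prems(3) and indep = Suc.prems(4)
  \<comment> \<open>A pivot exists: otherwise the unit coefficient vector at index \<open>r\<close>
    would be a nontrivial relation at \<open>p\<close>.\<close>
  obtain y where y: "y \<in> K" "v r p y \<noteq> 0"
  proof (rule ccontr)
    assume "\<not> thesis"
    then have "(\<Sum>i<Suc r. (if i = r then 1 else 0) * v i p x) = 0" if "x \<in> K" for x
      using that \<open>\<And>x. x \<in> K \<Longrightarrow> v r p x \<noteq> 0 \<Longrightarrow> thesis\<close> by (simp add: if_distrib[of "\<lambda>a. a * _"] cong: if_cong) blast
    then show False using indep[of "\<lambda>i. if i = r then 1 else 0"] by (metis lessI zero_neq_one)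
  qed
  have nz: "eventually (\<lambda>q. v r q y \<noteq> 0) (nhds p)"
    using smooth_near_eventually_nonzero[OF v y(2)] y(1) by simp
  have inv: "smooth_near \<A> p (\<lambda>q. inverse (v r q y))"
    using smooth_near_inverse[OF v y(2)] y(1) by simp
  \<comment> \<open>Elimination with pivot \<open>v r q y\<close>. Near \<open>p\<close> the last
    vector becomes zero, while the coefficients \<open>c i\<close> for \<open>i < r\<close> are
    unchanged.\<close>
  define v' where "v' i q x = v i q x - v i q y * inverse (v r q y) * v r q x" for i q x
  define s' where "s' q x = s q x - s q y * inverse (v r q y) * v r q x" for q x
  have "\<forall>i<r. smooth_near \<A> p (c i)"
  proof (rule Suc.IH[of v' s'])
    show "smooth_near \<A> p (\<lambda>q. v' i q x)" if "i < r" "x \<in> K" for i x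
      unfolding v'_def using that y(1) by (intro smooth_near_diff smooth_near_mult inv v) auto
    show "smooth_near \<A> p (\<lambda>q. s' q x)" if "x \<in> K" for x
      unfolding s'_def using that y(1) by (intro smooth_near_diff smooth_near_mult inv v s) auto
    show "eventually (\<lambda>q. s' q x = (\<Sum>i<r. c i q * v' i q x)) (nhds p)" if "x \<in> K" for x
      using eq[OF that] eq[OF y(1)] nz
    proof eventually_elim
      case (elim q)
      have "s' q x = (\<Sum>i<Suc r. c i q * v i q x) - (\<Sum>i<Suc r. c i q * v i q y) * inverse (v r q y) * v r q x"
        unfolding s'_def using elim by simp
      also have "\<dots> = (\<Sum>i<Suc r. c i q * v' i q x)"
        unfolding v'_def by (simp only: right_diff_distrib sum_subtractf sum_distrib_right mult.assoc)
      also have "v' r q x = 0" using elim(3) by (simp add: v'_def)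
      then have "(\<Sum>i<Suc r. c i q * v' i q x) = (\<Sum>i<r. c i q * v' i q x)" by simp
      finally show ?case .
    qed
    show "\<forall>i<r. d i = 0" if d: "\<And>x. x \<in> K \<Longrightarrow> (\<Sum>i<r. d i * v' i p x) = 0" for d
    proof -
      \<comment> \<open>The coefficient of \<open>v r\<close> that turns a relation \<open>d\<close>
        among the reduced vectors into a relation among the original ones.\<close>
      let ?t = "- (\<Sum>i<r. d i * v i p y) * inverse (v r p y)"
      have "(\<Sum>i<Suc r. (d(r := ?t)) i * v i p x) = 0" if "x \<in> K" for x
      proof -
        have "(\<Sum>i<Suc r. (d(r := ?t)) i * v i p x) = (\<Sum>i<r. d i * v i p x) + ?t * v r p x" by simp
        also have "\<dots> = (\<Sum>i<r. d i * v' i p x)"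
          unfolding v'_def by (simp add: right_diff_distrib sum_subtractf sum_distrib_right mult.assoc)
        finally show ?thesis using d[OF that] by simp
      qed
      then have "\<forall>i<Suc r. (d(r := ?t)) i = 0" by (rule indep)
      then show ?thesis by (metis fun_upd_other less_Suc_eq less_irrefl)
    qed
  qed
  moreover have "smooth_near \<A> p (c r)"
  proof (rule smooth_near_cong)
    show "smooth_near \<A> p (\<lambda>q. (s q y - (\<Sum>i<r. c i q * v i q y)) * inverse (v r q y))"
      using y(1) calculation by (intro smooth_near_mult smooth_near_diff smooth_near_sum s v inv) auto
    show "eventually (\<lambda>q. (s q y - (\<Sum>i<r. c i q * v i q y)) * inverse (v r q y) = c r q) (nhds p)"
      using eq[OF y(1)] nz by eventually_elim simp
  qed
  ultimately show ?case by (auto simp: less_Suc_eq)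
qed simp

text \<open>Write \<open>s\<close> as \<open>\<theta>^2 s + (1 - \<theta>^2) s\<close>. The
  coefficient of the second term vanishes at \<open>p\<close>. In the first term one factor
  \<open>\<theta>\<close> has already been spent on making the local frame into global elements
  \<open>t i\<close>, as \<open>eq\<close> records; the other factor makes the local coefficients
  \<open>c i\<close> global.\<close>

lemma vanish_by_cutoff:
  fixes s :: "'m \<Rightarrow> 'b::real_vector" and n :: nat
  assumes V: "open V" and L: "closed L" "L \<subseteq> V"
    and \<theta>: "smooth_fn \<A> UNIV \<theta>" "\<And>q. q \<notin> L \<Longrightarrow> \<theta> q = 0" "\<theta> p = 1"
    and c: "\<And>i. i < n \<Longrightarrow> smooth_fn \<A> (V \<inter> W) (c i)" "\<And>i. i < n \<Longrightarrow> c i p = 0"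
    and s: "s \<in> S" and t: "\<And>i. i < n \<Longrightarrow> t i \<in> S"
    and eq: "\<And>q. q \<in> V \<Longrightarrow> \<theta> q *\<^sub>R s q = (\<Sum>i<n. c i q *\<^sub>R t i q)"
  shows "\<exists>(n::nat) f t. (\<forall>i<n. smooth_fn \<A> W (f i) \<and> f i p = 0 \<and> t i \<in> S) \<and> s = (\<Sum>i<n. (\<lambda>q. f i q *\<^sub>R t i q))"
proof -
  \<comment> \<open>Index \<open>n\<close> carries the remainder \<open>(1 - \<theta>^2) s\<close>;
    the smaller indices carry the local expansion.\<close>
  define h where "h i = (if i = n then (\<lambda>q. 1 - \<theta> q * \<theta> q) else (\<lambda>q. if q \<in> V then \<theta> q * c i q else 0))" for i
  define w where "w i = (if i = n then s else t i)" for i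
  have "smooth_fn \<A> W (\<lambda>q. 1 - \<theta> q * \<theta> q)"
    using smooth_fn_mono[OF \<theta>(1)] by (intro smooth_fn_diff smooth_fn_const smooth_fn_mult) auto
  moreover have "smooth_fn \<A> W (\<lambda>q. if q \<in> V then \<theta> q * c i q else 0)" if "i < n" for i
    by (rule smooth_fn_extend_by_zero[OF V c(1)[OF that] L \<theta>(2,1)])
  ultimately have "\<forall>i<Suc n. smooth_fn \<A> W (h i) \<and> h i p = 0 \<and> w i \<in> S"
    using \<theta>(3) c(2) s t by (simp add: h_def w_def less_Suc_eq)
  moreover have "s = (\<Sum>i<Suc n. (\<lambda>q. h i q *\<^sub>R w i q))"
  proof
    fix q
    have "(\<Sum>i<Suc n. (\<lambda>q. h i q *\<^sub>R w i q)) q = (\<Sum>i<n. h i q *\<^sub>R t i q) + (1 - \<theta> q * \<theta> q) *\<^sub>R s q"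
      unfolding sum_fun_apply by (simp add: h_def w_def)
    also have "(\<Sum>i<n. h i q *\<^sub>R t i q) = (\<theta> q * \<theta> q) *\<^sub>R s q"
    proof (cases "q \<in> V")
      case True
      have "(\<Sum>i<n. h i q *\<^sub>R t i q) = \<theta> q *\<^sub>R (\<Sum>i<n. c i q *\<^sub>R t i q)"
        unfolding scaleR_sum_right using True by (intro sum.cong refl) (simp add: h_def)
      then show ?thesis using eq[OF True] by (simp flip: scaleR_scaleR)
    next
      case False
      then have "\<theta> q = 0" using L \<theta>(2) by blast
      then show ?thesis using False by (simp add: h_def)
    qed
    finally show "s q = (\<Sum>i<Suc n. (\<lambda>q. h i q *\<^sub>R w i q)) q" by (simp add: scaleR_left_diff_distrib)
  qed
  ultimately show ?thesis by blast
qed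

end

text \<open>\<open>section_vanish\<close> is the property that forces maps linear over smooth
  functions to act pointwise. The two instances are the sections of \<open>A\<close> with
  \<open>W = UNIV\<close> and the vector fields on the interior with
  \<open>W = M\<^sub>0\<close>.\<close>

locale section_module = atlas \<A> for \<A> :: "('m::t2_space, 'e::euclidean_space) chart set" +
  fixes W :: "'m set" and S :: "('m \<Rightarrow> 'b::real_vector) set"
  assumes section_zero: "0 \<in> S"
    and section_add: "s \<in> S \<Longrightarrow> t \<in> S \<Longrightarrow> s + t \<in> S"
    and section_scale: "smooth_fn \<A> W f \<Longrightarrow> s \<in> S \<Longrightarrow> (\<lambda>p. f p *\<^sub>R s p) \<in> S"
    and section_vanish: "s \<in> S \<Longrightarrow> p \<in> W \<Longrightarrow> s p = 0 \<Longrightarrow>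
      \<exists>(n::nat) f t. (\<forall>i<n. smooth_fn \<A> W (f i) \<and> f i p = 0 \<and> t i \<in> S) \<and> s = (\<Sum>i<n. (\<lambda>q. f i q *\<^sub>R t i q))"
begin

lemma section_minus: "s \<in> S \<Longrightarrow> - s \<in> S"
  using section_scale[OF smooth_fn_const, of s "- 1"] by (simp add: fun_Compl_def)

lemma section_diff: "s \<in> S \<Longrightarrow> t \<in> S \<Longrightarrow> s - t \<in> S"
  using section_add[OF _ section_minus, of s t] by simp

lemma section_sum: "(\<And>i. i \<in> I \<Longrightarrow> t i \<in> S) \<Longrightarrow> (\<Sum>i\<in>I. t i) \<in> S"
  by (induction I rule: infinite_finite_induct) (auto simp: section_zero section_add)

definition tensorial :: "(('m \<Rightarrow> 'b) \<Rightarrow> ('m \<Rightarrow> 'c::real_vector)) \<Rightarrow> bool" where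
  "tensorial h \<longleftrightarrow> (\<forall>s\<in>S. \<forall>t\<in>S. h (s + t) = h s + h t) \<and>
     (\<forall>f. \<forall>s\<in>S. smooth_fn \<A> W f \<longrightarrow> h (\<lambda>p. f p *\<^sub>R s p) = (\<lambda>p. f p *\<^sub>R h s p))"

lemma tensorial_add: "tensorial h \<Longrightarrow> s \<in> S \<Longrightarrow> t \<in> S \<Longrightarrow> h (s + t) = h s + h t"
  unfolding tensorial_def by blast

lemma tensorial_scale:
  "tensorial h \<Longrightarrow> s \<in> S \<Longrightarrow> smooth_fn \<A> W f \<Longrightarrow> h (\<lambda>p. f p *\<^sub>R s p) = (\<lambda>p. f p *\<^sub>R h s p)"
  unfolding tensorial_def by blast

text \<open>Linearity pulls out coefficients that are all zero at \<open>p\<close>. The induction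
  runs over partial sums, each of which has to be kept in \<open>S\<close>, where alone
  \<open>h\<close> is additive.\<close>

lemma tensorial_vanish:
  assumes h: "tensorial h" and s: "s \<in> S" "p \<in> W" "s p = 0"
  shows "h s p = 0"
proof -
  obtain n :: nat and f t where ft: "\<And>i. i < n \<Longrightarrow> smooth_fn \<A> W (f i) \<and> f i p = 0 \<and> t i \<in> S"
    and s_eq: "s = (\<Sum>i<n. (\<lambda>q. f i q *\<^sub>R t i q))"
    using section_vanish[OF s] by blast
  have "h (\<Sum>i<k. (\<lambda>q. f i q *\<^sub>R t i q)) p = 0" if "k \<le> n" for k
    using that
  proof (induction k)
    case 0
    have "h 0 = h 0 + h 0" using tensorial_add[OF h section_zero section_zero] by simp
    then show ?case by (simp add: zero_fun_def)
  next
    case (Suc k)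
    have "(\<Sum>i<k. (\<lambda>q. f i q *\<^sub>R t i q)) \<in> S"
      using ft Suc.prems by (intro section_sum section_scale) auto
    moreover have "(\<lambda>q. f k q *\<^sub>R t k q) \<in> S" using ft Suc.prems by (intro section_scale) auto
    ultimately have "h (\<Sum>i<Suc k. (\<lambda>q. f i q *\<^sub>R t i q)) =
        h (\<Sum>i<k. (\<lambda>q. f i q *\<^sub>R t i q)) + (\<lambda>q. f k q *\<^sub>R h (t k) q)"
      using tensorial_scale[OF h, of "t k" "f k"] ft[of k] Suc.prems
      by (simp only: sum.lessThan_Suc tensorial_add[OF h])
    then have "h (\<Sum>i<Suc k. (\<lambda>q. f i q *\<^sub>R t i q)) p =
        h (\<Sum>i<k. (\<lambda>q. f i q *\<^sub>R t i q)) p + f k p *\<^sub>R h (t k) p"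
      by (simp only: plus_fun_apply)
    then show ?case using Suc.IH Suc.prems ft[of k] by (simp only:) simp
  qed
  then show ?thesis using s_eq by blast
qed

lemma tensorial_pointwise:
  assumes h: "tensorial h" and s: "s \<in> S" and t: "t \<in> S" and p: "p \<in> W" "s p = t p"
  shows "h s p = h t p"
proof -
  have "h (s - t) p = 0" using s t p by (intro tensorial_vanish[OF h] section_diff) auto
  moreover have "h s = h (s - t) + h t" using tensorial_add[OF h section_diff[OF s t] t] by simp
  ultimately show ?thesis by simp
qed

lemma tensorial_add_fun: "tensorial g \<Longrightarrow> tensorial h \<Longrightarrow> tensorial (\<lambda>s. g s + h s)"
  unfolding tensorial_def by (simp add: fun_eq_iff algebra_simps)

lemma tensorial_diff_fun: "tensorial g \<Longrightarrow> tensorial h \<Longrightarrow> tensorial (\<lambda>s. g s - h s)"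
  unfolding tensorial_def by (simp add: fun_eq_iff algebra_simps)

lemma tensorial_minus_fun: "tensorial h \<Longrightarrow> tensorial (\<lambda>s. - h s)"
  unfolding tensorial_def by (simp add: fun_eq_iff)

lemma tensorial_zero_fun: "tensorial (\<lambda>s. 0)"
  unfolding tensorial_def by (simp add: fun_eq_iff)

lemma tensorial_sum_fun: "(\<And>i. i \<in> I \<Longrightarrow> tensorial (h i)) \<Longrightarrow> tensorial (\<lambda>s. \<Sum>i\<in>I. h i s)"
  by (induction I rule: infinite_finite_induct) (simp_all add: tensorial_add_fun tensorial_zero_fun)

lemma tensorial_compose: "tensorial h \<Longrightarrow> (\<And>s. s \<in> S \<Longrightarrow> h s \<in> S) \<Longrightarrow> tensorial g \<Longrightarrow> tensorial (\<lambda>s. g (h s))"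
  unfolding tensorial_def by simp

lemma tensorial_cong:
  assumes "tensorial h" "\<And>s. s \<in> S \<Longrightarrow> g s = h s"
  shows "tensorial g"
  using assms(1) unfolding tensorial_def
  by (simp add: assms(2) section_add section_scale)

section \<open>Operators that are multilinear over smooth functions\<close>

definition multitensorial :: "nat \<Rightarrow> (('m \<Rightarrow> 'b) list \<Rightarrow> ('m \<Rightarrow> 'b)) \<Rightarrow> bool" where
  "multitensorial m N \<longleftrightarrow> (\<forall>ss. length ss = m \<and> set ss \<subseteq> S \<longrightarrow>
     N ss \<in> S \<and> (\<forall>i<m. tensorial (\<lambda>s. N (ss[i := s]))))"

lemma multitensorial_closed: "multitensorial m N \<Longrightarrow> length ss = m \<Longrightarrow> set ss \<subseteq> S \<Longrightarrow> N ss \<in> S"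
  unfolding multitensorial_def by blast

lemma multitensorial_slot:
  "multitensorial m N \<Longrightarrow> length ss = m \<Longrightarrow> set ss \<subseteq> S \<Longrightarrow> i < m \<Longrightarrow> tensorial (\<lambda>s. N (ss[i := s]))"
  unfolding multitensorial_def by blast

text \<open>Arguments are exchanged from left to right, one slot at a time;
  \<open>take k ts @ drop k ss\<close> is the list after \<open>k\<close> exchanges.\<close>

lemma multitensorial_pointwise:
  assumes N: "multitensorial m N" and ss: "length ss = m" "set ss \<subseteq> S" and ts: "length ts = m" "set ts \<subseteq> S"
    and p: "p \<in> W" and eq: "map (\<lambda>s. s p) ss = map (\<lambda>s. s p) ts"
  shows "N ss p = N ts p"
proof -
  have "N (take k ts @ drop k ss) p = N ss p" if "k \<le> m" for k
    using that
  proof (induction k)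
    case (Suc k)
    let ?us = "take k ts @ drop k ss"
    have us: "length ?us = m" "set ?us \<subseteq> S"
      using ss ts Suc.prems set_take_subset[of k ts] set_drop_subset[of k ss] by auto
    have "?us ! k = ss ! k" using Suc.prems ss ts by (simp add: nth_append)
    then have old: "?us[k := ss ! k] = ?us" by (metis list_update_id)
    have new: "?us[k := ts ! k] = take (Suc k) ts @ drop (Suc k) ss"
      using Suc.prems ss ts
      by (simp add: list_update_append take_Suc_conv_app_nth Cons_nth_drop_Suc[symmetric])
    have k: "k < m" using Suc.prems by simp
    then have "ss ! k \<in> S" "ts ! k \<in> S" using ss ts nth_mem by (metis subsetD)+
    moreover have "(ss ! k) p = (ts ! k) p" using arg_cong[OF eq, of "\<lambda>l. l ! k"] k ss ts by simp
    ultimately have "N (?us[k := ts ! k]) p = N (?us[k := ss ! k]) p"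
      using tensorial_pointwise[OF multitensorial_slot[OF N us k] _ _ p] by metis
    then show ?case using Suc old new by simp
  qed simp
  from this[of m] show ?thesis using ss ts by simp
qed

lemma multitensorial_single:
  assumes h: "tensorial h" and closed: "\<And>s. s \<in> S \<Longrightarrow> h s \<in> S"
  shows "multitensorial 1 (\<lambda>ss. h (hd ss))"
  unfolding multitensorial_def
proof (intro allI impI, elim conjE, intro conjI allI impI)
  fix ss assume "length ss = 1" "set ss \<subseteq> S"
  then obtain s where s: "ss = [s]" "s \<in> S" by (auto simp: length_Suc_conv)
  then show "h (hd ss) \<in> S" using closed by simp
  fix i :: nat assume "i < 1"
  then show "tensorial (\<lambda>t. h (hd (ss[i := t])))" using s h by simp
qed

end

section \<open>Curvature and its covariant derivatives for an abstract connection\<close>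

definition curvature_of :: "(('m \<Rightarrow> 'b) \<Rightarrow> ('m \<Rightarrow> 'b) \<Rightarrow> ('m \<Rightarrow> 'b)) \<Rightarrow> (('m \<Rightarrow> 'b) \<Rightarrow> ('m \<Rightarrow> 'b) \<Rightarrow> ('m \<Rightarrow> 'b)) \<Rightarrow>
    ('m \<Rightarrow> 'b) \<Rightarrow> ('m \<Rightarrow> 'b) \<Rightarrow> ('m \<Rightarrow> 'b) \<Rightarrow> ('m \<Rightarrow> 'b::real_vector)" where
  "curvature_of br D X Y Z = D X (D Y Z) - D Y (D X Z) - D (br X Y) Z"

definition covariant_derivative :: "(('m \<Rightarrow> 'b) \<Rightarrow> ('m \<Rightarrow> 'b) \<Rightarrow> ('m \<Rightarrow> 'b)) \<Rightarrow>
    (('m \<Rightarrow> 'b) list \<Rightarrow> ('m \<Rightarrow> 'b)) \<Rightarrow> ('m \<Rightarrow> 'b) list \<Rightarrow> ('m \<Rightarrow> 'b::real_vector)" where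
  "covariant_derivative D N ss =
     D (hd ss) (N (tl ss)) - (\<Sum>i<length (tl ss). N ((tl ss)[i := D (hd ss) (tl ss ! i)]))"

primrec derived_curvature :: "(('m \<Rightarrow> 'b) \<Rightarrow> ('m \<Rightarrow> 'b) \<Rightarrow> ('m \<Rightarrow> 'b)) \<Rightarrow> (('m \<Rightarrow> 'b) \<Rightarrow> ('m \<Rightarrow> 'b) \<Rightarrow> ('m \<Rightarrow> 'b)) \<Rightarrow>
    nat \<Rightarrow> ('m \<Rightarrow> 'b) list \<Rightarrow> ('m \<Rightarrow> 'b::real_vector)" where
  "derived_curvature br D 0 = (\<lambda>ss. curvature_of br D (ss ! 0) (ss ! 1) (ss ! 2))"
| "derived_curvature br D (Suc k) = covariant_derivative D (derived_curvature br D k)"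

lemma curvature_eq: "curvature \<A> conn X Y Z = curvature_of (lie_bracket \<A>) conn X Y Z"
  by (simp add: curvature_def curvature_of_def)

lemma nabla_curvature_eq: "nabla_curvature \<A> conn k ss = derived_curvature (lie_bracket \<A>) conn k ss"
  by (induction k arbitrary: ss) (simp_all only: nabla_curvature.simps derived_curvature.simps curvature_eq covariant_derivative_def)

text \<open>These are the common features of \<open>A\<close> over the manifold with the Koszul
  connection and of the tangent bundle of the interior with the Levi-Civita connection.
  \<open>act_br\<close>, compatibility of the bracket with the action on functions, is what removes
  second derivatives of \<open>f\<close> when the third argument of the curvature is multiplied by
  \<open>f\<close>.\<close>

locale connection_module = section_module \<A> W S
  for \<A> :: "('m::t2_space, 'e::euclidean_space) chart set" and W and S :: "('m \<Rightarrow> 'b::real_vector) set" +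
  fixes act :: "('m \<Rightarrow> 'b) \<Rightarrow> ('m \<Rightarrow> real) \<Rightarrow> 'm \<Rightarrow> real"
    and D :: "('m \<Rightarrow> 'b) \<Rightarrow> ('m \<Rightarrow> 'b) \<Rightarrow> 'm \<Rightarrow> 'b"
    and br :: "('m \<Rightarrow> 'b) \<Rightarrow> ('m \<Rightarrow> 'b) \<Rightarrow> 'm \<Rightarrow> 'b"
  assumes conn: "connection_on \<A> W S act S D"
    and act_smooth: "X \<in> S \<Longrightarrow> smooth_fn \<A> W f \<Longrightarrow> smooth_fn \<A> W (act X f)"
    and br_closed: "X \<in> S \<Longrightarrow> Y \<in> S \<Longrightarrow> br X Y \<in> S"
    and br_anti: "X \<in> S \<Longrightarrow> Y \<in> S \<Longrightarrow> br Y X = - br X Y"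
    and br_add: "X \<in> S \<Longrightarrow> Y \<in> S \<Longrightarrow> Z \<in> S \<Longrightarrow> br X (Y + Z) = br X Y + br X Z"
    and br_scale: "X \<in> S \<Longrightarrow> Y \<in> S \<Longrightarrow> smooth_fn \<A> W f \<Longrightarrow>
      br X (\<lambda>p. f p *\<^sub>R Y p) = (\<lambda>p. f p *\<^sub>R br X Y p + act X f p *\<^sub>R Y p)"
    and act_br: "X \<in> S \<Longrightarrow> Y \<in> S \<Longrightarrow> smooth_fn \<A> W f \<Longrightarrow>
      act (br X Y) f p = act X (act Y f) p - act Y (act X f) p"
begin

lemma
  assumes "X \<in> S" "Y \<in> S"
  shows D_closed: "D X Y \<in> S"
    and D_add_left: "Z \<in> S \<Longrightarrow> D (X + Z) Y = D X Y + D Z Y"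
    and D_add_right: "Z \<in> S \<Longrightarrow> D X (Y + Z) = D X Y + D X Z"
    and D_scale_left: "smooth_fn \<A> W f \<Longrightarrow> D (\<lambda>p. f p *\<^sub>R X p) Y = (\<lambda>p. f p *\<^sub>R D X Y p)"
    and D_scale_right: "smooth_fn \<A> W f \<Longrightarrow>
      D X (\<lambda>p. f p *\<^sub>R Y p) = (\<lambda>p. f p *\<^sub>R D X Y p + act X f p *\<^sub>R Y p)"
  using conn assms unfolding connection_on_def by metis+

lemma D_minus_left: "X \<in> S \<Longrightarrow> Y \<in> S \<Longrightarrow> D (- X) Y = - D X Y"
  using D_scale_left[of X Y "\<lambda>_. - 1"] smooth_fn_const by (simp add: fun_Compl_def)

text \<open>Derived from additivity, since the Leibniz rule would bring in \<open>act X\<close> of a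
  constant.\<close>

lemma D_minus_right: "X \<in> S \<Longrightarrow> Y \<in> S \<Longrightarrow> D X (- Y) = - D X Y"
proof -
  assume X: "X \<in> S" and Y: "Y \<in> S"
  have "D X (- Y) + D X Y = D X 0" using D_add_right[OF X section_minus[OF Y] Y] by simp
  moreover have "D X 0 = 0" using D_add_right[OF X section_zero section_zero] by simp
  ultimately show ?thesis by (simp add: eq_neg_iff_add_eq_0)
qed

lemma tensorial_D_left: "Y \<in> S \<Longrightarrow> tensorial (\<lambda>X. D X Y)"
  unfolding tensorial_def using D_add_left D_scale_left by blast

lemma curvature_closed:
  "X \<in> S \<Longrightarrow> Y \<in> S \<Longrightarrow> Z \<in> S \<Longrightarrow> curvature_of br D X Y Z \<in> S"
  unfolding curvature_of_def by (intro section_diff D_closed br_closed)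

lemma curvature_anti:
  "X \<in> S \<Longrightarrow> Y \<in> S \<Longrightarrow> Z \<in> S \<Longrightarrow> curvature_of br D Y X Z = - curvature_of br D X Y Z"
  unfolding curvature_of_def by (simp add: br_anti[of X Y] D_minus_left br_closed)

text \<open>Multiplying \<open>Y\<close> by \<open>f\<close> creates the term \<open>act X f\<close>
  times \<open>D Y Z\<close> twice: once by the Leibniz rule in \<open>D X (D Y Z)\<close>, once
  from the bracket. They enter with opposite signs.\<close>

lemma curvature_tensorial_middle:
  assumes X: "X \<in> S" and Z: "Z \<in> S"
  shows "tensorial (\<lambda>Y. curvature_of br D X Y Z)"
  unfolding tensorial_def
proof (intro conjI ballI allI impI)
  fix Y Y' assume "Y \<in> S" "Y' \<in> S"
  then show "curvature_of br D X (Y + Y') Z = curvature_of br D X Y Z + curvature_of br D X Y' Z"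
    using X Z by (simp add: curvature_of_def br_add D_add_left D_add_right D_closed br_closed algebra_simps)
next
  fix f Y assume Y: "Y \<in> S" and f: "smooth_fn \<A> W f"
  have "D (br X (\<lambda>p. f p *\<^sub>R Y p)) Z = (\<lambda>p. f p *\<^sub>R D (br X Y) Z p + act X f p *\<^sub>R D Y Z p)"
  proof -
    have "br X (\<lambda>p. f p *\<^sub>R Y p) = (\<lambda>p. f p *\<^sub>R br X Y p) + (\<lambda>p. act X f p *\<^sub>R Y p)"
      unfolding br_scale[OF X Y f] by (simp add: fun_eq_iff)
    then have "D (br X (\<lambda>p. f p *\<^sub>R Y p)) Z = D (\<lambda>p. f p *\<^sub>R br X Y p) Z + D (\<lambda>p. act X f p *\<^sub>R Y p) Z"
      using D_add_left[OF section_scale[OF f br_closed[OF X Y]] Z section_scale[OF act_smooth[OF X f] Y]] by simp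
    also have "\<dots> = (\<lambda>p. f p *\<^sub>R D (br X Y) Z p) + (\<lambda>p. act X f p *\<^sub>R D Y Z p)"
      unfolding D_scale_left[OF br_closed[OF X Y] Z f] D_scale_left[OF Y Z act_smooth[OF X f]] by (rule refl)
    finally show ?thesis by (simp add: fun_eq_iff)
  qed
  then show "curvature_of br D X (\<lambda>p. f p *\<^sub>R Y p) Z = (\<lambda>p. f p *\<^sub>R curvature_of br D X Y Z p)"
    using X Y Z f by (simp add: curvature_of_def fun_eq_iff D_scale_left D_scale_right D_closed algebra_simps)
qed

lemma curvature_tensorial_left:
  assumes Y: "Y \<in> S" and Z: "Z \<in> S"
  shows "tensorial (\<lambda>X. curvature_of br D X Y Z)"
  by (rule tensorial_cong[OF tensorial_minus_fun[OF curvature_tensorial_middle[OF Y Z]]])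
    (rule curvature_anti[OF Y _ Z])

text \<open>The mixed first-order terms are symmetric in \<open>X\<close> and \<open>Y\<close> and
  drop out of the commutator. What remains is the commutator of the two actions on \<open>f\<close>,
  which \<open>act_br\<close> cancels against the bracket term.\<close>

lemma curvature_tensorial_right:
  assumes X: "X \<in> S" and Y: "Y \<in> S"
  shows "tensorial (\<lambda>Z. curvature_of br D X Y Z)"
  unfolding tensorial_def
proof (intro conjI ballI allI impI)
  fix Z Z' assume "Z \<in> S" "Z' \<in> S"
  then show "curvature_of br D X Y (Z + Z') = curvature_of br D X Y Z + curvature_of br D X Y Z'"
    using X Y by (simp add: curvature_of_def D_add_right D_closed br_closed algebra_simps)
next
  fix f Z assume Z: "Z \<in> S" and f: "smooth_fn \<A> W f"
  have DD: "D U (D V (\<lambda>p. f p *\<^sub>R Z p)) = (\<lambda>p. f p *\<^sub>R D U (D V Z) p + act U f p *\<^sub>R D V Z p +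
      act V f p *\<^sub>R D U Z p + act U (act V f) p *\<^sub>R Z p)" if "U \<in> S" "V \<in> S" for U V
  proof -
    have "D V (\<lambda>p. f p *\<^sub>R Z p) = (\<lambda>p. f p *\<^sub>R D V Z p) + (\<lambda>p. act V f p *\<^sub>R Z p)"
      using D_scale_right[OF that(2) Z f] by (simp add: fun_eq_iff)
    then have "D U (D V (\<lambda>p. f p *\<^sub>R Z p)) = D U (\<lambda>p. f p *\<^sub>R D V Z p) + D U (\<lambda>p. act V f p *\<^sub>R Z p)"
      using D_add_right[OF that(1) section_scale[OF f D_closed[OF that(2) Z]] section_scale[OF act_smooth[OF that(2) f] Z]]
      by simp
    then show ?thesis
      unfolding D_scale_right[OF that(1) D_closed[OF that(2) Z] f] D_scale_right[OF that(1) Z act_smooth[OF that(2) f]]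
      by (simp add: fun_eq_iff algebra_simps)
  qed
  show "curvature_of br D X Y (\<lambda>p. f p *\<^sub>R Z p) = (\<lambda>p. f p *\<^sub>R curvature_of br D X Y Z p)"
    unfolding curvature_of_def DD[OF X Y] DD[OF Y X] D_scale_right[OF br_closed[OF X Y] Z f]
    by (simp add: fun_eq_iff act_br[OF X Y f] algebra_simps)
qed

lemma multitensorial_curvature:
  "multitensorial 3 (\<lambda>ss. curvature_of br D (ss ! 0) (ss ! 1) (ss ! 2))"
  unfolding multitensorial_def
proof (intro allI impI, elim conjE, intro conjI allI impI)
  fix ss assume "length ss = 3" "set ss \<subseteq> S"
  then obtain X Y Z where ss: "ss = [X, Y, Z]" and XYZ: "X \<in> S" "Y \<in> S" "Z \<in> S"
    by (auto simp: numeral_3_eq_3 length_Suc_conv)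
  show "curvature_of br D (ss ! 0) (ss ! 1) (ss ! 2) \<in> S"
    using XYZ by (simp add: ss curvature_closed)
  fix i :: nat assume "i < 3"
  then consider "i = 0" | "i = 1" | "i = 2" by linarith
  then show "tensorial (\<lambda>s. curvature_of br D (ss[i := s] ! 0) (ss[i := s] ! 1) (ss[i := s] ! 2))"
    using XYZ curvature_tensorial_left curvature_tensorial_middle curvature_tensorial_right
    by cases (simp_all add: ss)
qed

text \<open>In the direction slot everything is linear because \<open>D\<close> is so in its first
  argument and \<open>N\<close> in each slot. In any other slot the derivative of \<open>f\<close>
  appears once from differentiating the value of \<open>N\<close> and once from differentiating the
  argument in that slot, with opposite signs.\<close>

lemma multitensorial_covariant_derivative:
  assumes N: "multitensorial m N"
  shows "multitensorial (Suc m) (covariant_derivative D N)"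
  unfolding multitensorial_def
proof (intro allI impI, elim conjE, intro conjI allI impI)
  fix ss assume "length ss = Suc m" "set ss \<subseteq> S"
  then obtain x xs where ss: "ss = x # xs" and x: "x \<in> S" and xs: "length xs = m" "set xs \<subseteq> S"
    by (auto simp: length_Suc_conv)
  have upd: "length (xs[i := s]) = m" "set (xs[i := s]) \<subseteq> S" if "s \<in> S" for i s
    using that xs set_update_subset_insert[of xs i s] by auto
  have xsi: "xs ! i \<in> S" if "i < m" for i using that xs nth_mem by (metis subsetD)
  have closed: "N (xs[i := s]) \<in> S" if "s \<in> S" for i s
    using multitensorial_closed[OF N] upd[OF that] by blast
  show "covariant_derivative D N ss \<in> S"
    unfolding covariant_derivative_def ss using x xs xsi multitensorial_closed[OF N xs]
    by (auto intro!: section_diff section_sum closed D_closed)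
  fix i assume i: "i < Suc m"
  show "tensorial (\<lambda>s. covariant_derivative D N (ss[i := s]))"
  proof (cases i)
    case 0
    have "tensorial (\<lambda>s. D s (N xs) - (\<Sum>j<m. N (xs[j := D s (xs ! j)])))"
      using xsi multitensorial_closed[OF N xs]
      by (intro tensorial_diff_fun tensorial_sum_fun tensorial_D_left tensorial_compose[OF tensorial_D_left]
        multitensorial_slot[OF N xs] D_closed) auto
    then show ?thesis by (simp add: 0 ss covariant_derivative_def xs)
  next
    case (Suc k)
    have k: "k < m" using i Suc by simp
    \<comment> \<open>The sum of correction terms is split at \<open>j = k\<close>. For
      \<open>j\<close> different from \<open>k\<close> the two updates commute, so \<open>s\<close>
      enters undifferentiated and the term is tensorial by itself; only the term
      \<open>j = k\<close> must be paired with the outer derivative.\<close>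
    let ?E = "\<lambda>s. \<Sum>j<m. N (xs[k := s, j := D x (xs[k := s] ! j)])"
    let ?F = "\<lambda>s. \<Sum>j\<in>{..<m} - {k}. N (xs[j := D x (xs ! j), k := s])"
    have E: "?E s = N (xs[k := D x s]) + ?F s" for s
    proof -
      have "?E s = N (xs[k := s, k := D x (xs[k := s] ! k)]) + (\<Sum>j\<in>{..<m} - {k}. N (xs[k := s, j := D x (xs[k := s] ! j)]))"
        using k by (intro sum.remove) auto
      also have "N (xs[k := s, k := D x (xs[k := s] ! k)]) = N (xs[k := D x s])" using k xs by simp
      also have "(\<Sum>j\<in>{..<m} - {k}. N (xs[k := s, j := D x (xs[k := s] ! j)])) = ?F s"
        by (intro sum.cong refl) (auto simp: list_update_swap)
      finally show ?thesis .
    qed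
    have F: "tensorial ?F"
      using xsi x k by (intro tensorial_sum_fun multitensorial_slot[OF N] upd D_closed) auto
    note slot = multitensorial_slot[OF N xs k]
    have "tensorial (\<lambda>s. D x (N (xs[k := s])) - N (xs[k := D x s]))"
      unfolding tensorial_def
    proof (intro conjI ballI allI impI)
      fix s t assume "s \<in> S" "t \<in> S"
      then show "D x (N (xs[k := s + t])) - N (xs[k := D x (s + t)]) =
          (D x (N (xs[k := s])) - N (xs[k := D x s])) + (D x (N (xs[k := t])) - N (xs[k := D x t]))"
        using x by (simp add: tensorial_add[OF slot] D_add_right D_closed closed)
    next
      fix f s assume s: "s \<in> S" and f: "smooth_fn \<A> W f"
      have "N (xs[k := D x (\<lambda>p. f p *\<^sub>R s p)]) =
          N (xs[k := (\<lambda>p. f p *\<^sub>R D x s p) + (\<lambda>p. act x f p *\<^sub>R s p)])"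
        unfolding D_scale_right[OF x s f] by (simp add: plus_fun_def)
      also have "\<dots> = (\<lambda>p. f p *\<^sub>R N (xs[k := D x s]) p) + (\<lambda>p. act x f p *\<^sub>R N (xs[k := s]) p)"
        using x s f by (simp add: tensorial_add[OF slot] tensorial_scale[OF slot] section_scale act_smooth D_closed)
      finally show "D x (N (xs[k := \<lambda>p. f p *\<^sub>R s p])) - N (xs[k := D x (\<lambda>p. f p *\<^sub>R s p)]) =
          (\<lambda>p. f p *\<^sub>R (D x (N (xs[k := s])) - N (xs[k := D x s])) p)"
        using x s f
        by (simp add: tensorial_scale[OF slot] D_scale_right closed fun_eq_iff algebra_simps)
    qed
    then have "tensorial (\<lambda>s. (D x (N (xs[k := s])) - N (xs[k := D x s])) - ?F s)"
      by (rule tensorial_diff_fun[OF _ F])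
    moreover have "covariant_derivative D N (ss[i := s]) = (D x (N (xs[k := s])) - N (xs[k := D x s])) - ?F s" for s
      using E[of s] by (simp add: Suc ss covariant_derivative_def xs)
    ultimately show ?thesis by simp
  qed
qed

lemma multitensorial_derived_curvature: "multitensorial (k + 3) (derived_curvature br D k)"
proof (induction k)
  case 0
  show ?case using multitensorial_curvature by (simp only: add_0 derived_curvature.simps)
next
  case (Suc k)
  show ?case
    using multitensorial_covariant_derivative[OF Suc] by (simp only: add_Suc derived_curvature.simps)
qed

text \<open>Among the correction terms, differentiating \<open>X\<close> in the list with
  \<open>X, Y\<close> corresponds to differentiating \<open>X\<close> in its new position in the
  list with \<open>Y, X\<close>, and likewise for \<open>Y\<close>. The induction hypothesis is
  therefore needed for altered arguments, hence the generalisation over \<open>X\<close>,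
  \<open>Y\<close> and \<open>Z\<close>.\<close>

lemma derived_curvature_anti:
  assumes "length ss = k" "set ss \<subseteq> S" "X \<in> S" "Y \<in> S" "Z \<in> S"
  shows "derived_curvature br D k (ss @ [X, Y, Z]) = - derived_curvature br D k (ss @ [Y, X, Z])"
  using assms
proof (induction k arbitrary: ss X Y Z)
  case 0
  then show ?case using curvature_anti[of X Y Z] by simp
next
  case (Suc k)
  then obtain x xs where ss: "ss = x # xs" and x: "x \<in> S" and xs: "length xs = k" "set xs \<subseteq> S"
    by (auto simp: length_Suc_conv)
  let ?R = "derived_curvature br D k"
  have R: "?R (xs @ [X, Y, Z]) = - ?R (xs @ [Y, X, Z])" using Suc.IH xs Suc.prems by blast
  have upd: "length (xs[i := s]) = k" "set (xs[i := s]) \<subseteq> S" if "s \<in> S" for i s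
    using that xs set_update_subset_insert[of xs i s] by auto
  have xsi: "xs ! i \<in> S" if "i < k" for i using that xs nth_mem by (metis subsetD)
  let ?t = "\<lambda>us i. ?R (us[i := D x (us ! i)])"
  have split: "(\<Sum>i<length (xs @ [A, B, C]). ?t (xs @ [A, B, C]) i) =
      (\<Sum>i<k. ?R (xs[i := D x (xs ! i)] @ [A, B, C])) + ?R (xs @ [D x A, B, C]) +
        ?R (xs @ [A, D x B, C]) + ?R (xs @ [A, B, D x C])" for A B C
  proof -
    have "length (xs @ [A, B, C]) = Suc (Suc (Suc k))" using xs by simp
    moreover have "(\<Sum>i<k. ?t (xs @ [A, B, C]) i) = (\<Sum>i<k. ?R (xs[i := D x (xs ! i)] @ [A, B, C]))"
      using xs by (intro sum.cong refl) (simp add: nth_append list_update_append)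
    ultimately show ?thesis
      using xs by (simp add: nth_append list_update_append numeral_2_eq_2 Suc_diff_le)
  qed
  have "(\<Sum>i<k. ?R (xs[i := D x (xs ! i)] @ [X, Y, Z])) = - (\<Sum>i<k. ?R (xs[i := D x (xs ! i)] @ [Y, X, Z]))"
    unfolding sum_negf[symmetric] using x xsi Suc.prems by (intro sum.cong refl Suc.IH upd D_closed) auto
  moreover have "?R (xs @ [D x X, Y, Z]) = - ?R (xs @ [Y, D x X, Z])"
    "?R (xs @ [X, D x Y, Z]) = - ?R (xs @ [D x Y, X, Z])" "?R (xs @ [X, Y, D x Z]) = - ?R (xs @ [Y, X, D x Z])"
    using Suc.IH[OF xs] Suc.prems x D_closed by blast+
  ultimately have sums: "(\<Sum>i<length (xs @ [X, Y, Z]). ?t (xs @ [X, Y, Z]) i) =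
      - (\<Sum>i<length (xs @ [Y, X, Z]). ?t (xs @ [Y, X, Z]) i)"
    unfolding split by simp
  have "?R (xs @ [Y, X, Z]) \<in> S"
    using multitensorial_closed[OF multitensorial_derived_curvature, of "xs @ [Y, X, Z]" k] xs Suc.prems by simp
  then have "D x (?R (xs @ [X, Y, Z])) = - D x (?R (xs @ [Y, X, Z]))"
    unfolding R using D_minus_right x by blast
  moreover have "a - c = - (b - d)" if "a = - b" "c = - d" for a b c d :: "'m \<Rightarrow> 'b"
    using that by simp
  ultimately show ?case
    unfolding ss covariant_derivative_def derived_curvature.simps append_Cons list.sel using sums by blast
qed

end

section \<open>Vector bundles\<close>

lemma linear_map_on_add: "linear_map_on S h \<Longrightarrow> x \<in> S \<Longrightarrow> y \<in> S \<Longrightarrow> h (x + y) = h x + h y"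
  unfolding linear_map_on_def by blast

lemma linear_map_on_scale: "linear_map_on S h \<Longrightarrow> x \<in> S \<Longrightarrow> h (c *\<^sub>R x) = c *\<^sub>R h x"
  unfolding linear_map_on_def by blast

lemma linear_map_on_subset: "linear_map_on S h \<Longrightarrow> T \<subseteq> S \<Longrightarrow> linear_map_on T h"
  unfolding linear_map_on_def by blast

lemma linear_map_on_zero: "linear_map_on S h \<Longrightarrow> subspace S \<Longrightarrow> h 0 = 0"
  using linear_map_on_scale[OF _ subspace_0, of S h 0] by simp

lemma linear_map_on_diff:
  assumes "linear_map_on S h" "subspace S" "x \<in> S" "y \<in> S"
  shows "h (x - y) = h x - h y"
  using linear_map_on_add[OF assms(1) assms(3) subspace_scale[OF assms(2,4), of "- 1"]]
    linear_map_on_scale[OF assms(1,4), of "- 1"] by simp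

lemma linear_map_on_sum:
  assumes "linear_map_on S h" "subspace S" "\<And>i. i \<in> I \<Longrightarrow> x i \<in> S"
  shows "h (\<Sum>i\<in>I. d i *\<^sub>R x i) = (\<Sum>i\<in>I. d i *\<^sub>R h (x i))"
  using assms(3)
proof (induction I rule: infinite_finite_induct)
  case (insert a F)
  have "(\<Sum>i\<in>F. d i *\<^sub>R x i) \<in> S"
    using insert.prems by (intro subspace_sum[OF assms(2)] subspace_scale[OF assms(2)]) auto
  moreover have "d a *\<^sub>R x a \<in> S" using insert.prems by (intro subspace_scale[OF assms(2)]) auto
  ultimately show ?case
    using insert linear_map_on_add[OF assms(1)] linear_map_on_scale[OF assms(1)] by simp
qed (use linear_map_on_zero[OF assms(1,2)] in auto)

section \<open>Inner products on finite-dimensional subspaces\<close>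

definition inner_product_on :: "'a::real_vector set \<Rightarrow> ('a \<Rightarrow> 'a \<Rightarrow> real) \<Rightarrow> bool" where
  "inner_product_on S g \<longleftrightarrow> (\<forall>a\<in>S. linear_map_on S (g a) \<and> (\<forall>b\<in>S. g a b = g b a) \<and> (a \<noteq> 0 \<longrightarrow> 0 < g a a))"

lemma inner_product_on_subset: "inner_product_on S g \<Longrightarrow> T \<subseteq> S \<Longrightarrow> inner_product_on T g"
  unfolding inner_product_on_def using linear_map_on_subset by blast

lemma
  assumes "inner_product_on S g" "a \<in> S"
  shows inner_product_on_linear: "linear_map_on S (g a)"
    and inner_product_on_commute: "b \<in> S \<Longrightarrow> g a b = g b a"
    and inner_product_on_pos: "a \<noteq> 0 \<Longrightarrow> 0 < g a a"
  using assms unfolding inner_product_on_def by simp_all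

lemma inner_product_on_linear_left:
  assumes g: "inner_product_on S g" and S: "subspace S" and a: "a \<in> S"
  shows "linear_map_on S (\<lambda>b. g b a)"
proof -
  have "g b a = g a b" if "b \<in> S" for b using inner_product_on_commute[OF g a that] by simp
  then show ?thesis
    using inner_product_on_linear[OF g a] subspace_add[OF S] subspace_scale[OF S]
    unfolding linear_map_on_def by simp
qed

text \<open>Fibres are subspaces of a bare real vector space, and \<open>g\<close> is just a
  function on them. The representing vector is built by Gram-Schmidt, one spanning vector at a
  time.\<close>

lemma riesz_finite_span:
  assumes "finite B" "inner_product_on (span B) g" "linear_map_on (span B) h"
  shows "\<exists>u\<in>span B. \<forall>z\<in>span B. g u z = h z"
  using assms
proof (induction B arbitrary: h)
  case empty
  have "g 0 0 = 0" using linear_map_on_zero[OF inner_product_on_linear[OF empty(1)] subspace_span] by simp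
  moreover have "h 0 = 0" using linear_map_on_zero[OF empty(2) subspace_span] .
  ultimately show ?case by simp
next
  case (insert b B)
  let ?S = "span (insert b B)"
  note g = insert.prems(1) and h = insert.prems(2)
  note gl = inner_product_on_linear[OF g] and gr = inner_product_on_linear_left[OF g subspace_span]
  have sub: "span B \<subseteq> ?S" by (rule span_mono) auto
  have b: "b \<in> ?S" by (auto intro: span_base)
  note IH = insert.IH[OF inner_product_on_subset[OF g sub]]
  obtain u where u: "u \<in> span B" "\<And>z. z \<in> span B \<Longrightarrow> g u z = h z"
    using IH[OF linear_map_on_subset[OF h sub]] by blast
  \<comment> \<open>The orthogonal projection of \<open>b\<close> onto the old span, obtained as the
    vector representing the functional \<open>g b\<close> there.\<close>
  obtain w where w: "w \<in> span B" "\<And>z. z \<in> span B \<Longrightarrow> g w z = g b z"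
    using IH[OF linear_map_on_subset[OF gl[OF b] sub]] by blast
  define b' where "b' = b - w"
  have b'S: "b' \<in> ?S" unfolding b'_def using b w(1) sub by (intro span_diff) auto
  have uS: "u \<in> ?S" using u(1) sub by blast
  have orth: "g b' z = 0" if "z \<in> span B" for z
    using that w sub b linear_map_on_diff[OF gr subspace_span b, of z w] by (auto simp: b'_def)
  have orth': "g u b' = 0" using orth[OF u(1)] inner_product_on_commute[OF g uS b'S] by simp
  show ?case
  proof (cases "b' = 0")
    case True
    then have "?S = span B" using w(1) by (simp add: b'_def span_redundant)
    then show ?thesis using u by metis
  next
    case False
    \<comment> \<open>Since \<open>u\<close> is orthogonal to \<open>b'\<close>, this is the
      multiple of \<open>b'\<close> that corrects the value at \<open>b'\<close>; values on the old
      span are not affected.\<close>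
    define t where "t = h b' / g b' b'"
    have pos: "g b' b' > 0" using inner_product_on_pos[OF g b'S False] .
    have uS': "u + t *\<^sub>R b' \<in> ?S" using uS b'S by (intro span_add span_scale)
    have "g (u + t *\<^sub>R b') z = h z" if z: "z \<in> ?S" for z
    proof -
      obtain k where "z - k *\<^sub>R b \<in> span B" using z span_breakdown_eq by blast
      then have y: "z - k *\<^sub>R b + k *\<^sub>R w \<in> span B" using w(1) by (intro span_add span_scale)
      define y where "y = z - k *\<^sub>R b + k *\<^sub>R w"
      have yB: "y \<in> span B" and yS: "y \<in> ?S" using y sub by (auto simp: y_def)
      have z_eq: "z = y + k *\<^sub>R b'" by (simp add: y_def b'_def algebra_simps)
      have kb: "k *\<^sub>R b' \<in> ?S" "t *\<^sub>R b' \<in> ?S" using b'S by (auto intro: span_scale)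
      have "g (u + t *\<^sub>R b') z = g u z + t * g b' z"
        using linear_map_on_add[OF gr[OF z] uS kb(2)] linear_map_on_scale[OF gr[OF z] b'S] by simp
      also have "g u z = h y"
        using linear_map_on_add[OF gl[OF uS] yS kb(1)] linear_map_on_scale[OF gl[OF uS] b'S] orth' u(2)[OF yB]
        by (simp add: z_eq)
      also have "g b' z = k * g b' b'"
        using linear_map_on_add[OF gl[OF b'S] yS kb(1)] linear_map_on_scale[OF gl[OF b'S] b'S] orth[OF yB]
        by (simp add: z_eq)
      also have "h y + t * (k * g b' b') = h z"
        using linear_map_on_add[OF h yS kb(1)] linear_map_on_scale[OF h b'S] pos
        by (simp add: z_eq t_def)
      finally show ?thesis .
    qed
    then show ?thesis using uS' by blast
  qed
qed

section \<open>Frames and global sections of a vector bundle\<close>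

locale smooth_bundle = atlas \<A> for \<A> :: "('m::t2_space, 'e::euclidean_space) chart set" +
  fixes E :: "('m, 'v::real_vector) vbundle"
  assumes vector_bundle: "vector_bundle \<A> E"
begin

abbreviation "r \<equiv> vb_rank E"
abbreviation "fibre \<equiv> vb_fibre E"
abbreviation "sections \<equiv> smooth_sections \<A> E"

lemma fibre_subspace: "subspace (fibre p)"
  using vector_bundle unfolding vector_bundle_def by blast

lemma frame_at: obtains U e where "(U, e) \<in> vb_frames E" "p \<in> U"
proof -
  have "\<forall>p. \<exists>(U, e)\<in>vb_frames E. p \<in> U"
    using vector_bundle unfolding vector_bundle_def by (elim conjE) assumption
  then have "\<exists>(U, e)\<in>vb_frames E. p \<in> U" ..
  then show thesis using that by auto
qed

lemma
  assumes "(U, e) \<in> vb_frames E"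
  shows frame_open: "open U"
    and frame_inj: "p \<in> U \<Longrightarrow> inj_on (\<lambda>i. e i p) {..<r}"
    and frame_independent: "p \<in> U \<Longrightarrow> independent ((\<lambda>i. e i p) ` {..<r})"
    and frame_span: "p \<in> U \<Longrightarrow> span ((\<lambda>i. e i p) ` {..<r}) = fibre p"
proof -
  have "\<forall>(U, e)\<in>vb_frames E. open U \<and>
      (\<forall>p\<in>U. inj_on (\<lambda>i. e i p) {..<r} \<and> independent ((\<lambda>i. e i p) ` {..<r}) \<and>
        span ((\<lambda>i. e i p) ` {..<r}) = fibre p)"
    using vector_bundle unfolding vector_bundle_def by (elim conjE) assumption
  from bspec[OF this assms] show "open U" "p \<in> U \<Longrightarrow> inj_on (\<lambda>i. e i p) {..<r}"
    "p \<in> U \<Longrightarrow> independent ((\<lambda>i. e i p) ` {..<r})" "p \<in> U \<Longrightarrow> span ((\<lambda>i. e i p) ` {..<r}) = fibre p"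
    by simp_all
qed

lemma frame_change:
  assumes "(U, e) \<in> vb_frames E" "(U', e') \<in> vb_frames E" "j < r"
  shows "smooth_in_frame \<A> r e (U \<inter> U') (e' j)"
proof -
  have "\<forall>(U, e)\<in>vb_frames E. \<forall>(U', e')\<in>vb_frames E. \<forall>j<r. smooth_in_frame \<A> r e (U \<inter> U') (e' j)"
    using vector_bundle unfolding vector_bundle_def by (elim conjE) assumption
  from bspec[OF this assms(1)] have "\<forall>(U', e')\<in>vb_frames E. \<forall>j<r. smooth_in_frame \<A> r e (U \<inter> U') (e' j)"
    by simp
  from bspec[OF this assms(2)] show ?thesis using assms(3) by simp
qed

lemma frame_in_fibre: "(U, e) \<in> vb_frames E \<Longrightarrow> p \<in> U \<Longrightarrow> i < r \<Longrightarrow> e i p \<in> fibre p"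
  using span_base[of "e i p" "(\<lambda>i. e i p) ` {..<r}"] frame_span[of U e p] by simp

lemma frame_combination_in_fibre:
  "(U, e) \<in> vb_frames E \<Longrightarrow> p \<in> U \<Longrightarrow> (\<Sum>i<r. d i *\<^sub>R e i p) \<in> fibre p"
  by (intro subspace_sum[OF fibre_subspace] subspace_scale[OF fibre_subspace] frame_in_fibre) auto

text \<open>Frames are indexed families, whereas \<open>independent\<close> speaks about sets;
  injectivity of the frame allows the coefficients to be transported to the set of its
  values.\<close>

lemma frame_coefficients_zero:
  assumes f: "(U, e) \<in> vb_frames E" "p \<in> U" and z: "(\<Sum>i<r. d i *\<^sub>R e i p) = 0" and i: "i < r"
  shows "d i = 0"
proof -
  let ?u = "\<lambda>v. d (the_inv_into {..<r} (\<lambda>i. e i p) v)"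
  have inv: "the_inv_into {..<r} (\<lambda>i. e i p) (e j p) = j" if "j < r" for j
    using the_inv_into_f_f[OF frame_inj[OF f], of j] that by simp
  have "(\<Sum>v\<in>(\<lambda>i. e i p) ` {..<r}. ?u v *\<^sub>R v) = (\<Sum>i<r. d i *\<^sub>R e i p)"
    unfolding sum.reindex[OF frame_inj[OF f]] by (intro sum.cong refl) (simp add: inv)
  then have "?u (e i p) = 0"
    using independentD[OF frame_independent[OF f] finite_imageI[OF finite_lessThan] subset_refl, of ?u "e i p"] z i
    by auto
  then show ?thesis using inv[OF i] by simp
qed

lemma frame_coefficients_unique:
  assumes f: "(U, e) \<in> vb_frames E" "p \<in> U" and z: "(\<Sum>i<r. c i *\<^sub>R e i p) = (\<Sum>i<r. d i *\<^sub>R e i p)" and i: "i < r"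
  shows "c i = d i"
  using frame_coefficients_zero[OF f, of "\<lambda>i. c i - d i"] z i by (simp add: scaleR_left_diff_distrib sum_subtractf)

lemma frame_expansion:
  assumes f: "(U, e) \<in> vb_frames E" "p \<in> U" and a: "a \<in> fibre p"
  obtains d where "a = (\<Sum>i<r. d i *\<^sub>R e i p)"
proof -
  have "a \<in> range (\<lambda>u. \<Sum>v\<in>(\<lambda>i. e i p) ` {..<r}. u v *\<^sub>R v)"
    using a frame_span[OF f] span_finite[OF finite_imageI[OF finite_lessThan], of "\<lambda>i. e i p" r] by simp
  then obtain u where "a = (\<Sum>v\<in>(\<lambda>i. e i p) ` {..<r}. u v *\<^sub>R v)" by blast
  then have "a = (\<Sum>i<r. u (e i p) *\<^sub>R e i p)" by (simp add: sum.reindex[OF frame_inj[OF f]])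
  then show thesis by (rule that)
qed

text \<open>The global coefficient at \<open>q\<close> is read off from the expansion chosen at
  \<open>q\<close> itself. Uniqueness of coefficients makes it agree near each \<open>p\<close> with
  the smooth coefficients chosen at \<open>p\<close>.\<close>

lemma smooth_in_frame_local:
  assumes f: "(U, e) \<in> vb_frames E"
    and loc: "\<And>p. p \<in> U \<Longrightarrow> \<exists>c. (\<forall>i<r. smooth_near \<A> p (c i)) \<and>
      eventually (\<lambda>q. s q = (\<Sum>i<r. c i q *\<^sub>R e i q)) (nhds p)"
  shows "smooth_in_frame \<A> r e U s"
proof -
  obtain C where C: "\<And>p i. p \<in> U \<Longrightarrow> i < r \<Longrightarrow> smooth_near \<A> p (C p i)"
    "\<And>p. p \<in> U \<Longrightarrow> eventually (\<lambda>q. s q = (\<Sum>i<r. C p i q *\<^sub>R e i q)) (nhds p)"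
  proof -
    define C where "C p = (SOME c. (\<forall>i<r. smooth_near \<A> p (c i)) \<and>
      eventually (\<lambda>q. s q = (\<Sum>i<r. c i q *\<^sub>R e i q)) (nhds p))" for p
    show thesis by (rule that[of C]) (use someI_ex[OF loc] in \<open>simp_all add: C_def\<close>)
  qed
  define d where "d i q = C q i q" for i q
  have d: "s q = (\<Sum>i<r. d i q *\<^sub>R e i q)" if "q \<in> U" for q
    using eventually_nhds_x_imp_x[OF C(2)[OF that]] by (simp add: d_def)
  have "smooth_fn \<A> U (d i)" if i: "i < r" for i
    unfolding smooth_fn_iff_near[OF frame_open[OF f]]
  proof
    fix p assume p: "p \<in> U"
    have "eventually (\<lambda>q. q \<in> U) (nhds p)" using frame_open[OF f] p eventually_nhds by blast
    with C(2)[OF p] have "eventually (\<lambda>q. C p i q = d i q) (nhds p)"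
    proof eventually_elim
      case (elim q)
      then show ?case
        using frame_coefficients_unique[OF f elim(2) _ i, of "\<lambda>i. C p i q" "\<lambda>i. d i q"] d[OF elim(2)] by simp
    qed
    then show "smooth_near \<A> p (d i)" using smooth_near_cong[OF C(1)[OF p i]] by blast
  qed
  then show ?thesis unfolding smooth_in_frame_def using d by blast
qed

lemma section_in_fibre: "s \<in> sections \<Longrightarrow> s p \<in> fibre p"
  unfolding smooth_sections_def by blast

lemma section_coefficients:
  assumes "s \<in> sections" "(U, e) \<in> vb_frames E"
  obtains c where "\<forall>i<r. smooth_fn \<A> U (c i)" "\<forall>p\<in>U. s p = (\<Sum>i<r. c i p *\<^sub>R e i p)"
  using assms unfolding smooth_sections_def smooth_in_frame_def by blast

text \<open>One frame around each point suffices: the smooth change-of-frame matrix carries the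
  expansion to any other frame, and \<open>smooth_in_frame_local\<close> assembles the
  pieces.\<close>

lemma smooth_sectionI:
  assumes fib: "\<And>p. s p \<in> fibre p"
    and loc: "\<And>p. \<exists>U e c. (U, e) \<in> vb_frames E \<and> p \<in> U \<and> (\<forall>i<r. smooth_near \<A> p (c i)) \<and>
      eventually (\<lambda>q. s q = (\<Sum>i<r. c i q *\<^sub>R e i q)) (nhds p)"
  shows "s \<in> sections"
proof -
  have "smooth_in_frame \<A> r e' U' s" if f': "(U', e') \<in> vb_frames E" for U' e'
  proof (rule smooth_in_frame_local[OF f'])
    fix p assume p: "p \<in> U'"
    obtain U e c where f: "(U, e) \<in> vb_frames E" "p \<in> U" and c: "\<And>i. i < r \<Longrightarrow> smooth_near \<A> p (c i)"
      "eventually (\<lambda>q. s q = (\<Sum>i<r. c i q *\<^sub>R e i q)) (nhds p)"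
      using loc by meson
    obtain a where a: "\<And>i j. i < r \<Longrightarrow> j < r \<Longrightarrow> smooth_fn \<A> (U' \<inter> U) (a i j)"
      "\<And>i q. i < r \<Longrightarrow> q \<in> U' \<inter> U \<Longrightarrow> e i q = (\<Sum>j<r. a i j q *\<^sub>R e' j q)"
      using frame_change[OF f' f(1)] unfolding smooth_in_frame_def by metis
    have UU: "open (U' \<inter> U)" "p \<in> U' \<inter> U" using frame_open[OF f'] frame_open[OF f(1)] p f(2) by auto
    have "smooth_near \<A> p (\<lambda>q. \<Sum>i<r. c i q * a i j q)" if "j < r" for j
      using that by (intro smooth_near_sum smooth_near_mult c smooth_nearI[OF a(1) UU]) auto
    moreover have "eventually (\<lambda>q. q \<in> U' \<inter> U) (nhds p)" using UU eventually_nhds by blast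
    with c(2) have "eventually (\<lambda>q. s q = (\<Sum>j<r. (\<Sum>i<r. c i q * a i j q) *\<^sub>R e' j q)) (nhds p)"
    proof eventually_elim
      case (elim q)
      have "s q = (\<Sum>i<r. c i q *\<^sub>R (\<Sum>j<r. a i j q *\<^sub>R e' j q))" using elim a(2) by simp
      also have "\<dots> = (\<Sum>i<r. \<Sum>j<r. (c i q * a i j q) *\<^sub>R e' j q)" by (simp add: scaleR_sum_right)
      also have "\<dots> = (\<Sum>j<r. (\<Sum>i<r. c i q * a i j q) *\<^sub>R e' j q)"
        unfolding scaleR_sum_left by (rule sum.swap)
      finally show ?case .
    qed
    ultimately show "\<exists>c. (\<forall>i<r. smooth_near \<A> p (c i)) \<and>
        eventually (\<lambda>q. s q = (\<Sum>i<r. c i q *\<^sub>R e' i q)) (nhds p)"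
      by (intro exI[of _ "\<lambda>j q. \<Sum>i<r. c i q * a i j q"]) auto
  qed
  then show ?thesis unfolding smooth_sections_def using fib by blast
qed

text \<open>Operators in this development accept global sections only. The cut-off frame consists of
  global sections and coincides with \<open>e\<close> near \<open>p\<close>. The extra set
  \<open>O'\<close> confines the cutoff to a region where given coefficients are known to be
  smooth.\<close>

lemma cutoff_frame:
  assumes f: "(U, e) \<in> vb_frames E" and p: "p \<in> U" and O': "open O'" "p \<in> O'"
  obtains \<eta> K t where "smooth_fn \<A> UNIV \<eta>" "eventually (\<lambda>q. \<eta> q = 1) (nhds p)"
    "closed K" "K \<subseteq> U \<inter> O'" "\<forall>q. q \<notin> K \<longrightarrow> \<eta> q = 0"
    "\<forall>i<r. t i \<in> sections" "\<forall>i. \<forall>q\<in>U. t i q = \<eta> q *\<^sub>R e i q" "\<forall>i q. q \<notin> U \<longrightarrow> t i q = 0"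
proof -
  have "open (U \<inter> O')" "p \<in> U \<inter> O'" using frame_open[OF f] p O' by auto
  then obtain \<eta> K where \<eta>: "smooth_fn \<A> UNIV \<eta>" "eventually (\<lambda>q. \<eta> q = 1) (nhds p)"
    "closed K" "K \<subseteq> U \<inter> O'" "\<And>q. q \<notin> K \<Longrightarrow> \<eta> q = 0"
    using ex_bump by metis
  define t where "t i q = (if q \<in> U then \<eta> q *\<^sub>R e i q else 0)" for i q
  have "t i \<in> sections" if i: "i < r" for i
  proof (rule smooth_sectionI)
    show "t i q \<in> fibre q" for q
      using frame_in_fibre[OF f _ i] by (auto simp: t_def intro: subspace_scale subspace_0 fibre_subspace)
    fix q
    show "\<exists>U e c. (U, e) \<in> vb_frames E \<and> q \<in> U \<and> (\<forall>i<r. smooth_near \<A> q (c i)) \<and>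
      eventually (\<lambda>q. t i q = (\<Sum>i<r. c i q *\<^sub>R e i q)) (nhds q)"
    proof (cases "q \<in> U")
      case True
      have "smooth_near \<A> q (\<lambda>x. if j = i then \<eta> x else 0)" for j
        using smooth_nearI[OF \<eta>(1) open_UNIV UNIV_I] smooth_near_const[of q 0] by (cases "j = i") simp_all
      moreover have "eventually (\<lambda>x. x \<in> U) (nhds q)" using frame_open[OF f] True eventually_nhds by blast
      then have "eventually (\<lambda>x. t i x = (\<Sum>j<r. (if j = i then \<eta> x else 0) *\<^sub>R e j x)) (nhds q)"
        by eventually_elim (use i in \<open>simp add: t_def if_distrib[of "\<lambda>a. a *\<^sub>R _"] sum.delta cong: if_cong\<close>)
      ultimately show ?thesis
        using f True by (intro exI[of _ U] exI[of _ e] exI[of _ "\<lambda>j x. if j = i then \<eta> x else 0"]) blast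
    next
      case False
      obtain U' e' where f': "(U', e') \<in> vb_frames E" "q \<in> U'" using frame_at .
      have "open (- K)" "q \<in> - K" using \<eta>(3,4) False by auto
      then have "eventually (\<lambda>x. x \<in> - K) (nhds q)" using eventually_nhds by blast
      then have "eventually (\<lambda>x. t i x = (\<Sum>j<r. 0 *\<^sub>R e' j x)) (nhds q)"
        by eventually_elim (use \<eta>(5) in \<open>simp add: t_def\<close>)
      then show ?thesis
        using f' smooth_near_const by (intro exI[of _ U'] exI[of _ e'] exI[of _ "\<lambda>i q. 0"]) auto
    qed
  qed
  then show thesis using that[of \<eta> K t] \<eta> by (simp add: t_def)
qed

lemma smooth_in_frame_scale:
  assumes "smooth_fn \<A> U f" "smooth_in_frame \<A> n e U s"
  shows "smooth_in_frame \<A> n e U (\<lambda>p. f p *\<^sub>R s p)"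
proof -
  obtain c where c: "\<forall>i<n. smooth_fn \<A> U (c i)" "\<forall>p\<in>U. s p = (\<Sum>i<n. c i p *\<^sub>R e i p)"
    using assms(2) unfolding smooth_in_frame_def by blast
  then show ?thesis
    unfolding smooth_in_frame_def
    by (intro exI[of _ "\<lambda>i p. f p * c i p"]) (auto intro: smooth_fn_mult assms(1) simp: scaleR_sum_right)
qed

lemma smooth_in_frame_add:
  assumes "smooth_in_frame \<A> n e U s" "smooth_in_frame \<A> n e U t"
  shows "smooth_in_frame \<A> n e U (s + t)"
proof -
  obtain c where c: "\<forall>i<n. smooth_fn \<A> U (c i)" "\<forall>p\<in>U. s p = (\<Sum>i<n. c i p *\<^sub>R e i p)"
    using assms(1) unfolding smooth_in_frame_def by blast
  obtain d where d: "\<forall>i<n. smooth_fn \<A> U (d i)" "\<forall>p\<in>U. t p = (\<Sum>i<n. d i p *\<^sub>R e i p)"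
    using assms(2) unfolding smooth_in_frame_def by blast
  show ?thesis
    unfolding smooth_in_frame_def using c d
    by (intro exI[of _ "\<lambda>i p. c i p + d i p"]) (auto intro: smooth_fn_add simp: scaleR_left_distrib sum.distrib)
qed

lemma smooth_in_frame_zero: "smooth_in_frame \<A> n e U 0"
  unfolding smooth_in_frame_def by (intro exI[of _ "\<lambda>i p. 0"]) (auto intro: smooth_fn_const)

lemma zero_in_sections: "0 \<in> sections"
  unfolding smooth_sections_def using smooth_in_frame_zero subspace_0[OF fibre_subspace] by auto

lemma add_in_sections: "s \<in> sections \<Longrightarrow> t \<in> sections \<Longrightarrow> s + t \<in> sections"
  unfolding smooth_sections_def using smooth_in_frame_add subspace_add[OF fibre_subspace] by fastforce

lemma scale_in_sections: "smooth_fn \<A> UNIV f \<Longrightarrow> s \<in> sections \<Longrightarrow> (\<lambda>p. f p *\<^sub>R s p) \<in> sections"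
  unfolding smooth_sections_def
  using smooth_in_frame_scale[OF smooth_fn_mono[OF _ subset_UNIV]] subspace_scale[OF fibre_subspace] by fastforce

lemma sections_vanish:
  assumes s: "s \<in> sections" and z: "s p = 0"
  shows "\<exists>(n::nat) f t. (\<forall>i<n. smooth_fn \<A> UNIV (f i) \<and> f i p = 0 \<and> t i \<in> sections) \<and>
    s = (\<Sum>i<n. (\<lambda>q. f i q *\<^sub>R t i q))"
proof -
  obtain U e where f: "(U, e) \<in> vb_frames E" "p \<in> U" using frame_at .
  obtain c where c: "\<forall>i<r. smooth_fn \<A> U (c i)" "\<forall>p\<in>U. s p = (\<Sum>i<r. c i p *\<^sub>R e i p)"
    using section_coefficients[OF s f(1)] .
  note c = c[rule_format]
  obtain \<eta> K t where \<eta>: "smooth_fn \<A> UNIV \<eta>" "eventually (\<lambda>q. \<eta> q = 1) (nhds p)"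
    "closed K" "K \<subseteq> U \<inter> UNIV" "\<forall>q. q \<notin> K \<longrightarrow> \<eta> q = 0"
    and t: "\<forall>i<r. t i \<in> sections" "\<forall>i. \<forall>q\<in>U. t i q = \<eta> q *\<^sub>R e i q" "\<forall>i q. q \<notin> U \<longrightarrow> t i q = 0"
    using cutoff_frame[OF f open_UNIV UNIV_I] .
  note \<eta> = \<eta>[rule_format] and t = t[rule_format]
  show ?thesis
  proof (rule vanish_by_cutoff[OF frame_open[OF f(1)] \<eta>(3) _ \<eta>(1,5) eventually_nhds_x_imp_x[OF \<eta>(2)] _ _ s t(1)])
    show "K \<subseteq> U" using \<eta>(4) by simp
    show "smooth_fn \<A> (U \<inter> UNIV) (c i)" if "i < r" for i using c(1)[OF that] by simp
    show "c i p = 0" if "i < r" for i using frame_coefficients_zero[OF f _ that] c(2)[OF f(2)] z by metis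
    show "\<eta> q *\<^sub>R s q = (\<Sum>i<r. c i q *\<^sub>R t i q)" if "q \<in> U" for q
      using that c(2) t(2) by (simp add: scaleR_sum_right mult.commute)
  qed
qed

sublocale section_module \<A> UNIV sections
  by unfold_locales (use zero_in_sections add_in_sections scale_in_sections sections_vanish in auto)

lemma section_through:
  assumes "a \<in> fibre p"
  obtains s where "s \<in> sections" "s p = a"
proof -
  obtain U e where f: "(U, e) \<in> vb_frames E" "p \<in> U" using frame_at .
  obtain d where d: "a = (\<Sum>i<r. d i *\<^sub>R e i p)" using frame_expansion[OF f assms] .
  obtain \<eta> K t where \<eta>: "smooth_fn \<A> UNIV \<eta>" "eventually (\<lambda>q. \<eta> q = 1) (nhds p)"
    "closed K" "K \<subseteq> U \<inter> UNIV" "\<forall>q. q \<notin> K \<longrightarrow> \<eta> q = 0"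
    and t: "\<forall>i<r. t i \<in> sections" "\<forall>i. \<forall>q\<in>U. t i q = \<eta> q *\<^sub>R e i q" "\<forall>i q. q \<notin> U \<longrightarrow> t i q = 0"
    using cutoff_frame[OF f open_UNIV UNIV_I] .
  note \<eta> = \<eta>[rule_format] and t = t[rule_format]
  have "\<eta> p = 1" using eventually_nhds_x_imp_x[OF \<eta>(2)] .
  then have "(\<Sum>i<r. (\<lambda>q. d i *\<^sub>R t i q)) p = a" using t(2)[OF f(2)] by (simp add: sum_fun_apply d)
  moreover have "(\<Sum>i<r. (\<lambda>q. d i *\<^sub>R t i q)) \<in> sections"
    by (intro section_sum section_scale smooth_fn_const t) auto
  ultimately show thesis using that by blast
qed

text \<open>The value on vectors at \<open>p\<close> is computed from arbitrary sections through
  them, and \<open>multitensorial_pointwise\<close> makes the choice immaterial. For smoothness, the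
  frame is replaced near \<open>p\<close> by one fixed list of cut-off frame sections, whose image
  under \<open>N\<close> is a smooth section.\<close>

lemma tensor_of_multitensorial:
  assumes N: "multitensorial m N"
  obtains T where "tensor_section \<A> E m T"
    "\<And>ss p. length ss = m \<Longrightarrow> set ss \<subseteq> sections \<Longrightarrow> T p (map (\<lambda>s. s p) ss) = N ss p"
proof -
  define sec where "sec p a = (SOME s. s \<in> sections \<and> s p = a)" for p a
  have sec: "sec p a \<in> sections \<and> sec p a p = a" if a: "a \<in> fibre p" for p a
  proof -
    obtain s where "s \<in> sections \<and> s p = a" using section_through[OF a] by blast
    then show ?thesis unfolding sec_def by (rule someI[where P = "\<lambda>s. s \<in> sections \<and> s p = a"])
  qed
  define T where "T p as = N (map (sec p) as) p" for p as
  have T: "T p (map (\<lambda>s. s p) ss) = N ss p" if ss: "length ss = m" "set ss \<subseteq> sections" for ss p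
    unfolding T_def
  proof (rule multitensorial_pointwise[OF N _ _ ss UNIV_I])
    show "length (map (sec p) (map (\<lambda>s. s p) ss)) = m" using ss by simp
    show "set (map (sec p) (map (\<lambda>s. s p) ss)) \<subseteq> sections" using ss sec section_in_fibre by auto
    show "map (\<lambda>s. s p) (map (sec p) (map (\<lambda>s. s p) ss)) = map (\<lambda>s. s p) ss"
      using ss sec section_in_fibre by auto
  qed
  have "tensor_section \<A> E m T"
    unfolding tensor_section_def
  proof (intro conjI allI impI ballI; clarify?)
    fix p as assume m: "m = length as" and as: "set as \<subseteq> fibre p"
    let ?ss = "map (sec p) as"
    have ss: "length ?ss = length as" "set ?ss \<subseteq> sections" using as sec by auto
    show "T p as \<in> fibre p" unfolding T_def using multitensorial_closed[OF N] ss m section_in_fibre by metis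
    fix i assume i: "i < length as"
    have as_eq: "map (\<lambda>s. s p) ?ss = as" using as sec by (auto simp: comp_def intro!: map_idI)
    have upd: "T p (as[i := s p]) = N (?ss[i := s]) p" if "s \<in> sections" for s
    proof -
      have "set (?ss[i := s]) \<subseteq> sections" by (rule subset_trans[OF set_update_subset_insert]) (use ss(2) that in simp)
      then have "T p (map (\<lambda>s. s p) (?ss[i := s])) = N (?ss[i := s]) p" using T m by simp
      then show ?thesis using as_eq by (simp add: map_update)
    qed
    note slot = multitensorial_slot[OF N _ ss(2), unfolded m, OF ss(1) i]
    show "linear_map_on (fibre p) (\<lambda>a. T p (as[i := a]))"
      unfolding linear_map_on_def
    proof (intro conjI ballI allI)
      fix a b assume "a \<in> fibre p" "b \<in> fibre p"
      then obtain s t where st: "s \<in> sections" "s p = a" "t \<in> sections" "t p = b"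
        using section_through by metis
      then show "T p (as[i := a + b]) = T p (as[i := a]) + T p (as[i := b])"
        using upd[OF section_add[OF st(1,3)]] upd[OF st(1)] upd[OF st(3)] tensorial_add[OF slot st(1,3)]
        by simp
    next
      fix c a assume "a \<in> fibre p"
      then obtain s where s: "s \<in> sections" "s p = a" using section_through by metis
      then show "T p (as[i := c *\<^sub>R a]) = c *\<^sub>R T p (as[i := a])"
        using upd[OF section_scale[OF smooth_fn_const s(1)], of c] upd[OF s(1)]
          tensorial_scale[OF slot s(1) smooth_fn_const, of c]
        by simp
    qed
  next
    fix U e js assume f: "(U, e) \<in> vb_frames E" and m: "m = length js" and js: "set js \<subseteq> {..<r}"
    show "smooth_in_frame \<A> r e U (\<lambda>p. T p (map (\<lambda>i. e i p) js))"
    proof (rule smooth_in_frame_local[OF f])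
      fix p assume p: "p \<in> U"
      obtain \<eta> K t where \<eta>: "smooth_fn \<A> UNIV \<eta>" "eventually (\<lambda>q. \<eta> q = 1) (nhds p)"
        "closed K" "K \<subseteq> U \<inter> UNIV" "\<forall>q. q \<notin> K \<longrightarrow> \<eta> q = 0"
        and t: "\<forall>i<r. t i \<in> sections" "\<forall>i. \<forall>q\<in>U. t i q = \<eta> q *\<^sub>R e i q" "\<forall>i q. q \<notin> U \<longrightarrow> t i q = 0"
        using cutoff_frame[OF f p open_UNIV UNIV_I] .
  note \<eta> = \<eta>[rule_format] and t = t[rule_format]
      have ss: "length (map t js) = m" "set (map t js) \<subseteq> sections" using m js t(1) by auto
      obtain c where c: "\<forall>i<r. smooth_fn \<A> U (c i)"
        "\<forall>q\<in>U. N (map t js) q = (\<Sum>i<r. c i q *\<^sub>R e i q)"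
        using section_coefficients[OF multitensorial_closed[OF N ss] f] .
  note c = c[rule_format]
      have "eventually (\<lambda>q. q \<in> U) (nhds p)" using frame_open[OF f] p eventually_nhds by blast
      with \<eta>(2) have "eventually (\<lambda>q. T q (map (\<lambda>i. e i q) js) = (\<Sum>i<r. c i q *\<^sub>R e i q)) (nhds p)"
      proof eventually_elim
        case (elim q)
        have "map (\<lambda>i. e i q) js = map (\<lambda>s. s q) (map t js)" using t(2)[OF elim(2)] elim(1) by simp
        then show ?case using T[OF ss, of q] c(2)[OF elim(2)] by metis
      qed
      then show "\<exists>c. (\<forall>i<r. smooth_near \<A> p (c i)) \<and>
          eventually (\<lambda>q. T q (map (\<lambda>i. e i q) js) = (\<Sum>i<r. c i q *\<^sub>R e i q)) (nhds p)"
        using c(1) smooth_nearI frame_open[OF f] p by blast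
    qed
  qed
  then show thesis using that T by blast
qed

end

section \<open>Tangent vectors and vector fields\<close>

context atlas
begin

lemma
  assumes "v \<in> tangent_space \<A> p"
  shows tangent_nonsmooth: "\<not> smooth_near \<A> p f \<Longrightarrow> v f = 0"
    and tangent_cong: "smooth_near \<A> p f \<Longrightarrow> eventually (\<lambda>q. f q = h q) (nhds p) \<Longrightarrow> v f = v h"
    and tangent_add: "smooth_near \<A> p f \<Longrightarrow> smooth_near \<A> p h \<Longrightarrow> v (\<lambda>q. f q + h q) = v f + v h"
    and tangent_cmult: "smooth_near \<A> p f \<Longrightarrow> v (\<lambda>q. c * f q) = c * v f"
    and tangent_mult: "smooth_near \<A> p f \<Longrightarrow> smooth_near \<A> p h \<Longrightarrow> v (\<lambda>q. f q * h q) = v f * h p + f p * v h"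
  using assms unfolding tangent_space_def by simp_all

lemma tangent_zero: "0 \<in> tangent_space \<A> p"
  unfolding tangent_space_def by simp

lemma tangent_space_add:
  assumes "v \<in> tangent_space \<A> p" "w \<in> tangent_space \<A> p"
  shows "v + w \<in> tangent_space \<A> p"
proof -
  have "v f + w f = v h + w h" if "smooth_near \<A> p f" "eventually (\<lambda>q. f q = h q) (nhds p)" for f h
    using tangent_cong[OF assms(1) that] tangent_cong[OF assms(2) that] by simp
  then show ?thesis
    unfolding tangent_space_def
    by (auto simp: tangent_nonsmooth[OF assms(1)] tangent_nonsmooth[OF assms(2)]
      tangent_add[OF assms(1)] tangent_add[OF assms(2)] tangent_cmult[OF assms(1)] tangent_cmult[OF assms(2)]
      tangent_mult[OF assms(1)] tangent_mult[OF assms(2)] algebra_simps)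
qed

lemma tangent_space_scale:
  assumes "v \<in> tangent_space \<A> p"
  shows "c *\<^sub>R v \<in> tangent_space \<A> p"
proof -
  have "c * v f = c * v h" if "smooth_near \<A> p f" "eventually (\<lambda>q. f q = h q) (nhds p)" for f h
    using tangent_cong[OF assms(1) that] by simp
  then show ?thesis
    unfolding tangent_space_def
    by (auto simp: scaleR_fun_apply tangent_nonsmooth[OF assms(1)]
      tangent_add[OF assms(1)] tangent_cmult[OF assms(1)] tangent_mult[OF assms(1)] algebra_simps)
qed

lemma
  assumes "X \<in> vector_fields \<A> W"
  shows vector_field_tangent: "p \<in> W \<Longrightarrow> X p \<in> tangent_space \<A> p"
    and vector_field_outside: "p \<notin> W \<Longrightarrow> X p = 0"
    and vector_field_smooth: "open W' \<Longrightarrow> W' \<subseteq> W \<Longrightarrow> smooth_fn \<A> W' f \<Longrightarrow> smooth_fn \<A> W' (\<lambda>p. X p f)"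
  using assms unfolding vector_fields_def by simp_all

lemma vector_field_tangent': "X \<in> vector_fields \<A> W \<Longrightarrow> X p \<in> tangent_space \<A> p"
  using vector_field_tangent vector_field_outside tangent_zero by metis

lemma vector_field_smooth_near:
  assumes X: "X \<in> vector_fields \<A> W" and W: "open W" "p \<in> W" and f: "smooth_near \<A> p f"
  shows "smooth_near \<A> p (\<lambda>q. X q f)"
proof -
  obtain V where V: "open V" "p \<in> V" "smooth_fn \<A> V f" using f unfolding smooth_near_def by blast
  have "smooth_fn \<A> (V \<inter> W) (\<lambda>q. X q f)"
    using V W smooth_fn_mono[OF V(3)] by (intro vector_field_smooth[OF X]) auto
  then show ?thesis using V W by (intro smooth_nearI[of "V \<inter> W"]) auto
qed

lemma vector_fields_zero: "0 \<in> vector_fields \<A> W"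
  unfolding vector_fields_def by (auto simp: tangent_zero smooth_fn_const)

lemma vector_fields_add:
  "X \<in> vector_fields \<A> W \<Longrightarrow> Y \<in> vector_fields \<A> W \<Longrightarrow> X + Y \<in> vector_fields \<A> W"
  unfolding vector_fields_def by (auto intro: tangent_space_add smooth_fn_add)

lemma vector_fields_scale:
  "smooth_fn \<A> W f \<Longrightarrow> X \<in> vector_fields \<A> W \<Longrightarrow> (\<lambda>p. f p *\<^sub>R X p) \<in> vector_fields \<A> W"
  unfolding vector_fields_def
  by (auto simp: scaleR_fun_apply intro: tangent_space_scale smooth_fn_mult smooth_fn_mono)

lemma lie_bracket_anti: "lie_bracket \<A> Y X = - lie_bracket \<A> X Y"
  by (simp add: lie_bracket_def fun_eq_iff)

lemma lie_bracket_act: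
  assumes "X \<in> vector_fields \<A> W" "Y \<in> vector_fields \<A> W"
  shows "p \<in> W \<Longrightarrow> smooth_near \<A> p f \<Longrightarrow> lie_bracket \<A> X Y p f = X p (\<lambda>q. Y q f) - Y p (\<lambda>q. X q f)"
    and "p \<notin> W \<Longrightarrow> lie_bracket \<A> X Y p f = 0"
  using vector_field_outside[OF assms(1)] vector_field_outside[OF assms(2)]
  by (simp_all add: lie_bracket_def)

text \<open>Tangent vectors are functionals on all functions, so equality also has to hold on
  non-smooth functions and at points outside \<open>W\<close>. The normalisations to 0 settle both
  cases and leave the identity on smooth germs.\<close>

lemma lie_bracket_eqI:
  assumes W: "open W" and XY: "X \<in> vector_fields \<A> W" "Y \<in> vector_fields \<A> W"
    and Z: "\<And>p. Z p \<in> tangent_space \<A> p" "\<And>p. p \<notin> W \<Longrightarrow> Z p = 0"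
    and eq: "\<And>p f. p \<in> W \<Longrightarrow> smooth_near \<A> p f \<Longrightarrow> X p (\<lambda>q. Y q f) - Y p (\<lambda>q. X q f) = Z p f"
  shows "lie_bracket \<A> X Y = Z"
proof (intro ext)
  fix p f
  consider "p \<notin> W" | "p \<in> W" "smooth_near \<A> p f" | "\<not> smooth_near \<A> p f" by blast
  then show "lie_bracket \<A> X Y p f = Z p f"
  proof cases
    case 1 then show ?thesis using lie_bracket_act(2)[OF XY] Z(2) by simp
  next
    case 2 then show ?thesis using lie_bracket_act(1)[OF XY] eq by simp
  next
    case 3 then show ?thesis using tangent_nonsmooth[OF Z(1)] by (simp add: lie_bracket_def)
  qed
qed

lemma lie_bracket_outside:
  "X \<in> vector_fields \<A> W \<Longrightarrow> Y \<in> vector_fields \<A> W \<Longrightarrow> p \<notin> W \<Longrightarrow> lie_bracket \<A> X Y p = 0"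
  using lie_bracket_act(2) by (simp add: fun_eq_iff)

text \<open>That brackets are tangent vectors enters as a hypothesis. Over the whole manifold it
  comes from the closure of \<open>\<V>\<close> under brackets, over the interior from
  torsion-freeness of the given connection.\<close>

lemma lie_bracket_add:
  assumes W: "open W" and X: "X \<in> vector_fields \<A> W" and Y: "Y \<in> vector_fields \<A> W" and Z: "Z \<in> vector_fields \<A> W"
    and br: "\<And>p. lie_bracket \<A> X Y p \<in> tangent_space \<A> p" "\<And>p. lie_bracket \<A> X Z p \<in> tangent_space \<A> p"
  shows "lie_bracket \<A> X (Y + Z) = lie_bracket \<A> X Y + lie_bracket \<A> X Z"
proof (rule lie_bracket_eqI[OF W X vector_fields_add[OF Y Z]])
  show "(lie_bracket \<A> X Y + lie_bracket \<A> X Z) p \<in> tangent_space \<A> p" for p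
    using br by (simp add: tangent_space_add)
  show "p \<notin> W \<Longrightarrow> (lie_bracket \<A> X Y + lie_bracket \<A> X Z) p = 0" for p
    using lie_bracket_outside[OF X Y] lie_bracket_outside[OF X Z] by simp
  fix p f assume p: "p \<in> W" and f: "smooth_near \<A> p f"
  show "X p (\<lambda>q. (Y + Z) q f) - (Y + Z) p (\<lambda>q. X q f) = (lie_bracket \<A> X Y + lie_bracket \<A> X Z) p f"
    using tangent_add[OF vector_field_tangent[OF X p] vector_field_smooth_near[OF Y W p f] vector_field_smooth_near[OF Z W p f]]
    by (simp add: lie_bracket_act(1)[OF X Y p f] lie_bracket_act(1)[OF X Z p f])
qed

lemma lie_bracket_scale:
  assumes W: "open W" and X: "X \<in> vector_fields \<A> W" and Y: "Y \<in> vector_fields \<A> W" and f: "smooth_fn \<A> W f"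
    and br: "\<And>p. lie_bracket \<A> X Y p \<in> tangent_space \<A> p"
  shows "lie_bracket \<A> X (\<lambda>p. f p *\<^sub>R Y p) = (\<lambda>p. f p *\<^sub>R lie_bracket \<A> X Y p + X p f *\<^sub>R Y p)"
proof (rule lie_bracket_eqI[OF W X vector_fields_scale[OF f Y]])
  show "f p *\<^sub>R lie_bracket \<A> X Y p + X p f *\<^sub>R Y p \<in> tangent_space \<A> p" for p
    using br vector_field_tangent'[OF Y] by (intro tangent_space_add tangent_space_scale)
  show "p \<notin> W \<Longrightarrow> f p *\<^sub>R lie_bracket \<A> X Y p + X p f *\<^sub>R Y p = 0" for p
    using lie_bracket_outside[OF X Y] vector_field_outside[OF Y] by simp
  fix p h assume p: "p \<in> W" and h: "smooth_near \<A> p h"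
  have "X p (\<lambda>q. f q * Y q h) = X p f * Y p h + f p * X p (\<lambda>q. Y q h)"
    using tangent_mult[OF vector_field_tangent[OF X p] smooth_nearI[OF f W p] vector_field_smooth_near[OF Y W p h]] .
  then show "X p (\<lambda>q. (f q *\<^sub>R Y q) h) - (f p *\<^sub>R Y p) (\<lambda>q. X q h) = (f p *\<^sub>R lie_bracket \<A> X Y p + X p f *\<^sub>R Y p) h"
    by (simp add: scaleR_fun_apply lie_bracket_act(1)[OF X Y p h] algebra_simps)
qed

end

section \<open>Bundle metrics\<close>

locale metric_bundle = smooth_bundle \<A> E
  for \<A> :: "('m::t2_space, 'e::euclidean_space) chart set" and E :: "('m, 'v::real_vector) vbundle" +
  fixes g :: "'m \<Rightarrow> 'v \<Rightarrow> 'v \<Rightarrow> real"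
  assumes bundle_metric: "bundle_metric \<A> E g"
begin

lemma metric_inner: "inner_product_on (fibre p) (g p)"
  using bundle_metric unfolding bundle_metric_def inner_product_on_def by simp

lemma metric_frame_smooth:
  "(U, e) \<in> vb_frames E \<Longrightarrow> i < r \<Longrightarrow> j < r \<Longrightarrow> smooth_fn \<A> U (\<lambda>p. g p (e i p) (e j p))"
  using bundle_metric unfolding bundle_metric_def by (elim conjE) (drule (1) bspec, simp)

lemmas metric_linear = inner_product_on_linear[OF metric_inner]
  and metric_linear_left = inner_product_on_linear_left[OF metric_inner fibre_subspace]
  and metric_commute = inner_product_on_commute[OF metric_inner]
  and metric_pos = inner_product_on_pos[OF metric_inner]

lemma metric_separates:
  assumes u: "u \<in> fibre p" and u': "u' \<in> fibre p" and eq: "\<And>z. z \<in> fibre p \<Longrightarrow> g p u z = g p u' z"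
  shows "u = u'"
proof (rule ccontr)
  assume "u \<noteq> u'"
  have d: "u - u' \<in> fibre p" using subspace_diff[OF fibre_subspace u u'] .
  have "g p (u - u') (u - u') = 0"
    using linear_map_on_diff[OF metric_linear_left[OF d] fibre_subspace u u'] eq[OF d] by simp
  then show False using metric_pos[OF d] \<open>u \<noteq> u'\<close> by simp
qed

lemma riesz:
  assumes "linear_map_on (fibre p) h"
  obtains u where "u \<in> fibre p" "\<forall>z\<in>fibre p. g p u z = h z"
proof -
  obtain U e where f: "(U, e) \<in> vb_frames E" "p \<in> U" using frame_at .
  have "\<exists>u\<in>fibre p. \<forall>z\<in>fibre p. g p u z = h z"
    using riesz_finite_span[of "(\<lambda>i. e i p) ` {..<r}" "g p" h] metric_inner assms frame_span[OF f] by simp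
  then show thesis using that by blast
qed

lemma metric_expansion:
  assumes f: "(U, e) \<in> vb_frames E" and q: "q \<in> U"
  shows "g q (\<Sum>i<r. c i *\<^sub>R e i q) (\<Sum>j<r. d j *\<^sub>R e j q) = (\<Sum>i<r. c i * (\<Sum>j<r. d j * g q (e i q) (e j q)))"
proof -
  let ?z = "\<Sum>j<r. d j *\<^sub>R e j q"
  have e: "e i q \<in> fibre q" if "i \<in> {..<r}" for i using frame_in_fibre[OF f q] that by simp
  have "g q (\<Sum>i<r. c i *\<^sub>R e i q) ?z = (\<Sum>i<r. c i * g q (e i q) ?z)"
    using linear_map_on_sum[OF metric_linear_left[OF frame_combination_in_fibre[OF f q]] fibre_subspace,
      of "{..<r}" "\<lambda>i. e i q" c d] e by simp
  also have "\<dots> = (\<Sum>i<r. c i * (\<Sum>j<r. d j * g q (e i q) (e j q)))"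
    using linear_map_on_sum[OF metric_linear fibre_subspace, of _ q "{..<r}" "\<lambda>j. e j q" d] e
    by (intro sum.cong refl) simp
  finally show ?thesis .
qed

lemma metric_smooth:
  assumes s: "s \<in> sections" and t: "t \<in> sections"
  shows "smooth_fn \<A> UNIV (\<lambda>p. g p (s p) (t p))"
proof (rule smooth_fn_local)
  fix p
  obtain U e where f: "(U, e) \<in> vb_frames E" "p \<in> U" using frame_at .
  obtain c where c: "\<forall>i<r. smooth_fn \<A> U (c i)" "\<forall>q\<in>U. s q = (\<Sum>i<r. c i q *\<^sub>R e i q)"
    using section_coefficients[OF s f(1)] .
  obtain d where d: "\<forall>i<r. smooth_fn \<A> U (d i)" "\<forall>q\<in>U. t q = (\<Sum>i<r. d i q *\<^sub>R e i q)"
    using section_coefficients[OF t f(1)] .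
  have "smooth_fn \<A> U (\<lambda>q. \<Sum>i<r. c i q * (\<Sum>j<r. d j q * g q (e i q) (e j q)))"
    using c(1) d(1) by (intro smooth_fn_sum smooth_fn_mult metric_frame_smooth[OF f(1)]) auto
  then have "smooth_fn \<A> U (\<lambda>q. g q (s q) (t q))"
  proof (rule smooth_fn_cong)
    fix q assume q: "q \<in> U"
    show "(\<Sum>i<r. c i q * (\<Sum>j<r. d j q * g q (e i q) (e j q))) = g q (s q) (t q)"
      using metric_expansion[OF f(1) q, of "\<lambda>i. c i q" "\<lambda>j. d j q"] c(2) d(2) q by simp
  qed
  then show "\<exists>V. open V \<and> p \<in> V \<and> smooth_fn \<A> (V \<inter> UNIV) (\<lambda>p. g p (s p) (t p))"
    using f frame_open by auto
qed

text \<open>Elimination applied to the Gram matrix. A relation \<open>d\<close> between its rows at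
  \<open>p\<close> gives a vector \<open>a\<close> orthogonal to the whole frame, hence to itself,
  and positive definiteness makes it zero.\<close>

lemma gram_coefficients_smooth:
  assumes f: "(U, e) \<in> vb_frames E" "p \<in> U"
    and s: "\<And>j. j < r \<Longrightarrow> smooth_near \<A> p (\<lambda>q. s q j)"
    and eq: "\<And>j. j < r \<Longrightarrow> eventually (\<lambda>q. s q j = (\<Sum>i<r. c i q * g q (e i q) (e j q))) (nhds p)"
    and i: "i < r"
  shows "smooth_near \<A> p (c i)"
proof -
  have "\<forall>i<r. smooth_near \<A> p (c i)"
  proof (rule coefficients_smooth_near[where K = "{..<r}" and v = "\<lambda>i q j. g q (e i q) (e j q)" and s = s])
    show "smooth_near \<A> p (\<lambda>q. g q (e i q) (e j q))" if "i < r" "j \<in> {..<r}" for i j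
      using that metric_frame_smooth[OF f(1)] by (intro smooth_nearI[OF _ frame_open[OF f(1)] f(2)]) auto
    show "smooth_near \<A> p (\<lambda>q. s q j)" if "j \<in> {..<r}" for j using s that by simp
    show "eventually (\<lambda>q. s q j = (\<Sum>i<r. c i q * g q (e i q) (e j q))) (nhds p)" if "j \<in> {..<r}" for j
      using eq that by simp
    fix d assume d: "\<And>j. j \<in> {..<r} \<Longrightarrow> (\<Sum>i<r. d i * g p (e i p) (e j p)) = 0"
    define a where "a = (\<Sum>i<r. d i *\<^sub>R e i p)"
    have a: "a \<in> fibre p" unfolding a_def by (rule frame_combination_in_fibre[OF f])
    have ej: "e j p \<in> fibre p" if "j < r" for j using frame_in_fibre[OF f that] .
    have aj: "g p a (e j p) = 0" if "j < r" for j
      using linear_map_on_sum[OF metric_linear_left[OF ej[OF that]] fibre_subspace, of "{..<r}" "\<lambda>i. e i p" d]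
        ej d[of j] that by (simp add: a_def)
    have "g p a a = (\<Sum>j<r. d j *\<^sub>R g p a (e j p))"
      using linear_map_on_sum[OF metric_linear[OF a] fibre_subspace, of "{..<r}" "\<lambda>i. e i p" d] ej
      by (simp add: a_def[symmetric])
    then have "g p a a = 0" using aj by simp
    then have "a = 0" using metric_pos[OF a] by fastforce
    then show "\<forall>i<r. d i = 0" using frame_coefficients_zero[OF f] unfolding a_def by blast
  qed
  then show ?thesis using i by blast
qed

text \<open>This upgrades a vector found separately in each fibre, such as a Riesz representative,
  to a smooth section. Testing against the cut-off frame gives smooth pairings with the frame near
  \<open>p\<close>, from which the coefficients are recovered.\<close>

lemma section_by_metric:
  assumes u: "\<And>p. u p \<in> fibre p" and sm: "\<And>z. z \<in> sections \<Longrightarrow> smooth_fn \<A> UNIV (\<lambda>p. g p (u p) (z p))"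
  shows "u \<in> sections"
proof (rule smooth_sectionI[OF u])
  fix p
  obtain U e where f: "(U, e) \<in> vb_frames E" "p \<in> U" using frame_at .
  obtain \<eta> K t where \<eta>: "smooth_fn \<A> UNIV \<eta>" "eventually (\<lambda>q. \<eta> q = 1) (nhds p)"
    "closed K" "K \<subseteq> U \<inter> UNIV" "\<forall>q. q \<notin> K \<longrightarrow> \<eta> q = 0"
    and t: "\<forall>i<r. t i \<in> sections" "\<forall>i. \<forall>q\<in>U. t i q = \<eta> q *\<^sub>R e i q" "\<forall>i q. q \<notin> U \<longrightarrow> t i q = 0"
    using cutoff_frame[OF f open_UNIV UNIV_I] .
  have "\<exists>d. u q = (\<Sum>i<r. d i *\<^sub>R e i q)" if "q \<in> U" for q
    using frame_expansion[OF f(1) that u] by metis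
  then obtain d where d: "\<And>q. q \<in> U \<Longrightarrow> u q = (\<Sum>i<r. d q i *\<^sub>R e i q)" by metis
  define c where "c i q = d q i" for i q
  have evU: "eventually (\<lambda>q. q \<in> U) (nhds p)" using frame_open[OF f(1)] f(2) eventually_nhds by blast
  have "smooth_near \<A> p (c i)" if "i < r" for i
  proof (rule gram_coefficients_smooth[OF f _ _ that, where s = "\<lambda>q j. g q (u q) (e j q)"])
    fix j assume j: "j < r"
    have "smooth_near \<A> p (\<lambda>q. g q (u q) (t j q))" using sm[of "t j"] t(1) j smooth_nearI by blast
    moreover have "eventually (\<lambda>q. g q (u q) (t j q) = g q (u q) (e j q)) (nhds p)"
      using evU \<eta>(2) by eventually_elim (use t(2) in simp)
    ultimately show "smooth_near \<A> p (\<lambda>q. g q (u q) (e j q))" by (rule smooth_near_cong)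
    show "eventually (\<lambda>q. g q (u q) (e j q) = (\<Sum>i<r. c i q * g q (e i q) (e j q))) (nhds p)"
      using evU
    proof eventually_elim
      case (elim q)
      then show ?case
        using linear_map_on_sum[OF metric_linear_left[OF frame_in_fibre[OF f(1) elim j]] fibre_subspace,
            of "{..<r}" "\<lambda>i. e i q" "d q"] frame_in_fibre[OF f(1) elim] d[OF elim]
        by (simp add: c_def)
    qed
  qed
  moreover have "eventually (\<lambda>q. u q = (\<Sum>i<r. c i q *\<^sub>R e i q)) (nhds p)"
    using evU by eventually_elim (simp add: d c_def)
  ultimately show "\<exists>U e c. (U, e) \<in> vb_frames E \<and> p \<in> U \<and> (\<forall>i<r. smooth_near \<A> p (c i)) \<and>
      eventually (\<lambda>q. u q = (\<Sum>i<r. c i q *\<^sub>R e i q)) (nhds p)"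
    using f by blast
qed

end

section \<open>The Levi-Civita connection on a Lie algebroid\<close>

locale metric_algebroid = metric_bundle \<A> A g
  for \<A> :: "('m::t2_space, 'e::euclidean_space) chart set" and A :: "('m, 'v::real_vector) vbundle" and g +
  fixes \<V> :: "'m vfield set" and \<rho> :: "'m \<Rightarrow> 'v \<Rightarrow> 'm tvec"
  assumes structural: "structural_lie_algebra \<A> \<V>"
    and algebroid: "is_lie_algebroid_of \<A> \<V> A \<rho>"
begin

definition anchor :: "('m \<Rightarrow> 'v) \<Rightarrow> 'm vfield" where
  "anchor s = (\<lambda>p. \<rho> p (s p))"

definition act :: "('m \<Rightarrow> 'v) \<Rightarrow> ('m \<Rightarrow> real) \<Rightarrow> 'm \<Rightarrow> real" where
  "act X f p = \<rho> p (X p) f"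

text \<open>Over the boundary \<open>\<rho> p\<close> may have a kernel, so the bracket cannot be
  transported fibre by fibre. It is transported through the bijection between global sections and
  \<open>\<V>\<close>, and identities for it are checked after applying
  \<open>anchor\<close>.\<close>

definition bracket :: "('m \<Rightarrow> 'v) \<Rightarrow> ('m \<Rightarrow> 'v) \<Rightarrow> ('m \<Rightarrow> 'v)" where
  "bracket X Y = the_inv_into sections anchor (lie_bracket \<A> (anchor X) (anchor Y))"

lemma
  shows anchor_linear: "linear_map_on (fibre p) (\<rho> p)"
    and anchor_tangent: "a \<in> fibre p \<Longrightarrow> \<rho> p a \<in> tangent_space \<A> p"
    and anchor_bij: "bij_betw anchor sections \<V>"
  using algebroid unfolding is_lie_algebroid_of_def anchor_def[abs_def] by blast+

lemma anchor_in_lie_algebra: "s \<in> sections \<Longrightarrow> anchor s \<in> \<V>"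
  using anchor_bij bij_betwE by blast

lemma anchor_vector_field: "s \<in> sections \<Longrightarrow> anchor s \<in> vector_fields \<A> UNIV"
  using anchor_in_lie_algebra structural unfolding structural_lie_algebra_def by blast

lemma anchor_eqD: "s \<in> sections \<Longrightarrow> t \<in> sections \<Longrightarrow> anchor s = anchor t \<Longrightarrow> s = t"
  using anchor_bij unfolding bij_betw_def inj_on_def by blast

lemma
  assumes "X \<in> sections" "Y \<in> sections"
  shows bracket_closed: "bracket X Y \<in> sections"
    and anchor_bracket: "anchor (bracket X Y) = lie_bracket \<A> (anchor X) (anchor Y)"
proof -
  have "lie_bracket \<A> (anchor X) (anchor Y) \<in> \<V>"
    using anchor_in_lie_algebra assms structural unfolding structural_lie_algebra_def by blast
  then have *: "lie_bracket \<A> (anchor X) (anchor Y) \<in> anchor ` sections"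
    using anchor_bij by (simp add: bij_betw_def)
  have inj: "inj_on anchor sections" using anchor_bij by (simp add: bij_betw_def)
  show "bracket X Y \<in> sections" unfolding bracket_def using the_inv_into_into[OF inj * subset_refl] .
  show "anchor (bracket X Y) = lie_bracket \<A> (anchor X) (anchor Y)"
    unfolding bracket_def using f_the_inv_into_f[OF inj *] .
qed

lemma anchor_add: "X \<in> sections \<Longrightarrow> Y \<in> sections \<Longrightarrow> anchor (X + Y) = anchor X + anchor Y"
  using linear_map_on_add[OF anchor_linear section_in_fibre section_in_fibre] by (simp add: anchor_def fun_eq_iff)

lemma anchor_scale: "X \<in> sections \<Longrightarrow> anchor (\<lambda>p. f p *\<^sub>R X p) = (\<lambda>p. f p *\<^sub>R anchor X p)"
  using linear_map_on_scale[OF anchor_linear section_in_fibre] by (simp add: anchor_def fun_eq_iff)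

lemma anchor_minus: "X \<in> sections \<Longrightarrow> anchor (- X) = - anchor X"
  using anchor_scale[of X "\<lambda>_. - 1"] by (simp add: fun_Compl_def fun_eq_iff scaleR_fun_apply)

lemma lie_bracket_anchor_tangent:
  "X \<in> sections \<Longrightarrow> Y \<in> sections \<Longrightarrow> lie_bracket \<A> (anchor X) (anchor Y) p \<in> tangent_space \<A> p"
  using vector_field_tangent'[OF anchor_vector_field[OF bracket_closed]] anchor_bracket by metis

lemma bracket_anti: "X \<in> sections \<Longrightarrow> Y \<in> sections \<Longrightarrow> bracket Y X = - bracket X Y"
  by (intro anchor_eqD bracket_closed section_minus)
    (simp_all add: anchor_minus anchor_bracket bracket_closed lie_bracket_anti[of "anchor Y"])

lemma bracket_add:
  "X \<in> sections \<Longrightarrow> Y \<in> sections \<Longrightarrow> Z \<in> sections \<Longrightarrow> bracket X (Y + Z) = bracket X Y + bracket X Z"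
  by (intro anchor_eqD bracket_closed section_add)
    (simp_all add: anchor_add anchor_bracket bracket_closed section_add
      lie_bracket_add[OF open_UNIV anchor_vector_field anchor_vector_field anchor_vector_field]
      lie_bracket_anchor_tangent)

lemma bracket_scale:
  assumes X: "X \<in> sections" and Y: "Y \<in> sections" and f: "smooth_fn \<A> UNIV f"
  shows "bracket X (\<lambda>p. f p *\<^sub>R Y p) = (\<lambda>p. f p *\<^sub>R bracket X Y p + act X f p *\<^sub>R Y p)"
proof -
  have a: "smooth_fn \<A> UNIV (act X f)"
    using vector_field_smooth[OF anchor_vector_field[OF X] open_UNIV subset_UNIV f]
    by (simp add: act_def[abs_def] anchor_def)
  have fXY: "(\<lambda>p. f p *\<^sub>R bracket X Y p) \<in> sections" "(\<lambda>p. act X f p *\<^sub>R Y p) \<in> sections"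
    using section_scale f a bracket_closed X Y by blast+
  have "bracket X (\<lambda>p. f p *\<^sub>R Y p) = (\<lambda>p. f p *\<^sub>R bracket X Y p) + (\<lambda>p. act X f p *\<^sub>R Y p)"
  proof (rule anchor_eqD)
    show "bracket X (\<lambda>p. f p *\<^sub>R Y p) \<in> sections" using bracket_closed X section_scale[OF f Y] .
    show "(\<lambda>p. f p *\<^sub>R bracket X Y p) + (\<lambda>p. act X f p *\<^sub>R Y p) \<in> sections" using section_add[OF fXY] .
    show "anchor (bracket X (\<lambda>p. f p *\<^sub>R Y p)) = anchor ((\<lambda>p. f p *\<^sub>R bracket X Y p) + (\<lambda>p. act X f p *\<^sub>R Y p))"
      unfolding anchor_add[OF fXY] anchor_scale[OF bracket_closed[OF X Y]] anchor_scale[OF Y]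
        anchor_bracket[OF X section_scale[OF f Y]] anchor_bracket[OF X Y]
        lie_bracket_scale[OF open_UNIV anchor_vector_field[OF X] anchor_vector_field[OF Y] f lie_bracket_anchor_tangent[OF X Y]]
      by (simp add: fun_eq_iff act_def anchor_def)
  qed
  then show ?thesis by (simp add: plus_fun_def)
qed

lemma act_smooth_fn: "X \<in> sections \<Longrightarrow> smooth_fn \<A> UNIV f \<Longrightarrow> smooth_fn \<A> UNIV (act X f)"
  using vector_field_smooth[OF anchor_vector_field open_UNIV subset_UNIV] by (simp add: act_def[abs_def] anchor_def)

lemma act_bracket:
  assumes "X \<in> sections" "Y \<in> sections" "smooth_fn \<A> UNIV f"
  shows "act (bracket X Y) f p = act X (act Y f) p - act Y (act X f) p"
proof -
  have "act (bracket X Y) f p = anchor (bracket X Y) p f" by (simp add: act_def anchor_def)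
  then show ?thesis
    unfolding anchor_bracket[OF assms(1,2)]
    using lie_bracket_act(1)[OF anchor_vector_field[OF assms(1)] anchor_vector_field[OF assms(2)] UNIV_I smooth_nearI[OF assms(3) open_UNIV UNIV_I], of p]
    by (simp add: act_def[abs_def] anchor_def)
qed

lemma
  assumes X: "X \<in> sections" and u: "smooth_fn \<A> UNIV u" and w: "smooth_fn \<A> UNIV w"
  shows act_add_fn: "act X (\<lambda>q. u q + w q) p = act X u p + act X w p"
    and act_mult_fn: "act X (\<lambda>q. u q * w q) p = u p * act X w p + act X u p * w p"
  using tangent_add[OF anchor_tangent[OF section_in_fibre[OF X]] smooth_nearI[OF u open_UNIV UNIV_I] smooth_nearI[OF w open_UNIV UNIV_I]]
    tangent_mult[OF anchor_tangent[OF section_in_fibre[OF X]] smooth_nearI[OF u open_UNIV UNIV_I] smooth_nearI[OF w open_UNIV UNIV_I]]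
  by (simp_all add: act_def)

lemma act_add_section: "X \<in> sections \<Longrightarrow> Y \<in> sections \<Longrightarrow> act (X + Y) u p = act X u p + act Y u p"
  using linear_map_on_add[OF anchor_linear section_in_fibre section_in_fibre] by (simp add: act_def)

lemma act_scale_section: "X \<in> sections \<Longrightarrow> act (\<lambda>p. f p *\<^sub>R X p) u p = f p * act X u p"
  using linear_map_on_scale[OF anchor_linear section_in_fibre] by (simp add: act_def scaleR_fun_apply)

section \<open>The Koszul formula on sections of A and the connection it defines\<close>

definition koszul :: "('m \<Rightarrow> 'v) \<Rightarrow> ('m \<Rightarrow> 'v) \<Rightarrow> ('m \<Rightarrow> 'v) \<Rightarrow> 'm \<Rightarrow> real" where
  "koszul X Y Z p = act X (\<lambda>q. g q (Y q) (Z q)) p + act Y (\<lambda>q. g q (X q) (Z q)) p - act Z (\<lambda>q. g q (X q) (Y q)) p +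
     g p (bracket X Y p) (Z p) - g p (bracket X Z p) (Y p) - g p (bracket Y Z p) (X p)"

lemma
  assumes Z: "Z \<in> sections"
  shows metric_add_left: "X \<in> sections \<Longrightarrow> Y \<in> sections \<Longrightarrow> g p (X p + Y p) (Z p) = g p (X p) (Z p) + g p (Y p) (Z p)"
    and metric_add_right: "X \<in> sections \<Longrightarrow> Y \<in> sections \<Longrightarrow> g p (Z p) (X p + Y p) = g p (Z p) (X p) + g p (Z p) (Y p)"
    and metric_scale_left: "X \<in> sections \<Longrightarrow> g p (c *\<^sub>R X p) (Z p) = c * g p (X p) (Z p)"
    and metric_scale_right: "X \<in> sections \<Longrightarrow> g p (Z p) (c *\<^sub>R X p) = c * g p (Z p) (X p)"
  using linear_map_on_add[OF metric_linear_left] linear_map_on_scale[OF metric_linear_left]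
    linear_map_on_add[OF metric_linear] linear_map_on_scale[OF metric_linear] section_in_fibre Z
  by simp_all

lemmas metric_section_simps = metric_add_left metric_add_right metric_scale_left metric_scale_right

lemma metric_combination_left:
  assumes "X \<in> sections" "Y \<in> sections" "Z \<in> sections"
  shows "g p (a *\<^sub>R X p + b *\<^sub>R Y p) (Z p) = a * g p (X p) (Z p) + b * g p (Y p) (Z p)"
    and "g p (a *\<^sub>R X p - b *\<^sub>R Y p) (Z p) = a * g p (X p) (Z p) - b * g p (Y p) (Z p)"
proof -
  have *: "g p (a *\<^sub>R X p + b *\<^sub>R Y p) (Z p) = a * g p (X p) (Z p) + b * g p (Y p) (Z p)" for a b
    using metric_add_left[OF assms(3) section_scale[OF smooth_fn_const assms(1)] section_scale[OF smooth_fn_const assms(2)], of p a b]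
      metric_scale_left[OF assms(3,1)] metric_scale_left[OF assms(3,2)] by simp
  show "g p (a *\<^sub>R X p + b *\<^sub>R Y p) (Z p) = a * g p (X p) (Z p) + b * g p (Y p) (Z p)" by (rule *)
  show "g p (a *\<^sub>R X p - b *\<^sub>R Y p) (Z p) = a * g p (X p) (Z p) - b * g p (Y p) (Z p)"
    using *[of a "- b"] by simp
qed

lemma koszul_smooth: "X \<in> sections \<Longrightarrow> Y \<in> sections \<Longrightarrow> Z \<in> sections \<Longrightarrow> smooth_fn \<A> UNIV (koszul X Y Z)"
  unfolding koszul_def[abs_def]
  by (intro smooth_fn_diff smooth_fn_add metric_smooth act_smooth_fn bracket_closed) assumption+

lemma bracket_add_left:
  assumes "X \<in> sections" "Y \<in> sections" "Z \<in> sections"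
  shows "bracket (X + Y) Z = bracket X Z + bracket Y Z"
  using assms bracket_anti[of Z "X + Y"] bracket_anti[of Z X] bracket_anti[of Z Y] bracket_add[of Z X Y]
  by (simp add: section_add)

lemma bracket_scale_left:
  assumes "X \<in> sections" "Y \<in> sections" "smooth_fn \<A> UNIV f"
  shows "bracket (\<lambda>p. f p *\<^sub>R X p) Y = (\<lambda>p. f p *\<^sub>R bracket X Y p + (- act Y f p) *\<^sub>R X p)"
  using assms bracket_anti[of Y "\<lambda>p. f p *\<^sub>R X p"] bracket_anti[of Y X] bracket_scale[of Y X f]
  by (simp add: section_scale fun_eq_iff)

lemma
  assumes X: "X \<in> sections" and Y: "Y \<in> sections" and Z: "Z \<in> sections" and W: "W \<in> sections"
  shows koszul_add_1: "koszul (X + W) Y Z p = koszul X Y Z p + koszul W Y Z p"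
    and koszul_add_2: "koszul X (Y + W) Z p = koszul X Y Z p + koszul X W Z p"
    and koszul_add_3: "koszul X Y (Z + W) p = koszul X Y Z p + koszul X Y W p"
  unfolding koszul_def using assms
  by (simp_all add: metric_section_simps metric_smooth act_add_fn act_add_section bracket_add bracket_add_left bracket_closed)

text \<open>In the first and third arguments the derivatives of \<open>f\<close> coming from the
  metric terms cancel those coming from the brackets. In the second argument \<open>act X f\<close>
  survives twice, once from each source; after halving, this is the Leibniz term of the
  connection.\<close>

lemma
  assumes X: "X \<in> sections" and Y: "Y \<in> sections" and Z: "Z \<in> sections" and f: "smooth_fn \<A> UNIV f"
  shows koszul_scale_1: "koszul (\<lambda>p. f p *\<^sub>R X p) Y Z p = f p * koszul X Y Z p"
    and koszul_scale_2: "koszul X (\<lambda>p. f p *\<^sub>R Y p) Z p = f p * koszul X Y Z p + 2 * act X f p * g p (Y p) (Z p)"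
    and koszul_scale_3: "koszul X Y (\<lambda>p. f p *\<^sub>R Z p) p = f p * koszul X Y Z p"
proof -
  note simps = metric_scale_left metric_scale_right metric_combination_left metric_smooth act_mult_fn act_scale_section bracket_scale bracket_scale_left
    bracket_closed f X Y Z
  show "koszul (\<lambda>p. f p *\<^sub>R X p) Y Z p = f p * koszul X Y Z p"
    unfolding koszul_def by (simp add: simps algebra_simps)
  show "koszul X (\<lambda>p. f p *\<^sub>R Y p) Z p = f p * koszul X Y Z p + 2 * act X f p * g p (Y p) (Z p)"
    unfolding koszul_def
    using metric_commute[OF section_in_fibre[OF X] section_in_fibre[OF Y], of p] by (simp add: simps algebra_simps)
  show "koszul X Y (\<lambda>p. f p *\<^sub>R Z p) p = f p * koszul X Y Z p"
    unfolding koszul_def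
    using metric_commute[OF section_in_fibre[OF X] section_in_fibre[OF Z], of p]
      metric_commute[OF section_in_fibre[OF Y] section_in_fibre[OF Z], of p] by (simp add: simps algebra_simps)
qed

lemma tensorial_koszul: "X \<in> sections \<Longrightarrow> Y \<in> sections \<Longrightarrow> tensorial (\<lambda>Z p. koszul X Y Z p)"
  unfolding tensorial_def by (simp add: fun_eq_iff koszul_add_3 koszul_scale_3)

definition connection :: "('m \<Rightarrow> 'v) \<Rightarrow> ('m \<Rightarrow> 'v) \<Rightarrow> ('m \<Rightarrow> 'v)" where
  "connection X Y p = (SOME u. u \<in> fibre p \<and> (\<forall>Z\<in>sections. g p u (Z p) = koszul X Y Z p / 2))"

text \<open>Being tensorial in \<open>Z\<close>, half the Koszul expression descends to a linear
  functional on the fibre at \<open>p\<close>, for boundary points as well. The metric on the fibre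
  represents it by a vector.\<close>

lemma connection_spec:
  assumes X: "X \<in> sections" and Y: "Y \<in> sections"
  shows "connection X Y p \<in> fibre p \<and> (\<forall>Z\<in>sections. g p (connection X Y p) (Z p) = koszul X Y Z p / 2)"
proof -
  have wd: "koszul X Y Z p = koszul X Y Z' p" if "Z \<in> sections" "Z' \<in> sections" "Z p = Z' p" for Z Z'
    using tensorial_pointwise[OF tensorial_koszul[OF X Y] that(1,2) UNIV_I that(3)] .
  \<comment> \<open>Some section through each vector; \<open>wd\<close> shows that the value of the
    Koszul expression does not depend on which.\<close>
  define lift where "lift a = (SOME Z. Z \<in> sections \<and> Z p = a)" for a
  define h where "h a = koszul X Y (lift a) p / 2" for a
  have h: "h (Z p) = koszul X Y Z p / 2" if Z: "Z \<in> sections" for Z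
  proof -
    have "lift (Z p) \<in> sections \<and> lift (Z p) p = Z p"
      unfolding lift_def by (rule someI[where P = "\<lambda>Z'. Z' \<in> sections \<and> Z' p = Z p"]) (use Z in simp)
    then show ?thesis unfolding h_def using wd[of "lift (Z p)" Z] Z by simp
  qed
  have "linear_map_on (fibre p) h"
    unfolding linear_map_on_def
  proof (intro conjI ballI allI)
    fix a b assume "a \<in> fibre p" "b \<in> fibre p"
    then obtain s t where st: "s \<in> sections" "s p = a" "t \<in> sections" "t p = b"
      using section_through by metis
    then show "h (a + b) = h a + h b"
      using h[OF section_add[OF st(1,3)]] h[OF st(1)] h[OF st(3)] koszul_add_3[OF X Y st(1,3), of p]
      by (simp add: add_divide_distrib)
  next
    fix c a assume "a \<in> fibre p"
    then obtain s where s: "s \<in> sections" "s p = a" using section_through by metis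
    have "h (c *\<^sub>R s p) = c * koszul X Y s p / 2"
      using h[OF section_scale[OF smooth_fn_const s(1), of c]] koszul_scale_3[OF X Y s(1) smooth_fn_const, of c p]
      by simp
    then show "h (c *\<^sub>R a) = c *\<^sub>R h a"
      unfolding s(2)[symmetric] h[OF s(1)] real_scaleR_def by (simp only: times_divide_eq_right)
  qed
  then obtain u where u: "u \<in> fibre p" "\<forall>z\<in>fibre p. g p u z = h z" using riesz by blast
  then have "u \<in> fibre p \<and> (\<forall>Z\<in>sections. g p u (Z p) = koszul X Y Z p / 2)"
    using h section_in_fibre by simp
  then show ?thesis
    unfolding connection_def
    by (rule someI[where P = "\<lambda>u. u \<in> fibre p \<and> (\<forall>Z\<in>sections. g p u (Z p) = koszul X Y Z p / 2)"])
qed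

lemma metric_connection:
  "X \<in> sections \<Longrightarrow> Y \<in> sections \<Longrightarrow> Z \<in> sections \<Longrightarrow> g p (connection X Y p) (Z p) = koszul X Y Z p / 2"
  using connection_spec by blast

lemma connection_closed: "X \<in> sections \<Longrightarrow> Y \<in> sections \<Longrightarrow> connection X Y \<in> sections"
proof (rule section_by_metric)
  assume X: "X \<in> sections" and Y: "Y \<in> sections"
  show "connection X Y p \<in> fibre p" for p using connection_spec[OF X Y] by blast
  show "smooth_fn \<A> UNIV (\<lambda>p. g p (connection X Y p) (Z p))" if "Z \<in> sections" for Z
    unfolding metric_connection[OF X Y that]
    using smooth_fn_cmult[OF koszul_smooth[OF X Y that], of "1 / 2"] by simp
qed

lemma connection_eqI:
  assumes "X \<in> sections" "Y \<in> sections" "u \<in> fibre p" "\<And>Z. Z \<in> sections \<Longrightarrow> g p u (Z p) = koszul X Y Z p / 2"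
  shows "connection X Y p = u"
proof (rule metric_separates)
  show "connection X Y p \<in> fibre p" using connection_spec[OF assms(1,2)] by blast
  show "u \<in> fibre p" by fact
  show "g p (connection X Y p) z = g p u z" if z: "z \<in> fibre p" for z
  proof -
    obtain Z where "Z \<in> sections" "Z p = z" using section_through[OF z] .
    then show ?thesis using metric_connection[OF assms(1,2)] assms(4) by metis
  qed
qed

lemma connection_on_connection: "connection_on \<A> UNIV sections act sections connection"
  unfolding connection_on_def
proof (intro conjI ballI allI impI)
  fix X Y assume X: "X \<in> sections" and Y: "Y \<in> sections"
  note c = connection_closed[OF X Y]
  show "connection X Y \<in> sections" by (rule c)
  fix Z assume Z: "Z \<in> sections"
  note XZ = connection_closed[OF X Z] and YZ = connection_closed[OF Y Z]
  show "connection (X + Y) Z = connection X Z + connection Y Z"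
  proof (intro ext connection_eqI section_add X Y Z)
    show "(connection X Z + connection Y Z) p \<in> fibre p" for p
      by (rule section_in_fibre[OF section_add[OF XZ YZ]])
    show "g p ((connection X Z + connection Y Z) p) (V p) = koszul (X + Y) Z V p / 2" if V: "V \<in> sections" for p V
      using metric_add_left[OF V XZ YZ, of p]
      by (simp add: metric_connection[OF X Z V] metric_connection[OF Y Z V] koszul_add_1[OF X Z V Y] add_divide_distrib)
  qed
  show "connection X (Y + Z) = connection X Y + connection X Z"
  proof (intro ext connection_eqI section_add X Y Z)
    show "(connection X Y + connection X Z) p \<in> fibre p" for p
      by (rule section_in_fibre[OF section_add[OF c XZ]])
    show "g p ((connection X Y + connection X Z) p) (V p) = koszul X (Y + Z) V p / 2" if V: "V \<in> sections" for p V
      using metric_add_left[OF V c XZ, of p]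
      by (simp add: metric_connection[OF X Y V] metric_connection[OF X Z V] koszul_add_2[OF X Y V Z] add_divide_distrib)
  qed
next
  fix f X Y assume X: "X \<in> sections" and Y: "Y \<in> sections" and f: "smooth_fn \<A> UNIV f"
  note c = connection_closed[OF X Y]
  show "connection (\<lambda>p. f p *\<^sub>R X p) Y = (\<lambda>p. f p *\<^sub>R connection X Y p)"
  proof (intro ext connection_eqI section_scale X Y f)
    show "f p *\<^sub>R connection X Y p \<in> fibre p" for p
      by (rule section_in_fibre[OF section_scale[OF f c]])
    show "g p (f p *\<^sub>R connection X Y p) (V p) = koszul (\<lambda>p. f p *\<^sub>R X p) Y V p / 2" if V: "V \<in> sections" for p V
      by (simp add: metric_scale_left[OF V c] metric_connection[OF X Y V] koszul_scale_1[OF X Y V f])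
  qed
  show "connection X (\<lambda>p. f p *\<^sub>R Y p) = (\<lambda>p. f p *\<^sub>R connection X Y p + act X f p *\<^sub>R Y p)"
  proof (intro ext connection_eqI section_scale X Y f)
    fix p
    have fib: "f p *\<^sub>R connection X Y p \<in> fibre p" "act X f p *\<^sub>R Y p \<in> fibre p"
      using section_in_fibre[OF c] section_in_fibre[OF Y] subspace_scale[OF fibre_subspace] by blast+
    show "f p *\<^sub>R connection X Y p + act X f p *\<^sub>R Y p \<in> fibre p" using subspace_add[OF fibre_subspace fib] .
    fix Z assume Z: "Z \<in> sections"
    show "g p (f p *\<^sub>R connection X Y p + act X f p *\<^sub>R Y p) (Z p) = koszul X (\<lambda>p. f p *\<^sub>R Y p) Z p / 2"
      unfolding linear_map_on_add[OF metric_linear_left[OF section_in_fibre[OF Z]] fib]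
        metric_scale_left[OF Z c] metric_scale_left[OF Z Y] metric_connection[OF X Y Z] koszul_scale_2[OF X Y Z f]
      by (simp add: add_divide_distrib)
  qed
qed

sublocale connection_module \<A> UNIV sections act connection bracket
  by unfold_locales
    ((rule connection_on_connection act_smooth_fn bracket_closed bracket_anti bracket_add bracket_scale act_bracket; assumption)+)

end

section \<open>Boundedness of tensors on compact manifolds\<close>

context metric_bundle
begin

definition fibre_norm :: "'m \<Rightarrow> 'v \<Rightarrow> real" where
  "fibre_norm p a = sqrt (g p a a)"

lemma metric_nonneg: "a \<in> fibre p \<Longrightarrow> 0 \<le> g p a a"
  using metric_pos[of a p] linear_map_on_zero[OF metric_linear[of a p] fibre_subspace]
  by (cases "a = 0") (auto simp: less_imp_le)

lemma fibre_norm_nonneg: "a \<in> fibre p \<Longrightarrow> 0 \<le> fibre_norm p a"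
  by (simp add: fibre_norm_def metric_nonneg)

lemma metric_Cauchy_Schwarz:
  assumes a: "a \<in> fibre p" and b: "b \<in> fibre p"
  shows "\<bar>g p a b\<bar> \<le> fibre_norm p a * fibre_norm p b"
proof (cases "b = 0")
  case True
  then show ?thesis
    using linear_map_on_zero[OF metric_linear[OF a] fibre_subspace] linear_map_on_zero[OF metric_linear[OF b] fibre_subspace]
    by (simp add: fibre_norm_def)
next
  case False
  define t where "t = g p a b / g p b b"
  have pos: "g p b b > 0" using metric_pos[OF b False] .
  have tb: "t *\<^sub>R b \<in> fibre p" using subspace_scale[OF fibre_subspace b] .
  have d: "a - t *\<^sub>R b \<in> fibre p" using subspace_diff[OF fibre_subspace a tb] .
  have exp: "g p (a - t *\<^sub>R b) z = g p a z - t * g p b z" if "z \<in> fibre p" for z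
    using linear_map_on_diff[OF metric_linear_left[OF that] fibre_subspace a tb]
      linear_map_on_scale[OF metric_linear_left[OF that] b] by simp
  have exp2: "g p z (a - t *\<^sub>R b) = g p z a - t * g p z b" if "z \<in> fibre p" for z
    using linear_map_on_diff[OF metric_linear[OF that] fibre_subspace a tb]
      linear_map_on_scale[OF metric_linear[OF that] b] by simp
  have "0 \<le> g p (a - t *\<^sub>R b) (a - t *\<^sub>R b)" using metric_nonneg[OF d] .
  also have "\<dots> = g p a a - t * g p a b - t * (g p b a - t * g p b b)"
    by (simp only: exp[OF d] exp2[OF a] exp2[OF b])
  also have "t * g p b b = g p b a" using pos metric_commute[OF a b] by (simp add: t_def)
  finally have "t * g p a b \<le> g p a a" by simp
  then have "g p a b * g p a b \<le> g p a a * g p b b"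
    using pos by (simp add: t_def field_simps)
  then have "sqrt (g p a b * g p a b) \<le> sqrt (g p a a * g p b b)" by (rule real_sqrt_le_mono)
  then show ?thesis by (simp add: fibre_norm_def real_sqrt_mult)
qed

lemma fibre_norm_scale: "a \<in> fibre p \<Longrightarrow> fibre_norm p (c *\<^sub>R a) = \<bar>c\<bar> * fibre_norm p a"
  using linear_map_on_scale[OF metric_linear, of a p a c] linear_map_on_scale[OF metric_linear_left, of "c *\<^sub>R a" p a c]
    subspace_scale[OF fibre_subspace]
  by (simp add: fibre_norm_def real_sqrt_mult mult.assoc[symmetric])

lemma fibre_norm_triangle:
  assumes a: "a \<in> fibre p" and b: "b \<in> fibre p"
  shows "fibre_norm p (a + b) \<le> fibre_norm p a + fibre_norm p b"
proof -
  have ab: "a + b \<in> fibre p" using subspace_add[OF fibre_subspace a b] .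
  have sq: "fibre_norm p z * fibre_norm p z = g p z z" if "z \<in> fibre p" for z
    using metric_nonneg[OF that] by (simp add: fibre_norm_def)
  have "g p (a + b) (a + b) = g p a a + 2 * g p a b + g p b b"
    using linear_map_on_add[OF metric_linear_left[OF ab] a b] linear_map_on_add[OF metric_linear[OF a] a b]
      linear_map_on_add[OF metric_linear[OF b] a b] metric_commute[OF a b] by simp
  also have "\<dots> \<le> (fibre_norm p a + fibre_norm p b)\<^sup>2"
    using metric_Cauchy_Schwarz[OF a b] sq[OF a] sq[OF b] by (simp add: power2_eq_square algebra_simps)
  finally have "sqrt (g p (a + b) (a + b)) \<le> sqrt ((fibre_norm p a + fibre_norm p b)\<^sup>2)" by (rule real_sqrt_le_mono)
  then show ?thesis using fibre_norm_nonneg[OF a] fibre_norm_nonneg[OF b] by (simp add: fibre_norm_def)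
qed

lemma fibre_norm_sum:
  assumes "\<And>i. i \<in> I \<Longrightarrow> x i \<in> fibre p"
  shows "fibre_norm p (\<Sum>i\<in>I. d i *\<^sub>R x i) \<le> (\<Sum>i\<in>I. \<bar>d i\<bar> * fibre_norm p (x i))"
  using assms
proof (induction I rule: infinite_finite_induct)
  case (insert k F)
  have "(\<Sum>i\<in>F. d i *\<^sub>R x i) \<in> fibre p" "d k *\<^sub>R x k \<in> fibre p"
    using insert.prems by (intro subspace_sum[OF fibre_subspace] subspace_scale[OF fibre_subspace]; simp)+
  then show ?case
    using insert fibre_norm_triangle[of "d k *\<^sub>R x k" p "\<Sum>i\<in>F. d i *\<^sub>R x i"] fibre_norm_scale[of "x k" p "d k"] by simp
qed (use linear_map_on_zero[OF metric_linear[OF subspace_0[OF fibre_subspace]] fibre_subspace, of p] in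
    \<open>auto simp: fibre_norm_def\<close>)

text \<open>The metric dual of the coordinate functional of index \<open>i\<close>. It expresses a
  coefficient as an inner product, so that Cauchy-Schwarz can bound it.\<close>

lemma ex_dual_frame_vector:
  assumes f: "(U, e) \<in> vb_frames E" and q: "q \<in> U" and i: "i < r"
  shows "\<exists>\<epsilon>. \<epsilon> \<in> fibre q \<and> (\<forall>d. g q \<epsilon> (\<Sum>j<r. d j *\<^sub>R e j q) = d i)"
proof -
  define h where "h z = (SOME d. z = (\<Sum>j<r. d j *\<^sub>R e j q)) i" for z
  have h: "h (\<Sum>j<r. d j *\<^sub>R e j q) = d i" for d
  proof -
    have "(\<Sum>j<r. d j *\<^sub>R e j q) = (\<Sum>j<r. (SOME d'. (\<Sum>j<r. d j *\<^sub>R e j q) = (\<Sum>j<r. d' j *\<^sub>R e j q)) j *\<^sub>R e j q)"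
      by (rule someI[where P = "\<lambda>d'. (\<Sum>j<r. d j *\<^sub>R e j q) = (\<Sum>j<r. d' j *\<^sub>R e j q)"]) (rule refl)
    from frame_coefficients_unique[OF f q this i] show ?thesis by (simp add: h_def)
  qed
  have "linear_map_on (fibre q) h"
    unfolding linear_map_on_def
  proof (intro conjI ballI allI)
    fix a b assume "a \<in> fibre q" "b \<in> fibre q"
    obtain c where c: "a = (\<Sum>j<r. c j *\<^sub>R e j q)" using frame_expansion[OF f q \<open>a \<in> fibre q\<close>] .
    obtain d where d: "b = (\<Sum>j<r. d j *\<^sub>R e j q)" using frame_expansion[OF f q \<open>b \<in> fibre q\<close>] .
    note cd = c d
    have "a + b = (\<Sum>j<r. (c j + d j) *\<^sub>R e j q)" by (simp add: cd scaleR_left_distrib sum.distrib)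
    then show "h (a + b) = h a + h b" using h[of c] h[of d] h[of "\<lambda>j. c j + d j"] cd by simp
  next
    fix k a assume "a \<in> fibre q"
    then obtain c where c: "a = (\<Sum>j<r. c j *\<^sub>R e j q)" by (rule frame_expansion[OF f q])
    have "k *\<^sub>R a = (\<Sum>j<r. (k * c j) *\<^sub>R e j q)" by (simp add: c scaleR_sum_right)
    then show "h (k *\<^sub>R a) = k *\<^sub>R h a" using h[of c] h[of "\<lambda>j. k * c j"] c by simp
  qed
  then obtain \<epsilon> where \<epsilon>: "\<epsilon> \<in> fibre q" "\<forall>z\<in>fibre q. g q \<epsilon> z = h z" by (rule riesz)
  then show ?thesis using h frame_combination_in_fibre[OF f q] by (intro exI[of _ \<epsilon>]) simp
qed

text \<open>The norm of a covector of the dual frame is the square root of a diagonal entry of the inverse Gram matrix.\<close>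

lemma frame_coefficients_locally_bounded:
  assumes f: "(U, e) \<in> vb_frames E" "p \<in> U"
  shows "\<exists>B\<ge>0. eventually (\<lambda>q. \<forall>d. \<forall>i<r. \<bar>d i\<bar> \<le> B * fibre_norm q (\<Sum>i<r. d i *\<^sub>R e i q)) (nhds p)"
proof -
  define \<epsilon> where "\<epsilon> i q = (SOME x. x \<in> fibre q \<and> (\<forall>d. g q x (\<Sum>j<r. d j *\<^sub>R e j q) = d i))" for i q
  have \<epsilon>: "\<epsilon> i q \<in> fibre q \<and> (\<forall>d. g q (\<epsilon> i q) (\<Sum>j<r. d j *\<^sub>R e j q) = d i)" if "i < r" "q \<in> U" for i q
    unfolding \<epsilon>_def by (rule someI_ex[OF ex_dual_frame_vector[OF f(1) that(2,1)]])
  \<comment> \<open>Row \<open>i\<close> of the inverse Gram matrix: the coefficients of the dual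
    vector in the frame, smooth by \<open>gram_coefficients_smooth\<close>.\<close>
  define a where "a i k q = (SOME c. \<epsilon> i q = (\<Sum>k<r. c k *\<^sub>R e k q)) k" for i k q
  have a: "\<epsilon> i q = (\<Sum>k<r. a i k q *\<^sub>R e k q)" if "i < r" "q \<in> U" for i q
  proof -
    have "\<exists>c. \<epsilon> i q = (\<Sum>k<r. c k *\<^sub>R e k q)" using frame_expansion[OF f(1) that(2)] \<epsilon>[OF that] by blast
    then show ?thesis unfolding a_def by (rule someI_ex)
  qed
  have evU: "eventually (\<lambda>q. q \<in> U) (nhds p)" using frame_open[OF f(1)] f(2) eventually_nhds by blast
  have delta: "e j q = (\<Sum>k<r. (if k = j then 1 else 0) *\<^sub>R e k q)" if "j < r" for j q
    using that by (simp add: if_distrib[of "\<lambda>a. a *\<^sub>R _"] sum.delta cong: if_cong)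
  have "smooth_near \<A> p (a i i)" if i: "i < r" for i
  proof (rule gram_coefficients_smooth[OF f _ _ i, where s = "\<lambda>q j. if i = j then 1 else 0" and c = "a i"])
    show "smooth_near \<A> p (\<lambda>q. if i = j then 1 else 0)" for j using smooth_near_const by simp
    fix j assume j: "j < r"
    show "eventually (\<lambda>q. (if i = j then 1 else 0) = (\<Sum>k<r. a i k q * g q (e k q) (e j q))) (nhds p)"
      using evU
    proof eventually_elim
      case (elim q)
      have ej: "e j q \<in> fibre q" using frame_in_fibre[OF f(1) elim j] .
      have "g q (\<epsilon> i q) (e j q) = (if i = j then 1 else 0)"
        using conjunct2[OF \<epsilon>[OF i elim], THEN spec, of "\<lambda>k. if k = j then 1 else 0"]
        by (simp only: delta[OF j, symmetric])
      moreover have "g q (\<epsilon> i q) (e j q) = (\<Sum>k<r. a i k q * g q (e k q) (e j q))"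
        using linear_map_on_sum[OF metric_linear_left[OF ej] fibre_subspace, of "{..<r}" "\<lambda>k. e k q" "\<lambda>k. a i k q"]
          frame_in_fibre[OF f(1) elim] by (simp add: a[OF i elim])
      ultimately show ?case by simp
    qed
  qed
  then have ev: "eventually (\<lambda>q. a i i q < a i i p + 1) (nhds p)" if "i < r" for i
    using smooth_near_isCont[of p "a i i"] that
    by (intro order_tendstoD(2)[of "a i i" "a i i p"]) (auto simp: isCont_def tendsto_at_iff_tendsto_nhds)
  \<comment> \<open>Pairing with \<open>\<epsilon> i q\<close> reads off the coefficient of index
    \<open>i\<close>; applied to \<open>\<epsilon> i q\<close> itself this gives the diagonal
    entry.\<close>
  have norm: "fibre_norm q (\<epsilon> i q) = sqrt (a i i q)" if "i < r" "q \<in> U" for i q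
  proof -
    have "g q (\<epsilon> i q) (\<Sum>j<r. a i j q *\<^sub>R e j q) = a i i q"
      using conjunct2[OF \<epsilon>[OF that], THEN spec, of "\<lambda>j. a i j q"] .
    then show ?thesis by (simp only: fibre_norm_def a[OF that, symmetric])
  qed
  define B where "B = (\<Sum>i<r. sqrt \<bar>a i i p + 1\<bar>)"
  have "eventually (\<lambda>q. \<forall>i\<in>{..<r}. a i i q < a i i p + 1) (nhds p)"
    using ev by (intro eventually_ball_finite) auto
  with evU have "eventually (\<lambda>q. \<forall>d. \<forall>i<r. \<bar>d i\<bar> \<le> B * fibre_norm q (\<Sum>i<r. d i *\<^sub>R e i q)) (nhds p)"
  proof eventually_elim
    case (elim q)
    show ?case
    proof (intro allI impI)
      fix d i assume i: "i < r"
      let ?z = "\<Sum>i<r. d i *\<^sub>R e i q"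
      have z: "?z \<in> fibre q" using frame_combination_in_fibre[OF f(1) elim(1)] .
      have "g q (\<epsilon> i q) ?z = d i" using \<epsilon>[OF i elim(1)] by blast
      then have "\<bar>d i\<bar> \<le> fibre_norm q (\<epsilon> i q) * fibre_norm q ?z"
        using metric_Cauchy_Schwarz[OF conjunct1[OF \<epsilon>[OF i elim(1)]] z] by simp
      also have "\<dots> \<le> B * fibre_norm q ?z"
      proof (rule mult_right_mono[OF _ fibre_norm_nonneg[OF z]])
        have "fibre_norm q (\<epsilon> i q) \<le> sqrt \<bar>a i i p + 1\<bar>"
          unfolding norm[OF i elim(1)] using elim(2) i by (intro real_sqrt_le_mono) force
        also have "\<dots> \<le> B" unfolding B_def using i by (intro member_le_sum) auto
        finally show "fibre_norm q (\<epsilon> i q) \<le> B" .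
      qed
      finally show "\<bar>d i\<bar> \<le> B * fibre_norm q ?z" .
    qed
  qed
  moreover have "B \<ge> 0" unfolding B_def by (intro sum_nonneg) simp
  ultimately show ?thesis by blast
qed

lemma
  assumes T: "tensor_section \<A> E m T" and as: "length as = m" "set as \<subseteq> fibre p"
  shows tensor_in_fibre: "T p as \<in> fibre p"
    and tensor_linear: "i < m \<Longrightarrow> linear_map_on (fibre p) (\<lambda>a. T p (as[i := a]))"
  using assms unfolding tensor_section_def by simp_all

lemma tensor_frame_smooth:
  assumes T: "tensor_section \<A> E m T" and f: "(U, e) \<in> vb_frames E" and js: "length js = m" "set js \<subseteq> {..<r}"
  obtains c where "\<forall>i<r. smooth_fn \<A> U (c i)" "\<forall>p\<in>U. T p (map (\<lambda>i. e i p) js) = (\<Sum>i<r. c i p *\<^sub>R e i p)"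
proof -
  have "\<forall>(U, e)\<in>vb_frames E. \<forall>js. length js = m \<and> set js \<subseteq> {..<r} \<longrightarrow>
        smooth_in_frame \<A> r e U (\<lambda>p. T p (map (\<lambda>i. e i p) js))"
    using T unfolding tensor_section_def by (elim conjE) assumption
  from bspec[OF this f] have "smooth_in_frame \<A> r e U (\<lambda>p. T p (map (\<lambda>i. e i p) js))" using js by simp
  then show thesis using that unfolding smooth_in_frame_def by blast
qed

text \<open>There are finitely many frame components. The squares of their norms are smooth, hence
  bounded near \<open>p\<close>; the norms themselves need not be smooth where a component
  vanishes.\<close>

lemma tensor_frame_locally_bounded:
  assumes T: "tensor_section \<A> E m T" and f: "(U, e) \<in> vb_frames E" "p \<in> U"
  shows "\<exists>C\<ge>0. eventually (\<lambda>q. \<forall>js. length js = m \<and> set js \<subseteq> {..<r} \<longrightarrow>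
    fibre_norm q (T q (map (\<lambda>i. e i q) js)) \<le> C) (nhds p)"
proof -
  define J where "J = {js. set js \<subseteq> {..<r} \<and> length js = m}"
  have finJ: "finite J" unfolding J_def by (rule finite_lists_length_eq) simp
  define \<phi> where "\<phi> js q = g q (T q (map (\<lambda>i. e i q) js)) (T q (map (\<lambda>i. e i q) js))" for js q
  have evU: "eventually (\<lambda>q. q \<in> U) (nhds p)" using frame_open[OF f(1)] f(2) eventually_nhds by blast
  have sm: "smooth_near \<A> p (\<phi> js)" if js: "js \<in> J" for js
  proof -
    obtain c where c: "\<forall>i<r. smooth_fn \<A> U (c i)" "\<forall>q\<in>U. T q (map (\<lambda>i. e i q) js) = (\<Sum>i<r. c i q *\<^sub>R e i q)"
      using tensor_frame_smooth[OF T f(1), of js] js unfolding J_def by blast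
    have "smooth_fn \<A> U (\<lambda>q. \<Sum>i<r. c i q * (\<Sum>j<r. c j q * g q (e i q) (e j q)))"
      using c(1) by (intro smooth_fn_sum smooth_fn_mult metric_frame_smooth[OF f(1)]) auto
    then have near: "smooth_near \<A> p (\<lambda>q. \<Sum>i<r. c i q * (\<Sum>j<r. c j q * g q (e i q) (e j q)))"
      by (rule smooth_nearI[OF _ frame_open[OF f(1)] f(2)])
    show ?thesis
    proof (rule smooth_near_cong[OF near])
      show "eventually (\<lambda>q. (\<Sum>i<r. c i q * (\<Sum>j<r. c j q * g q (e i q) (e j q))) = \<phi> js q) (nhds p)"
        using evU
      proof eventually_elim
        case (elim q)
        then show ?case
          using metric_expansion[OF f(1) elim, of "\<lambda>i. c i q" "\<lambda>i. c i q"] c(2) by (simp add: \<phi>_def)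
      qed
    qed
  qed
  have ev: "eventually (\<lambda>q. \<phi> js q < \<phi> js p + 1) (nhds p)" if "js \<in> J" for js
    using smooth_near_isCont[OF sm[OF that]]
    by (intro order_tendstoD(2)[of "\<phi> js" "\<phi> js p"]) (auto simp: isCont_def tendsto_at_iff_tendsto_nhds)
  define C where "C = (\<Sum>js\<in>J. sqrt \<bar>\<phi> js p + 1\<bar>)"
  have "eventually (\<lambda>q. \<forall>js\<in>J. \<phi> js q < \<phi> js p + 1) (nhds p)"
    using ev finJ by (intro eventually_ball_finite) auto
  then have "eventually (\<lambda>q. \<forall>js. length js = m \<and> set js \<subseteq> {..<r} \<longrightarrow>
      fibre_norm q (T q (map (\<lambda>i. e i q) js)) \<le> C) (nhds p)"
  proof eventually_elim
    case (elim q)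
    show ?case
    proof (intro allI impI)
      fix js assume "length js = m \<and> set js \<subseteq> {..<r}"
      then have js: "js \<in> J" by (simp add: J_def)
      have "fibre_norm q (T q (map (\<lambda>i. e i q) js)) = sqrt (\<phi> js q)" by (simp add: fibre_norm_def \<phi>_def)
      also have "\<dots> \<le> sqrt \<bar>\<phi> js p + 1\<bar>" using elim js by (intro real_sqrt_le_mono) force
      also have "\<dots> \<le> C" unfolding C_def using js finJ by (intro member_le_sum) auto
      finally show "fibre_norm q (T q (map (\<lambda>i. e i q) js)) \<le> C" .
    qed
  qed
  moreover have "C \<ge> 0" unfolding C_def by (intro sum_nonneg) simp
  ultimately show ?thesis by blast
qed

text \<open>Arguments are expanded in the frame one by one, starting next to the tail
  \<open>js\<close> of frame vectors already inserted, hence the induction from the right. Each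
  expansion yields \<open>r\<close> terms with coefficients at most \<open>B\<close> times the norm
  of the argument, which accounts for the factor \<open>real r * B\<close>.\<close>

lemma tensor_bound_from_frame:
  assumes T: "tensor_section \<A> E m T" and f: "(U, e) \<in> vb_frames E" "q \<in> U"
    and B: "\<And>d i. i < r \<Longrightarrow> \<bar>d i\<bar> \<le> B * fibre_norm q (\<Sum>i<r. d i *\<^sub>R e i q)"
    and C: "\<And>js. length js = m \<Longrightarrow> set js \<subseteq> {..<r} \<Longrightarrow> fibre_norm q (T q (map (\<lambda>i. e i q) js)) \<le> C"
    and as: "set as \<subseteq> fibre q" "set js \<subseteq> {..<r}" "length as + length js = m"
  shows "fibre_norm q (T q (as @ map (\<lambda>i. e i q) js)) \<le> C * (real r * B) ^ length as * (\<Prod>a\<leftarrow>as. fibre_norm q a)"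
  using as
proof (induction as arbitrary: js rule: rev_induct)
  case Nil
  then show ?case using C by simp
next
  case (snoc a as)
  let ?l = "map (\<lambda>i. e i q) js"
  have a: "a \<in> fibre q" and as: "set as \<subseteq> fibre q" using snoc.prems by auto
  have ei: "e i q \<in> fibre q" if "i < r" for i using frame_in_fibre[OF f that] .
  have l: "set ?l \<subseteq> fibre q" using snoc.prems(2) ei by auto
  obtain d where d: "a = (\<Sum>i<r. d i *\<^sub>R e i q)" using frame_expansion[OF f a] .
  have len: "length (as @ a # ?l) = m" and sub: "set (as @ a # ?l) \<subseteq> fibre q" using snoc.prems l by auto
  have upd: "(as @ a # ?l)[length as := b] = as @ b # ?l" for b by simp
  have lin: "linear_map_on (fibre q) (\<lambda>b. T q (as @ b # ?l))"
    using tensor_linear[OF T len sub, of "length as"] len unfolding upd by simp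
  have inT: "T q (as @ b # ?l) \<in> fibre q" if "b \<in> fibre q" for b
    using tensor_in_fibre[OF T, of "as @ b # ?l"] that as l len by simp
  let ?P = "C * (real r * B) ^ length as * (\<Prod>a\<leftarrow>as. fibre_norm q a)"
  have "T q (as @ a # ?l) = (\<Sum>i<r. d i *\<^sub>R T q (as @ e i q # ?l))"
    using linear_map_on_sum[OF lin fibre_subspace, of "{..<r}" "\<lambda>i. e i q" d] ei d by simp
  then have "fibre_norm q (T q (as @ a # ?l)) \<le> (\<Sum>i<r. \<bar>d i\<bar> * fibre_norm q (T q (as @ e i q # ?l)))"
    using fibre_norm_sum[of "{..<r}" "\<lambda>i. T q (as @ e i q # ?l)" q d] inT ei by simp
  also have "\<dots> \<le> (\<Sum>i<r. (B * fibre_norm q a) * ?P)"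
  proof (intro sum_mono mult_mono)
    fix i assume i: "i \<in> {..<r}"
    show "\<bar>d i\<bar> \<le> B * fibre_norm q a" using B i d by simp
    show "fibre_norm q (T q (as @ e i q # ?l)) \<le> ?P"
      using snoc.IH[OF as, of "i # js"] i snoc.prems by simp
    show "0 \<le> fibre_norm q (T q (as @ e i q # ?l))" using fibre_norm_nonneg inT ei i by simp
    show "0 \<le> B * fibre_norm q a" using \<open>\<bar>d i\<bar> \<le> B * fibre_norm q a\<close> by linarith
  qed
  also have "\<dots> = C * (real r * B) ^ length (as @ [a]) * (\<Prod>a\<leftarrow>as @ [a]. fibre_norm q a)"
    by (simp add: algebra_simps)
  finally show ?case by simp
qed

lemma tensor_bounded:
  assumes cpt: "compact (UNIV :: 'm set)" and T: "tensor_section \<A> E m T"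
  shows "\<exists>C. \<forall>p as. length as = m \<and> set as \<subseteq> fibre p \<longrightarrow> fibre_norm p (T p as) \<le> C * (\<Prod>a\<leftarrow>as. fibre_norm p a)"
proof -
  let ?P = "\<lambda>C p. \<forall>as. length as = m \<and> set as \<subseteq> fibre p \<longrightarrow> fibre_norm p (T p as) \<le> C * (\<Prod>a\<leftarrow>as. fibre_norm p a)"
  have "\<exists>O' C. open O' \<and> p \<in> O' \<and> (\<forall>q\<in>O'. ?P C q)" for p
  proof -
    obtain U e where f: "(U, e) \<in> vb_frames E" "p \<in> U" using frame_at .
    obtain B where B: "eventually (\<lambda>q. \<forall>d. \<forall>i<r. \<bar>d i\<bar> \<le> B * fibre_norm q (\<Sum>i<r. d i *\<^sub>R e i q)) (nhds p)"
      using frame_coefficients_locally_bounded[OF f] by blast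
    obtain C where C: "eventually (\<lambda>q. \<forall>js. length js = m \<and> set js \<subseteq> {..<r} \<longrightarrow>
        fibre_norm q (T q (map (\<lambda>i. e i q) js)) \<le> C) (nhds p)"
      using tensor_frame_locally_bounded[OF T f] by blast
    have "eventually (\<lambda>q. q \<in> U) (nhds p)" using frame_open[OF f(1)] f(2) eventually_nhds by blast
    with B C have "eventually (?P (C * (real r * B) ^ m)) (nhds p)"
    proof eventually_elim
      case (elim q)
      then show ?case
        using tensor_bound_from_frame[OF T f(1) elim(3), of B C _ "[]"] by simp
    qed
    then show ?thesis unfolding eventually_nhds by blast
  qed
  then obtain O' C where OC: "\<And>p. open (O' p)" "\<And>p. p \<in> O' p" "\<And>p q. q \<in> O' p \<Longrightarrow> ?P (C p) q"
    by metis
  obtain D where D: "finite D" "UNIV \<subseteq> (\<Union>p\<in>D. O' p)"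
    using compactE_image[OF cpt, of UNIV O'] OC(1,2) by (metis UNIV_I UN_I subsetI)
  \<comment> \<open>A sum of absolute values dominates each local constant, whatever its
    sign.\<close>
  define M where "M = (\<Sum>p\<in>D. \<bar>C p\<bar>)"
  have "?P M q" for q
  proof (intro allI impI)
    fix as assume as: "length as = m \<and> set as \<subseteq> fibre q"
    obtain p where p: "p \<in> D" "q \<in> O' p" using D(2) by blast
    have "0 \<le> (\<Prod>a\<leftarrow>as. fibre_norm q a)"
      using as by (intro prod_list_nonneg) (auto intro: fibre_norm_nonneg)
    moreover have "C p \<le> M"
      using member_le_sum[of p D "\<lambda>p. \<bar>C p\<bar>"] p(1) D(1) by (simp add: M_def)
    ultimately have "C p * (\<Prod>a\<leftarrow>as. fibre_norm q a) \<le> M * (\<Prod>a\<leftarrow>as. fibre_norm q a)"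
      by (intro mult_right_mono)
    then show "fibre_norm q (T q as) \<le> M * (\<Prod>a\<leftarrow>as. fibre_norm q a)"
      using OC(3)[OF p(2)] as order_trans by blast
  qed
  then show ?thesis by blast
qed

end

section \<open>Comparison with the Levi-Civita connection of the interior\<close>

locale lie_infinity = metric_algebroid \<A> A g \<V> \<rho>
  for \<A> :: "('m::t2_space, 'e::euclidean_space) chart set" and A :: "('m, 'v::real_vector) vbundle" and g \<V> \<rho> +
  fixes conn :: "'m vfield \<Rightarrow> 'm vfield \<Rightarrow> 'm vfield"
  assumes compact_UNIV: "compact (UNIV :: 'm set)"
    and anchor_iso: "p \<in> mfd_interior \<A> \<Longrightarrow> bij_betw (\<rho> p) (vb_fibre A p) (tangent_space \<A> p)"
    and levi_civita: "levi_civita \<A> (mfd_interior \<A>) (induced_metric A \<rho> g) conn"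
begin

abbreviation "M\<^sub>0 \<equiv> mfd_interior \<A>"
abbreviation "int_fields \<equiv> vector_fields \<A> M\<^sub>0"
abbreviation "restr \<equiv> interior_field \<A> \<rho>"
abbreviation "\<rho>inv \<equiv> anchor_inv A \<rho>"

lemma
  assumes p: "p \<in> M\<^sub>0"
  shows anchor_inv_anchor: "a \<in> fibre p \<Longrightarrow> \<rho>inv p (\<rho> p a) = a"
    and anchor_inv_in_fibre: "v \<in> tangent_space \<A> p \<Longrightarrow> \<rho>inv p v \<in> fibre p"
    and anchor_anchor_inv: "v \<in> tangent_space \<A> p \<Longrightarrow> \<rho> p (\<rho>inv p v) = v"
  using anchor_iso[OF p] unfolding anchor_inv_def bij_betw_def
  by (auto simp: inv_into_into f_inv_into_f)

lemma restr_interior: "p \<in> M\<^sub>0 \<Longrightarrow> restr s p = \<rho> p (s p)"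
  by (simp add: interior_field_def)

lemma restr_outside: "p \<notin> M\<^sub>0 \<Longrightarrow> restr s p = 0"
  by (simp add: interior_field_def)

lemma restr_field:
  assumes s: "s \<in> sections"
  shows "restr s \<in> int_fields"
  unfolding vector_fields_def
proof (intro CollectI conjI ballI allI impI)
  show "restr s p \<in> tangent_space \<A> p" if "p \<in> M\<^sub>0" for p
    using that anchor_tangent[OF section_in_fibre[OF s]] by (simp add: restr_interior)
  show "restr s p = 0" if "p \<notin> M\<^sub>0" for p using that by (rule restr_outside)
  fix W' f assume W': "open W' \<and> W' \<subseteq> M\<^sub>0 \<and> smooth_fn \<A> W' f"
  then have "smooth_fn \<A> W' (\<lambda>p. anchor s p f)"
    using vector_field_smooth[OF anchor_vector_field[OF s]] by simp
  then show "smooth_fn \<A> W' (\<lambda>p. restr s p f)"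
    by (rule smooth_fn_cong) (use W' in \<open>auto simp: anchor_def restr_interior subset_iff\<close>)
qed

lemma restr_add: "s \<in> sections \<Longrightarrow> t \<in> sections \<Longrightarrow> restr (s + t) = restr s + restr t"
  using linear_map_on_add[OF anchor_linear section_in_fibre section_in_fibre] by (simp add: interior_field_def fun_eq_iff)

lemma restr_minus: "s \<in> sections \<Longrightarrow> restr (- s) = - restr s"
  using linear_map_on_scale[OF anchor_linear section_in_fibre, of s _ "- 1"]
  by (simp add: interior_field_def fun_eq_iff scaleR_fun_apply)

lemma restr_diff: "s \<in> sections \<Longrightarrow> t \<in> sections \<Longrightarrow> restr (s - t) = restr s - restr t"
  using restr_add[OF _ section_minus, of s t] restr_minus[of t] by simp

lemma restr_zero: "restr 0 = 0"
  using linear_map_on_zero[OF anchor_linear fibre_subspace] by (simp add: interior_field_def fun_eq_iff)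

lemma restr_sum: "(\<And>i. i \<in> I \<Longrightarrow> t i \<in> sections) \<Longrightarrow> restr (\<Sum>i\<in>I. t i) = (\<Sum>i\<in>I. restr (t i))"
  by (induction I rule: infinite_finite_induct) (simp_all add: restr_zero restr_add section_sum)

lemma eventually_interior: "p \<in> M\<^sub>0 \<Longrightarrow> eventually (\<lambda>q. q \<in> M\<^sub>0) (nhds p)"
  using open_mfd_interior eventually_nhds by blast

text \<open>The interior counterpart of \<open>sections_vanish\<close>. Near \<open>p\<close> the
  field is expanded in the images of a frame of \<open>A\<close>, which form a basis of the tangent
  space since \<open>\<rho> q\<close> is bijective there; the globalised fields are restrictions of
  sections of \<open>A\<close>.\<close>

lemma fields_vanish:
  assumes X: "X \<in> int_fields" and p: "p \<in> M\<^sub>0" and z: "X p = 0"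
  shows "\<exists>(n::nat) f t. (\<forall>i<n. smooth_fn \<A> M\<^sub>0 (f i) \<and> f i p = 0 \<and> t i \<in> int_fields) \<and>
    X = (\<Sum>i<n. (\<lambda>q. f i q *\<^sub>R t i q))"
proof -
  obtain U e where f: "(U, e) \<in> vb_frames A" "p \<in> U" using frame_at .
  have evU: "eventually (\<lambda>q. q \<in> U) (nhds p)" using frame_open[OF f(1)] f(2) eventually_nhds by blast
  have "\<exists>d. X q = (\<Sum>i<r. d i *\<^sub>R \<rho> q (e i q))" if q: "q \<in> U" "q \<in> M\<^sub>0" for q
  proof -
    have Xq: "X q \<in> tangent_space \<A> q" using vector_field_tangent[OF X q(2)] .
    obtain d where d: "\<rho>inv q (X q) = (\<Sum>i<r. d i *\<^sub>R e i q)"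
      using frame_expansion[OF f(1) q(1) anchor_inv_in_fibre[OF q(2) Xq]] .
    have "X q = \<rho> q (\<Sum>i<r. d i *\<^sub>R e i q)" using anchor_anchor_inv[OF q(2) Xq] d by simp
    then have "X q = (\<Sum>i<r. d i *\<^sub>R \<rho> q (e i q))"
      using linear_map_on_sum[OF anchor_linear fibre_subspace, of "{..<r}" "\<lambda>i. e i q"] frame_in_fibre[OF f(1) q(1)] by simp
    then show ?thesis by blast
  qed
  then obtain d where d: "\<And>q. q \<in> U \<Longrightarrow> q \<in> M\<^sub>0 \<Longrightarrow> X q = (\<Sum>i<r. d q i *\<^sub>R \<rho> q (e i q))" by metis
  define c where "c i q = d q i" for i q
  have c: "X q = (\<Sum>i<r. c i q *\<^sub>R \<rho> q (e i q))" if "q \<in> U" "q \<in> M\<^sub>0" for q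
    using d[OF that] by (simp add: c_def)
  obtain \<eta> K t where \<eta>: "smooth_fn \<A> UNIV \<eta>" "eventually (\<lambda>q. \<eta> q = 1) (nhds p)"
    "closed K" "K \<subseteq> U \<inter> UNIV" "\<forall>q. q \<notin> K \<longrightarrow> \<eta> q = 0"
    and t: "\<forall>i<r. t i \<in> sections" "\<forall>i. \<forall>q\<in>U. t i q = \<eta> q *\<^sub>R e i q" "\<forall>i q. q \<notin> U \<longrightarrow> t i q = 0"
    using cutoff_frame[OF f open_UNIV UNIV_I] .
  have indep: "d i = 0" if "(\<Sum>i<r. d i *\<^sub>R \<rho> p (e i p)) = 0" "i < r" for d i
  proof -
    let ?a = "\<Sum>i<r. d i *\<^sub>R e i p"
    have a: "?a \<in> fibre p" using frame_combination_in_fibre[OF f] .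
    have "\<rho> p ?a = 0"
      using linear_map_on_sum[OF anchor_linear fibre_subspace, of "{..<r}" "\<lambda>i. e i p" p d] frame_in_fibre[OF f] that(1) by simp
    then have "?a = \<rho>inv p 0" using anchor_inv_anchor[OF p a] by simp
    moreover have "\<rho>inv p 0 = 0"
      using anchor_inv_anchor[OF p subspace_0[OF fibre_subspace]] linear_map_on_zero[OF anchor_linear fibre_subspace] by metis
    ultimately show ?thesis using frame_coefficients_zero[OF f _ that(2)] by metis
  qed
  \<comment> \<open>Smoothness of \<open>X\<close> refers only to its action on functions, so the
    elimination runs over all functions smooth near \<open>p\<close>. The frame is replaced by the
    global sections \<open>t i\<close>, whose anchors are smooth fields; near \<open>p\<close> the
    two agree.\<close>
  have "\<forall>i<r. smooth_near \<A> p (c i)"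
  proof (rule coefficients_smooth_near[where K = "{f. smooth_near \<A> p f}" and v = "\<lambda>i q f. anchor (t i) q f" and s = X])
    show "smooth_near \<A> p (\<lambda>q. anchor (t i) q h)" if "i < r" "h \<in> {f. smooth_near \<A> p f}" for i h
      using vector_field_smooth_near[OF anchor_vector_field open_UNIV UNIV_I] t(1) that by simp
    show "smooth_near \<A> p (\<lambda>q. X q h)" if "h \<in> {f. smooth_near \<A> p f}" for h
      using vector_field_smooth_near[OF X open_mfd_interior p] that by simp
    show "eventually (\<lambda>q. X q h = (\<Sum>i<r. c i q * anchor (t i) q h)) (nhds p)" for h
      using evU eventually_interior[OF p] \<eta>(2)
    proof eventually_elim
      case (elim q)
      have "t i q = e i q" for i using t(2) elim by simp
      then show ?case unfolding c[OF elim(1,2)] by (simp add: anchor_def sum_fun_apply scaleR_fun_apply)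
    qed
    fix d :: "nat \<Rightarrow> real"
    assume d: "\<And>h. h \<in> {f. smooth_near \<A> p f} \<Longrightarrow> (\<Sum>i<r. d i * anchor (t i) p h) = 0"
    have tp: "t i p = e i p" for i using t(2) f(2) eventually_nhds_x_imp_x[OF \<eta>(2)] by simp
    have "(\<Sum>i<r. d i *\<^sub>R \<rho> p (e i p)) h = 0" for h
    proof (cases "smooth_near \<A> p h")
      case True
      then show ?thesis using d[of h] by (simp add: sum_fun_apply scaleR_fun_apply anchor_def tp)
    next
      case False
      then show ?thesis
        using tangent_nonsmooth[OF anchor_tangent[OF frame_in_fibre[OF f]] False]
        by (simp add: sum_fun_apply scaleR_fun_apply)
    qed
    then have "(\<Sum>i<r. d i *\<^sub>R \<rho> p (e i p)) = 0" by (simp add: fun_eq_iff)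
    then show "\<forall>i<r. d i = 0" using indep by blast
  qed
  then have "eventually (\<lambda>q. \<forall>i\<in>{..<r}. smooth_near \<A> q (c i)) (nhds p)"
    using eventually_smooth_near by (intro eventually_ball_finite) auto
  then have "eventually (\<lambda>q. q \<in> U \<and> q \<in> M\<^sub>0 \<and> (\<forall>i<r. smooth_near \<A> q (c i))) (nhds p)"
    using evU eventually_interior[OF p] by eventually_elim simp
  then obtain V where V: "open V" "p \<in> V" "\<And>q. q \<in> V \<Longrightarrow> q \<in> U" "\<And>q. q \<in> V \<Longrightarrow> q \<in> M\<^sub>0"
    "\<And>q i. q \<in> V \<Longrightarrow> i < r \<Longrightarrow> smooth_near \<A> q (c i)"
    unfolding eventually_nhds by metis
  have cV: "smooth_fn \<A> V (c i)" if "i < r" for i using V(5) that smooth_fn_iff_near[OF V(1)] by blast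
  obtain \<theta> L u where \<theta>: "smooth_fn \<A> UNIV \<theta>" "eventually (\<lambda>q. \<theta> q = 1) (nhds p)"
    "closed L" "L \<subseteq> U \<inter> V" "\<forall>q. q \<notin> L \<longrightarrow> \<theta> q = 0"
    and u: "\<forall>i<r. u i \<in> sections" "\<forall>i. \<forall>q\<in>U. u i q = \<theta> q *\<^sub>R e i q" "\<forall>i q. q \<notin> U \<longrightarrow> u i q = 0"
    using cutoff_frame[OF f V(1,2)] .
  show ?thesis
  proof (rule vanish_by_cutoff[OF V(1) \<theta>(3) _ \<theta>(1) _ eventually_nhds_x_imp_x[OF \<theta>(2)] _ _ X])
    show "L \<subseteq> V" using \<theta>(4) by simp
    show "\<theta> q = 0" if "q \<notin> L" for q using \<theta>(5) that by simp
    show "smooth_fn \<A> (V \<inter> M\<^sub>0) (c i)" if "i < r" for i using smooth_fn_mono[OF cV[OF that] Int_lower1] .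
    show "c i p = 0" if "i < r" for i using indep[of "\<lambda>i. c i p", OF _ that] c[OF f(2) p] z by simp
    show "restr (u i) \<in> int_fields" if "i < r" for i using u(1) that restr_field by simp
    show "\<theta> q *\<^sub>R X q = (\<Sum>i<r. c i q *\<^sub>R restr (u i) q)" if "q \<in> V" for q
    proof -
      note q = V(3,4)[OF that]
      have "restr (u i) q = \<theta> q *\<^sub>R \<rho> q (e i q)" if "i < r" for i
        using u(2) q linear_map_on_scale[OF anchor_linear frame_in_fibre[OF f(1) q(1) that]] by (simp add: restr_interior)
      then have "(\<Sum>i<r. c i q *\<^sub>R restr (u i) q) = (\<Sum>i<r. \<theta> q *\<^sub>R (c i q *\<^sub>R \<rho> q (e i q)))"
        by (intro sum.cong refl) (simp add: mult.commute)
      then show ?thesis by (simp only: c[OF q] scaleR_sum_right)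
    qed
  qed
qed

lemma
  shows conn_connection: "connection_on \<A> M\<^sub>0 int_fields (\<lambda>X f p. X p f) int_fields conn"
    and conn_torsion_free: "X \<in> int_fields \<Longrightarrow> Y \<in> int_fields \<Longrightarrow> conn X Y - conn Y X = lie_bracket \<A> X Y"
    and conn_metric: "X \<in> int_fields \<Longrightarrow> Y \<in> int_fields \<Longrightarrow> Z \<in> int_fields \<Longrightarrow> p \<in> M\<^sub>0 \<Longrightarrow>
      X p (\<lambda>q. induced_metric A \<rho> g q (Y q) (Z q)) =
      induced_metric A \<rho> g p (conn X Y p) (Z p) + induced_metric A \<rho> g p (Y p) (conn X Z p)"
  using levi_civita unfolding levi_civita_def by simp_all

lemma conn_field: "X \<in> int_fields \<Longrightarrow> Y \<in> int_fields \<Longrightarrow> conn X Y \<in> int_fields"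
  using conn_connection unfolding connection_on_def by (elim conjE) simp

lemma section_module_fields: "section_module \<A> M\<^sub>0 int_fields"
  by unfold_locales
    (rule vector_fields_zero vector_fields_add vector_fields_scale fields_vanish; assumption)+

interpretation F: section_module \<A> M\<^sub>0 int_fields
  by (rule section_module_fields)

text \<open>By torsion-freeness the bracket is a difference of two values of \<open>conn\<close>,
  which are smooth fields on the interior by assumption.\<close>

lemma lie_bracket_field: "X \<in> int_fields \<Longrightarrow> Y \<in> int_fields \<Longrightarrow> lie_bracket \<A> X Y \<in> int_fields"
  using F.section_diff[OF conn_field conn_field] conn_torsion_free by metis

lemma connection_module_fields: "connection_module \<A> M\<^sub>0 int_fields (\<lambda>X f p. X p f) conn (lie_bracket \<A>)"
proof unfold_locales
  show "connection_on \<A> M\<^sub>0 int_fields (\<lambda>X f p. X p f) int_fields conn" by (rule conn_connection)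
  show "lie_bracket \<A> X Y \<in> int_fields" if "X \<in> int_fields" "Y \<in> int_fields" for X Y using that by (rule lie_bracket_field)
  show "lie_bracket \<A> Y X = - lie_bracket \<A> X Y" for X Y by (rule lie_bracket_anti)
  fix X Y assume X: "X \<in> int_fields" and Y: "Y \<in> int_fields"
  note tangent = vector_field_tangent'[OF lie_bracket_field]
  show "lie_bracket \<A> X (Y + Z) = lie_bracket \<A> X Y + lie_bracket \<A> X Z" if Z: "Z \<in> int_fields" for Z
    by (rule lie_bracket_add[OF open_mfd_interior X Y Z tangent[OF X Y] tangent[OF X Z]])
  fix f assume f: "smooth_fn \<A> M\<^sub>0 f"
  show "smooth_fn \<A> M\<^sub>0 (\<lambda>p. X p f)" using vector_field_smooth[OF X open_mfd_interior subset_refl f] .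
  show "lie_bracket \<A> X (\<lambda>p. f p *\<^sub>R Y p) = (\<lambda>p. f p *\<^sub>R lie_bracket \<A> X Y p + X p f *\<^sub>R Y p)"
    by (rule lie_bracket_scale[OF open_mfd_interior X Y f tangent[OF X Y]])
  show "lie_bracket \<A> X Y p f = X p (\<lambda>p. Y p f) - Y p (\<lambda>p. X p f)" for p
  proof (cases "p \<in> M\<^sub>0")
    case True
    then show ?thesis using lie_bracket_act(1)[OF X Y True smooth_nearI[OF f open_mfd_interior]] by simp
  next
    case False
    then show ?thesis
      using lie_bracket_act(2)[OF X Y] vector_field_outside[OF X] vector_field_outside[OF Y] by simp
  qed
qed

interpretation F: connection_module \<A> M\<^sub>0 int_fields "\<lambda>X f p. X p f" conn "lie_bracket \<A>"
  by (rule connection_module_fields)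

text \<open>Functions built from restricted fields agree with their counterparts on the manifold
  only over the interior. As the interior is open, the germs at \<open>p\<close> coincide, and germs
  are all that a tangent vector sees.\<close>

lemma restr_act:
  assumes X: "X \<in> sections" and p: "p \<in> M\<^sub>0" and f: "smooth_near \<A> p f"
    and eq: "\<And>q. q \<in> M\<^sub>0 \<Longrightarrow> f q = h q"
  shows "restr X p h = \<rho> p (X p) f"
proof -
  have "eventually (\<lambda>q. f q = h q) (nhds p)"
    using eventually_interior[OF p] by eventually_elim (rule eq)
  then have "\<rho> p (X p) f = \<rho> p (X p) h"
    by (rule tangent_cong[OF anchor_tangent[OF section_in_fibre[OF X]] f])
  then show ?thesis using p by (simp add: restr_interior)
qed

lemma restr_bracket:
  assumes X: "X \<in> sections" and Y: "Y \<in> sections"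
  shows "restr (bracket X Y) = lie_bracket \<A> (restr X) (restr Y)"
proof (intro ext)
  fix p f
  note XY = restr_field[OF X] restr_field[OF Y]
  show "restr (bracket X Y) p f = lie_bracket \<A> (restr X) (restr Y) p f"
  proof (cases "p \<in> M\<^sub>0")
    case False
    then show ?thesis using lie_bracket_act(2)[OF XY] by (simp add: restr_outside)
  next
    case p: True
    show ?thesis
    proof (cases "smooth_near \<A> p f")
      case False
      then show ?thesis
        using tangent_nonsmooth[OF vector_field_tangent'[OF restr_field[OF bracket_closed[OF X Y]]] False]
        by (simp add: lie_bracket_def)
    next
      case True
      have "restr S p (\<lambda>q. restr T q f) = anchor S p (\<lambda>q. anchor T q f)" if "S \<in> sections" "T \<in> sections" for S T
        using restr_act[OF that(1) p vector_field_smooth_near[OF anchor_vector_field[OF that(2)] open_UNIV UNIV_I True], of "\<lambda>q. restr T q f"]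
        by (simp add: anchor_def restr_interior)
      moreover have "restr (bracket X Y) p f = anchor (bracket X Y) p f" using p by (simp add: anchor_def restr_interior)
      ultimately show ?thesis
        using lie_bracket_act(1)[OF XY p True] X Y
          lie_bracket_act(1)[OF anchor_vector_field[OF X] anchor_vector_field[OF Y] UNIV_I True]
        by (simp add: anchor_bracket)
    qed
  qed
qed

lemma restr_connection:
  assumes X: "X \<in> sections" and Y: "Y \<in> sections"
  shows "restr (connection X Y) = conn (restr X) (restr Y)"
proof
  fix p
  note XY = conn_field[OF restr_field[OF X] restr_field[OF Y]]
  show "restr (connection X Y) p = conn (restr X) (restr Y) p"
  proof (cases "p \<in> M\<^sub>0")
    case False
    then show ?thesis using vector_field_outside[OF XY] by (simp add: restr_outside)
  next
    case p: True
    \<comment> \<open>The Levi-Civita derivative at \<open>p\<close>, carried back to the fibre of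
      \<open>A\<close>. It satisfies the metric and torsion identities against global sections,
      which is what the Koszul argument uses.\<close>
    define c where "c S T = \<rho>inv p (conn (restr S) (restr T) p)" for S T
    have tan: "conn (restr S) (restr T) p \<in> tangent_space \<A> p" if "S \<in> sections" "T \<in> sections" for S T
      using vector_field_tangent[OF conn_field[OF restr_field restr_field] p] that .
    have c: "c S T \<in> fibre p" "\<rho> p (c S T) = conn (restr S) (restr T) p" if "S \<in> sections" "T \<in> sections" for S T
      unfolding c_def using anchor_inv_in_fibre[OF p tan[OF that]] anchor_anchor_inv[OF p tan[OF that]] by simp_all
    have metric: "act S (\<lambda>q. g q (T q) (V q)) p = g p (c S T) (V p) + g p (T p) (c S V)"
      if S: "S \<in> sections" and T: "T \<in> sections" and V: "V \<in> sections" for S T V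
    proof -
      have inv: "\<rho>inv q (restr T q) = T q" if "T \<in> sections" "q \<in> M\<^sub>0" for T q
        using anchor_inv_anchor[OF that(2) section_in_fibre[OF that(1)]] that(2) by (simp add: restr_interior)
      have "act S (\<lambda>q. g q (T q) (V q)) p = restr S p (\<lambda>q. induced_metric A \<rho> g q (restr T q) (restr V q))"
        unfolding act_def
        by (rule restr_act[OF S p smooth_nearI[OF metric_smooth[OF T V] open_UNIV UNIV_I], symmetric])
          (simp add: induced_metric_def inv T V)
      then show ?thesis
        using conn_metric[OF restr_field[OF S] restr_field[OF T] restr_field[OF V] p] inv[OF T p] inv[OF V p]
        by (simp add: induced_metric_def c_def)
    qed
    have torsion: "g p (bracket S T p) z = g p (c S T) z - g p (c T S) z"
      if S: "S \<in> sections" and T: "T \<in> sections" and z: "z \<in> fibre p" for S T z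
    proof -
      have d: "c S T - c T S \<in> fibre p" using subspace_diff[OF fibre_subspace] c S T by blast
      have "\<rho> p (c S T - c T S) = \<rho> p (bracket S T p)"
        using linear_map_on_diff[OF anchor_linear fibre_subspace c(1)[OF S T] c(1)[OF T S]] c(2) S T
          fun_cong[OF conn_torsion_free[OF restr_field[OF S] restr_field[OF T]], of p]
          fun_cong[OF restr_bracket[OF S T], of p] p
        by (simp add: restr_interior)
      from arg_cong[OF this, of "\<rho>inv p"] have "c S T - c T S = bracket S T p"
        unfolding anchor_inv_anchor[OF p d] anchor_inv_anchor[OF p section_in_fibre[OF bracket_closed[OF S T]]] .
      then show ?thesis
        using linear_map_on_diff[OF metric_linear_left[OF z] fibre_subspace c(1)[OF S T] c(1)[OF T S]] by simp
    qed
    have "connection X Y p = c X Y"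
    proof (rule connection_eqI[OF X Y c(1)[OF X Y]])
      fix Z assume Z: "Z \<in> sections"
      have comm: "g p (S p) (c T V) = g p (c T V) (S p)" if "S \<in> sections" "T \<in> sections" "V \<in> sections" for S T V
        using metric_commute[OF section_in_fibre[OF that(1)] c(1)[OF that(2,3)]] .
      \<comment> \<open>Add the metric identities for \<open>X Y Z\<close> and \<open>Y X Z\<close>,
        subtract the one for \<open>Z X Y\<close>, and replace brackets by torsion; everything
        except twice \<open>g p (c X Y) (Z p)\<close> cancels.\<close>
      show "g p (c X Y) (Z p) = koszul X Y Z p / 2"
        unfolding koszul_def
        using metric[OF X Y Z] metric[OF Y X Z] metric[OF Z X Y] torsion[OF X Y section_in_fibre[OF Z, of p]]
          torsion[OF X Z section_in_fibre[OF Y, of p]] torsion[OF Y Z section_in_fibre[OF X, of p]]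
          comm[OF Y X Z] comm[OF X Y Z] comm[OF X Z Y]
        by simp
    qed
    then show ?thesis using c(2)[OF X Y] p by (simp add: restr_interior)
  qed
qed

text \<open>Restriction is additive and intertwines both the brackets and the connections, the only
  ingredients of \<open>derived_curvature\<close>.\<close>

lemma restr_derived_curvature:
  assumes "length ss = k + 3" "set ss \<subseteq> sections"
  shows "derived_curvature (lie_bracket \<A>) conn k (map restr ss) = restr (derived_curvature bracket connection k ss)"
  using assms
proof (induction k arbitrary: ss)
  case 0
  then obtain X Y Z where ss: "ss = [X, Y, Z]" and XYZ: "X \<in> sections" "Y \<in> sections" "Z \<in> sections"
    by (auto simp: numeral_3_eq_3 length_Suc_conv)
  have "curvature_of (lie_bracket \<A>) conn (restr X) (restr Y) (restr Z) = restr (curvature_of bracket connection X Y Z)"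
    unfolding curvature_of_def using XYZ
    by (simp only: restr_diff restr_connection restr_bracket connection_closed bracket_closed section_diff)
  then show ?case by (simp add: ss)
next
  case (Suc k)
  then have "ss \<noteq> []" by auto
  then obtain x xs where ss: "ss = x # xs" by (cases ss) auto
  then have x: "x \<in> sections" and xs: "length xs = k + 3" "set xs \<subseteq> sections" using Suc.prems by simp_all
  let ?R = "derived_curvature bracket connection k"
  have upd: "length (xs[i := s]) = k + 3" "set (xs[i := s]) \<subseteq> sections" if "s \<in> sections" for i s
    using xs(1) by (simp, intro subset_trans[OF set_update_subset_insert]) (use that xs in simp)
  have xsi: "xs ! i \<in> sections" if "i < k + 3" for i using that xs nth_mem by (metis subsetD)
  have closed: "?R us \<in> sections" if "length us = k + 3" "set us \<subseteq> sections" for us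
    using multitensorial_closed[OF multitensorial_derived_curvature that] .
  have sum: "(\<Sum>i<k + 3. derived_curvature (lie_bracket \<A>) conn k ((map restr xs)[i := conn (restr x) (map restr xs ! i)])) =
      (\<Sum>i<k + 3. restr (?R (xs[i := connection x (xs ! i)])))"
  proof (intro sum.cong refl)
    fix i assume "i \<in> {..<k + 3}"
    then have i: "i < k + 3" by simp
    have "(map restr xs)[i := conn (restr x) (map restr xs ! i)] = map restr (xs[i := connection x (xs ! i)])"
      using i xs x xsi[OF i] by (simp add: map_update restr_connection)
    then show "derived_curvature (lie_bracket \<A>) conn k ((map restr xs)[i := conn (restr x) (map restr xs ! i)]) =
        restr (?R (xs[i := connection x (xs ! i)]))"
      using Suc.IH[OF upd[OF connection_closed[OF x xsi[OF i]]]] by simp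
  qed
  have sec: "?R (xs[i := connection x (xs ! i)]) \<in> sections" if "i < k + 3" for i
    using closed upd connection_closed x xsi[OF that] by blast
  have "restr (derived_curvature bracket connection (Suc k) ss) =
      restr (connection x (?R xs)) - restr (\<Sum>i<k + 3. ?R (xs[i := connection x (xs ! i)]))"
    using restr_diff[OF connection_closed[OF x closed[OF xs]] section_sum[of "{..<k + 3}"], OF sec] xs
    by (simp add: ss covariant_derivative_def)
  also have "\<dots> = conn (restr x) (restr (?R xs)) - (\<Sum>i<k + 3. restr (?R (xs[i := connection x (xs ! i)])))"
    using restr_sum[of "{..<k + 3}", OF sec] by (simp add: restr_connection[OF x closed[OF xs]])
  also have "\<dots> = derived_curvature (lie_bracket \<A>) conn (Suc k) (map restr ss)"
    using sum Suc.IH[OF xs] xs by (simp add: ss covariant_derivative_def)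
  finally show ?case by simp
qed

text \<open>Fields on the interior need not extend to the boundary, so \<open>FN\<close>, which
  concerns restrictions of sections, does not apply to them directly. Tensoriality over functions on
  the interior allows them to be exchanged, at one point at a time, for restrictions of sections
  with the same values.\<close>

lemma extends_tensorI:
  assumes T: "\<And>ss p. length ss = m \<Longrightarrow> set ss \<subseteq> sections \<Longrightarrow> T p (map (\<lambda>s. s p) ss) = N ss p"
    and F: "F.multitensorial m F"
    and FN: "\<And>ss. length ss = m \<Longrightarrow> set ss \<subseteq> sections \<Longrightarrow> F (map restr ss) = restr (N ss)"
  shows "extends_tensor \<A> A \<rho> m T F"
  unfolding extends_tensor_def
proof (intro allI impI ballI, elim conjE)
  fix Xs p assume Xs: "length Xs = m" "set Xs \<subseteq> int_fields" and p: "p \<in> M\<^sub>0"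
  have "\<exists>s. s \<in> sections \<and> s p = \<rho>inv p (X p)" if "X \<in> set Xs" for X
  proof -
    have "X p \<in> tangent_space \<A> p" using vector_field_tangent Xs(2) that p by blast
    then obtain s where "s \<in> sections" "s p = \<rho>inv p (X p)"
      using section_through[OF anchor_inv_in_fibre[OF p]] by blast
    then show ?thesis by blast
  qed
  then obtain sec where sec: "\<And>X. X \<in> set Xs \<Longrightarrow> sec X \<in> sections \<and> sec X p = \<rho>inv p (X p)" by metis
  let ?ss = "map sec Xs"
  have ss: "length ?ss = m" "set ?ss \<subseteq> sections" using Xs sec by auto
  have "F Xs p = F (map restr ?ss) p"
  proof (rule F.multitensorial_pointwise[OF F Xs _ _ p])
    show "length (map restr ?ss) = m" using Xs by simp
    show "set (map restr ?ss) \<subseteq> int_fields" using ss(2) restr_field by auto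
    show "map (\<lambda>X. X p) Xs = map (\<lambda>X. X p) (map restr ?ss)"
      using sec Xs(2) anchor_anchor_inv[OF p vector_field_tangent[OF _ p]] p
      by (auto simp: restr_interior subset_iff)
  qed
  also have "\<dots> = \<rho> p (N ?ss p)" using FN[OF ss] p by (simp add: restr_interior)
  also have "N ?ss p = T p (map (\<lambda>s. s p) ?ss)" using T[OF ss] by simp
  also have "map (\<lambda>s. s p) ?ss = map (\<lambda>X. \<rho>inv p (X p)) Xs" using sec by simp
  finally show "F Xs p = \<rho> p (T p (map (\<lambda>X. \<rho>inv p (X p)) Xs))" .
qed

section \<open>Extension of the connection, of the curvature and of its derivatives;
  boundedness\<close>

theorem connection_extends:
  "A_connection \<A> A \<rho> connection \<and> extends_connection \<A> A \<rho> connection conn"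
proof
  show "A_connection \<A> A \<rho> connection"
    using connection_on_connection unfolding A_connection_def act_def[abs_def] .
  show "extends_connection \<A> A \<rho> connection conn"
    unfolding extends_connection_def using restr_connection by blast
qed

theorem curvature_endomorphism_extends:
  assumes X: "X \<in> sections" and Y: "Y \<in> sections"
  shows "\<exists>T. endomorphism_section \<A> A T \<and>
    extends_tensor \<A> A \<rho> 1 T (\<lambda>Zs. curvature \<A> conn (restr X) (restr Y) (hd Zs))"
proof -
  have N: "multitensorial 1 (\<lambda>ss. curvature_of bracket connection X Y (hd ss))"
    by (rule multitensorial_single[OF curvature_tensorial_right[OF X Y] curvature_closed[OF X Y]])
  obtain T where T: "tensor_section \<A> A 1 T"
    "\<And>ss p. length ss = 1 \<Longrightarrow> set ss \<subseteq> sections \<Longrightarrow> T p (map (\<lambda>s. s p) ss) = curvature_of bracket connection X Y (hd ss) p"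
    using tensor_of_multitensorial[OF N] by blast
  note XY = restr_field[OF X] restr_field[OF Y]
  have "extends_tensor \<A> A \<rho> 1 T (\<lambda>Zs. curvature \<A> conn (restr X) (restr Y) (hd Zs))"
  proof (rule extends_tensorI[where N = "\<lambda>ss. curvature_of bracket connection X Y (hd ss)", OF T(2)])
    show "F.multitensorial 1 (\<lambda>Zs. curvature \<A> conn (restr X) (restr Y) (hd Zs))"
      unfolding curvature_eq
      by (rule F.multitensorial_single[OF F.curvature_tensorial_right[OF XY] F.curvature_closed[OF XY]])
    fix ss assume "length ss = 1" "set ss \<subseteq> sections"
    then obtain Z where ss: "ss = [Z]" and Z: "Z \<in> sections" by (auto simp: length_Suc_conv)
    show "curvature \<A> conn (restr X) (restr Y) (hd (map restr ss)) = restr (curvature_of bracket connection X Y (hd ss))"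
      using restr_derived_curvature[of "[X, Y, Z]" 0] X Y Z by (simp add: ss curvature_eq)
  qed
  then show ?thesis using T(1) unfolding endomorphism_section_def by blast
qed

theorem nabla_curvature_extends:
  "\<exists>T. curvature_type_section \<A> A k T \<and> extends_tensor \<A> A \<rho> (k + 3) T (nabla_curvature \<A> conn k)"
proof -
  let ?N = "derived_curvature bracket connection k"
  obtain T where T: "tensor_section \<A> A (k + 3) T"
    "\<And>ss p. length ss = k + 3 \<Longrightarrow> set ss \<subseteq> sections \<Longrightarrow> T p (map (\<lambda>s. s p) ss) = ?N ss p"
    using tensor_of_multitensorial[OF multitensorial_derived_curvature[of k]] by blast
  have "curvature_type_section \<A> A k T"
    unfolding curvature_type_section_def
  proof (intro conjI allI ballI impI T(1))
    fix p as a b c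
    assume abc: "a \<in> fibre p" "b \<in> fibre p" "c \<in> fibre p" and as: "length as = k \<and> set as \<subseteq> fibre p"
    obtain X where X: "X \<in> sections" "X p = a" using section_through[OF abc(1)] .
    obtain Y where Y: "Y \<in> sections" "Y p = b" using section_through[OF abc(2)] .
    obtain Z where Z: "Z \<in> sections" "Z p = c" using section_through[OF abc(3)] .
    have "\<exists>s. s \<in> sections \<and> s p = x" if "x \<in> set as" for x
      using section_through[of x p] as that by blast
    then obtain sec where sec: "\<And>x. x \<in> set as \<Longrightarrow> sec x \<in> sections \<and> sec x p = x" by metis
    let ?ss = "map sec as"
    have ss: "length ?ss = k" "set ?ss \<subseteq> sections" using as sec by auto
    have "map (\<lambda>s. s p) ?ss = as" using sec by (auto simp: comp_def intro!: map_idI)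
    then have "T p (as @ [a, b, c]) = ?N (?ss @ [X, Y, Z]) p" "T p (as @ [b, a, c]) = ?N (?ss @ [Y, X, Z]) p"
      using T(2)[of "?ss @ [X, Y, Z]" p] T(2)[of "?ss @ [Y, X, Z]" p] ss X Y Z by simp_all
    then show "T p (as @ [a, b, c]) = - T p (as @ [b, a, c])"
      using derived_curvature_anti[OF ss X(1) Y(1) Z(1)] by simp
  qed
  moreover have "extends_tensor \<A> A \<rho> (k + 3) T (nabla_curvature \<A> conn k)"
  proof (rule extends_tensorI[where N = ?N, OF T(2)])
    have "nabla_curvature \<A> conn k = derived_curvature (lie_bracket \<A>) conn k"
      by (intro ext) (simp only: nabla_curvature_eq)
    then show "F.multitensorial (k + 3) (nabla_curvature \<A> conn k)"
      using F.multitensorial_derived_curvature[of k] by simp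
    show "nabla_curvature \<A> conn k (map restr ss) = restr (?N ss)" if "length ss = k + 3" "set ss \<subseteq> sections" for ss
      unfolding nabla_curvature_eq by (rule restr_derived_curvature[OF that])
  qed
  ultimately show ?thesis by blast
qed

text \<open>The induced norm at an interior point is by definition the fibre norm of
  \<open>A\<close> after inverting the anchor, so the uniform bound for \<open>T\<close> over the
  compact manifold carries over with the same constant.\<close>

theorem bounded_extended_tensor:
  assumes T: "tensor_section \<A> A m T" and ext: "extends_tensor \<A> A \<rho> m T F"
  shows "bounded_tensor \<A> M\<^sub>0 (induced_metric A \<rho> g) m F"
proof -
  obtain C where C: "\<And>p as. length as = m \<Longrightarrow> set as \<subseteq> fibre p \<Longrightarrow> fibre_norm p (T p as) \<le> C * (\<Prod>a\<leftarrow>as. fibre_norm p a)"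
    using tensor_bounded[OF compact_UNIV T] by blast
  show ?thesis
    unfolding bounded_tensor_def
  proof (intro exI[of _ C] ballI allI impI, elim conjE)
    fix p Xs assume p: "p \<in> M\<^sub>0" and Xs: "length Xs = m" "set Xs \<subseteq> int_fields"
    let ?as = "map (\<lambda>X. \<rho>inv p (X p)) Xs"
    have as: "length ?as = m" "set ?as \<subseteq> fibre p"
      using Xs anchor_inv_in_fibre[OF p vector_field_tangent[OF _ p]] by auto
    have "F Xs p = \<rho> p (T p ?as)" using ext Xs p unfolding extends_tensor_def by blast
    then have "sqrt (induced_metric A \<rho> g p (F Xs p) (F Xs p)) = fibre_norm p (T p ?as)"
      using anchor_inv_anchor[OF p tensor_in_fibre[OF T as]] by (simp add: induced_metric_def fibre_norm_def)
    also have "\<dots> \<le> C * (\<Prod>a\<leftarrow>?as. fibre_norm p a)" by (rule C[OF as])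
    also have "(\<Prod>a\<leftarrow>?as. fibre_norm p a) = (\<Prod>X\<leftarrow>Xs. sqrt (induced_metric A \<rho> g p (X p) (X p)))"
      by (simp add: induced_metric_def fibre_norm_def comp_def)
    finally show "sqrt (induced_metric A \<rho> g p (F Xs p) (F Xs p)) \<le> C * (\<Prod>X\<leftarrow>Xs. sqrt (induced_metric A \<rho> g p (X p) (X p)))" .
  qed
qed

end

theorem corollary3p3:
  fixes \<A> :: "('m::t2_space, 'e::euclidean_space) chart set"
    and \<V> :: "'m vfield set"
    and A :: "('m, 'v::real_vector) vbundle"
    and \<rho> :: "'m \<Rightarrow> 'v \<Rightarrow> 'm tvec"
    and g :: "'m \<Rightarrow> 'v \<Rightarrow> 'v \<Rightarrow> real"
    and conn :: "'m vfield \<Rightarrow> 'm vfield \<Rightarrow> 'm vfield"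
  assumes "lie_structure_at_infinity \<A> \<V> A \<rho>"
    and "bundle_metric \<A> A g"
    and "levi_civita \<A> (mfd_interior \<A>) (induced_metric A \<rho> g) conn"
  shows "(\<exists>D. A_connection \<A> A \<rho> D \<and> extends_connection \<A> A \<rho> D conn) \<and>
    (\<forall>X\<in>smooth_sections \<A> A. \<forall>Y\<in>smooth_sections \<A> A. \<exists>T.
       endomorphism_section \<A> A T \<and>
       extends_tensor \<A> A \<rho> 1 T
         (\<lambda>Zs. curvature \<A> conn (interior_field \<A> \<rho> X) (interior_field \<A> \<rho> Y) (hd Zs))) \<and>
    (\<forall>k. \<exists>T. curvature_type_section \<A> A k T \<and>
       extends_tensor \<A> A \<rho> (k + 3) T (nabla_curvature \<A> conn k)) \<and>
    (\<forall>k. bounded_tensor \<A> (mfd_interior \<A>) (induced_metric A \<rho> g) (k + 3)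
       (nabla_curvature \<A> conn k))"
proof -
  have "corner_atlas \<A>" "vector_bundle \<A> A" "structural_lie_algebra \<A> \<V>" "is_lie_algebroid_of \<A> \<V> A \<rho>"
    "compact (UNIV :: 'm set)" "\<And>p. p \<in> mfd_interior \<A> \<Longrightarrow> bij_betw (\<rho> p) (vb_fibre A p) (tangent_space \<A> p)"
    using assms(1) unfolding lie_structure_at_infinity_def manifold_with_corners_def is_lie_algebroid_of_def by simp_all
  with assms(2,3) interpret lie_infinity \<A> A g \<V> \<rho> conn
    by unfold_locales
  have "bounded_tensor \<A> (mfd_interior \<A>) (induced_metric A \<rho> g) (k + 3) (nabla_curvature \<A> conn k)" for k
  proof -
    obtain T where T: "curvature_type_section \<A> A k T" "extends_tensor \<A> A \<rho> (k + 3) T (nabla_curvature \<A> conn k)"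
      using nabla_curvature_extends by blast
    then show ?thesis using bounded_extended_tensor unfolding curvature_type_section_def by blast
  qed
  then show ?thesis
    using connection_extends curvature_endomorphism_extends nabla_curvature_extends by blast
qed

end
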